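(* Let $\Gamma$ be a discrete group acting on a unital C$^*$-algebra $\mathcal A$ through an action $\alpha$. Suppose that $\mathcal A\rtimes_r\Gamma$ is $\mathcal A$-$\Gamma$-nuclear (as an $\mathcal A$-$\Gamma$-module or as an $\mathcal A$-$\Gamma$-comodule). Then $\mathcal A$ is exact if and only if $\mathcal A\rtimes_r\Gamma$ is exact.
   Context: Abbreviations: c.p. = completely positive, c.c.p. = contractive completely positive. $\otimes$ always denotes the minimal tensor product. Setting. $\Gamma$ is a discrete group with identity $e$, acting by automorphisms $\alpha_s$ ($s\in\Gamma$) on a unital C$^*$-algebra $\mathcal A$. In the reduced crossed product $\mathcal A\rtimes_r\Gamma$ we identify $\mathcal A$ and $\Gamma$ with their canonical images, so $sas^{-1}=\alpha_s(a)$ and the elements $as$ ($a\in\mathcal A$, $s\in\Gamma$) are total. $\lambda$ is the left regular representation of $\Gamma$, generating $C^*_r(\Gamma)$. Notation. $\Gamma^\infty=\bigcup_{n\ge1}\Gamma^n$ (union of all finite Cartesian powers). For $t=(t_1,\dots,t_\ell)\in\Gamma^\infty$ and $r\in\Gamma$ put $\bar t=t_1\cdots t_\ell\in\Gamma$ and $rt=(rt_1,t_2,\dots,t_\ell)$. Let $e_{s,t}$ be the matrix units of $\mathbb B(\ell^2(\Gamma^\infty))$. For finite $F\subseteq\Gamma^\infty$, $P_F$ is the orthogonal projection onto $\ell^2(F)$, and $\mathbb M_F(\mathcal A)=\mathrm{span}\{a\otimes e_{s,t}:a\in\mathcal A,\ s,t\in F\}\subseteq\mathcal A\otimes\mathbb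 B(\ell^2(\Gamma^\infty))$. Modules and comodules. An operator $\mathcal A$-$\Gamma$-module is an operator system $\mathcal B$ with a $\Gamma$-action $\beta$ by surjective complete isometries and a right $\mathcal A$-module action such that $\beta_t(b\cdot a)=\beta_t(b)\cdot\alpha_t(a)$ (for a C$^*$-algebra $\mathcal B$, $\Gamma$ acts by automorphisms). An operator $\mathcal A$-$\Gamma$-comodule is an operator system $\mathcal B$ with a coaction $\delta_{\mathcal B}:\mathcal B\to\mathcal B\otimes C^*_r(\Gamma)$ (a non-degenerate c.p. map, a homomorphism when $\mathcal B$ is a C$^*$-algebra), a coaction $\delta_{\mathcal A}:\mathcal A\to\mathcal A\otimes C^*_r(\Gamma)$ (a non-degenerate homomorphism), and a right $\mathcal A$-module structure with $\delta_{\mathcal B}(b\cdot a)=\delta_{\mathcal B}(b)\cdot\delta_{\mathcal A}(a)$. Here $\delta_{\mathcal A}(a)=a\otimes\lambda_e$. Structures used. On $\mathcal A\rtimes_r\Gamma$: right multiplication by $\mathcal A$, the action $r\cdot x=rxr^{-1}$, and the coaction $\delta(as)=as\otimes\lambda_s$. On $\mathcal A\otimes\mathbb B(\ell^2(\Gamma^\infty))$: the module action and $\Gamma$-action extending $(a\otimes e_{s,t})\cdot b=(a\otimes e_{s,t})\pi(b)=a\alpha_{\bar t^{-1}}(b)\otimes e_{s,t}$, where $\pi(b)=\sum_{s\in\Gamma^\infty}\alpha_{\bar s^{-1}}(b)\otimes e_{s,s}$, and $r\cdot(a\otimes e_{s,t})=U_r(a\otimes e_{s,t})U_r^*=a\otimes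 e_{rs,rt}$, where $U_r\delta_s=\delta_{rs}$. Each $\mathbb M_F(\mathcal A)$ gets its $\mathcal A$-module structure as a subspace, and $r\cdot\mathbb M_F(\mathcal A)=\mathbb M_{rF}(\mathcal A)$. In the comodule case $\mathcal A\otimes\mathbb B(\ell^2(\Gamma^\infty))$ is regarded as an $\mathcal A$-$\Gamma$-comodule whose coaction is given on each $\mathbb M_F(\mathcal A)$ by $\delta_F(a\otimes e_{s,t})=(a\otimes\lambda_{\bar s\bar t^{-1}})\otimes e_{s,t}$, with $\mathbb M_F(\mathcal A)\otimes C^*_r(\Gamma)$ identified with $\mathbb M_F(\mathcal A\otimes C^*_r(\Gamma))$. $\mathcal A$-admissible maps. For operator systems $\mathcal B,\mathcal D$ with right $\mathcal A$-module structures, the class of $\mathcal A$-admissible c.p. maps is determined by the rules: (1) every c.p. $\mathcal A$-module map $\mathcal B\to\mathcal D$ is $\mathcal A$-admissible; (2) if $\varphi:\mathcal B\to\mathcal D$ is $\mathcal A$-admissible, so are $x\mapsto\varphi(bxb^* )$ and $x\mapsto d\varphi(x)d^*$ for $b\in\mathcal B$, $d\in\mathcal D$; (3) the maps $x\mapsto\rho(x)d$ with $\rho$ a positive functional on $\mathcal B$ and $d\in\mathcal D^+$ are $\mathcal A$-admissible; (4) compositions, positive multiples and finite sums of $\mathcal A$-admissible maps are $\mathcal A$-admissible. $\Gamma$-families. Let $\mathcal B,\mathcal D$ have $\Gamma$-actions $\alpha^{\mathcal B},\alpha^{\mathcal D}$. A $\Gamma$-family of operator subsystems of $\mathcal B$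 is a family $\{\mathcal B_i\}_{i\in I}$ with an action of $\Gamma$ on $I$ such that $\alpha^{\mathcal B}_t(\mathcal B_i)\subseteq\mathcal B_{t\cdot i}$. A $\Gamma$-family of maps on it is a family of c.p. maps $\psi_i:\mathcal B_i\to\mathcal D$ with $\psi_{t\cdot i}(\alpha^{\mathcal B}_t(b))=\alpha^{\mathcal D}_t(\psi_i(b))$. For $\{\mathbb M_F(\mathcal A)\}_F$ the index set is the set of finite subsets of $\Gamma^\infty$ with action $F\mapsto rF$. $\Gamma$-cofamilies. Let $\mathcal B,\mathcal D$ have coactions $\delta_{\mathcal B},\delta_{\mathcal D}$. A $\Gamma$-cofamily of operator subsystems of $\mathcal B$ is a family $\{\mathcal B_i\}_{i\in I}$ with a map $\delta:I\to I$ such that $\delta_{\mathcal B}(\mathcal B_i)\subseteq\mathcal B_{\delta(i)}\otimes C^*_r(\Gamma)$. A $\Gamma$-cofamily of maps on it is a family of c.p. maps $\psi_i:\mathcal B_i\to\mathcal D$ with $(\psi_{\delta(i)}\otimes\mathrm{id})(\delta_{\mathcal B}(b))=\delta_{\mathcal D}(\psi_i(b))$. (Co)admissible families. The class of $\Gamma$-admissible families of c.p. maps is determined by: (i) every $\Gamma$-family of maps is $\Gamma$-admissible; (ii) a $\Gamma$-admissible family $\{\psi_i:\mathcal B_i\to\mathcal D\}_{i\in I}$ stays so if one adds $x\mapsto\psi_i(bxb^* )$ or $x\mapsto d\psi_i(x)d^*$ ($b\in\mathcal B$, $d\in\mathcal D$), or a finite sum of maps in the family, or $x\mapsto\alpha^{\mathcal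 D}_t(\psi_i(x))$ or $x\mapsto\psi_{t\cdot i}(\alpha^{\mathcal B}_t(x))$ ($t\in\Gamma$); (iii) for $\Gamma$-admissible families $\{\phi_i:\mathcal B_i\to\mathcal D\}$, $\{\psi_j:\mathcal D_j\to\mathcal C\}$, the family of all $\psi_j\circ\phi_i$ with $\phi_i(\mathcal B_i)\subseteq\mathcal D_j$ is $\Gamma$-admissible; (iv) the union of two $\Gamma$-admissible families is $\Gamma$-admissible. $\Gamma$-coadmissible families of c.p. maps are determined by the same rules with $\Gamma$-cofamilies in (i) and with the last pair of maps in (ii) replaced by $x\mapsto(\mathrm{id}\otimes f)\delta_{\mathcal D}(\psi_i(x))$ or $x\mapsto\psi_{\delta(i)}((\mathrm{id}\otimes f)\delta_{\mathcal B}(x))$, $f\in C^*_r(\Gamma)^*$. A family is (co)admissible if it is $\Gamma$-(co)admissible and all its members are $\mathcal A$-admissible; a single map is (co)admissible if it belongs to a (co)admissible family. Nuclearity. $\mathcal B=\mathcal A\rtimes_r\Gamma$ is $\mathcal A$-$\Gamma$-nuclear as an $\mathcal A$-$\Gamma$-module (respectively, comodule) if for every $\varepsilon>0$ and finite $S\subseteq\mathcal B$ there are an admissible (respectively, coadmissible) c.c.p. map $\varphi:\mathcal B\to\mathcal A\otimes\mathbb B(\ell^2(\Gamma^\infty))$ and an admissible (respectively, coadmissible) family $\{\psi_F:\mathbb M_F(\mathcal A)\to\mathcal B\}_F$ ($F$ ranging over the finite subsets of $\Gamma^\infty$) of c.c.p. maps such that, for some $F$, $\|\psi_F\varphi_F(b)-b\|\le\varepsilon$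 for all $b\in S$, where the c.c.p. admissible (respectively, coadmissible) map $\varphi_F:\mathcal B\to\mathbb M_F(\mathcal A)$ is $\varphi_F(b)=(1\otimes P_F)\varphi(b)(1\otimes P_F)$. "$\mathcal A$-$\Gamma$-nuclear" without qualification means: as an $\mathcal A$-$\Gamma$-module or as an $\mathcal A$-$\Gamma$-comodule. *)

theory Defs
  imports "HOL-Analysis.Analysis"
begin

section \<open>Hilbert spaces and bounded operators\<close>

text \<open>
  Every Hilbert space has an orthonormal basis, so Hilbert spaces are taken in the form
  \<open>\<ell>\<^sup>2(X)\<close>, with \<open>X\<close> the universe of a type.
\<close>

typedef 'x ell2 = "{f :: 'x \<Rightarrow> complex. (\<lambda>x. (cmod (f x))\<^sup>2) summable_on UNIV}"
  morphisms coord Abs_ell2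
  by (rule exI[of _ "\<lambda>_. 0"]) simp

lemma coord_summable: "(\<lambda>x. (cmod (coord \<xi> x))\<^sup>2) summable_on UNIV"
  using coord[of \<xi>] by simp

lemma ell2_eqI: "(\<And>x. coord \<xi> x = coord \<eta> x) \<Longrightarrow> \<xi> = \<eta>"
  by (metis coord_inject ext)

lemma summable_bounded_by_squares:
  fixes f g :: "'x \<Rightarrow> complex" and h :: "'x \<Rightarrow> real"
  assumes "(\<lambda>x. (cmod (f x))\<^sup>2) summable_on UNIV" "(\<lambda>x. (cmod (g x))\<^sup>2) summable_on UNIV"
    and "\<And>x. \<bar>h x\<bar> \<le> c * (cmod (f x))\<^sup>2 + c * (cmod (g x))\<^sup>2"
  shows "h summable_on UNIV"
proof -
  have s: "(\<lambda>x. c * (cmod (f x))\<^sup>2 + c * (cmod (g x))\<^sup>2) summable_on UNIV"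
    by (intro summable_on_add summable_on_cmult_right assms(1,2))
  have "(\<lambda>x. norm (h x)) summable_on UNIV"
    by (rule summable_on_comparison_test[OF s]) (use assms(3) in auto)
  then show ?thesis by (rule abs_summable_summable)
qed

lemma ell2_add_closed:
  assumes "(\<lambda>x. (cmod (f x))\<^sup>2) summable_on UNIV" "(\<lambda>x. (cmod (g x))\<^sup>2) summable_on UNIV"
  shows "(\<lambda>x. (cmod (f x + g x))\<^sup>2) summable_on UNIV"
proof (rule summable_bounded_by_squares[OF assms, where c = 2])
  fix x
  have "(cmod (f x + g x))\<^sup>2 \<le> (cmod (f x) + cmod (g x))\<^sup>2"
    by (intro power_mono norm_triangle_ineq) auto
  also have "\<dots> \<le> 2 * (cmod (f x))\<^sup>2 + 2 * (cmod (g x))\<^sup>2"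
    using sum_squares_ge_zero[of "cmod (f x) - cmod (g x)" 0]
    by (simp add: power2_eq_square algebra_simps)
  finally show "\<bar>(cmod (f x + g x))\<^sup>2\<bar> \<le> 2 * (cmod (f x))\<^sup>2 + 2 * (cmod (g x))\<^sup>2"
    by simp
qed

lemma ell2_scale_closed:
  assumes "(\<lambda>x. (cmod (f x))\<^sup>2) summable_on UNIV"
  shows "(\<lambda>x. (cmod (c * f x))\<^sup>2) summable_on UNIV"
  using summable_on_cmult_right[OF assms, of "(cmod c)\<^sup>2"]
  by (simp add: norm_mult power_mult_distrib)

definition scaleC :: "complex \<Rightarrow> 'x ell2 \<Rightarrow> 'x ell2" (infixr "*\<^sub>C" 75)
  where "c *\<^sub>C \<xi> = Abs_ell2 (\<lambda>x. c * coord \<xi> x)"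

lemma coord_scaleC [simp]: "coord (c *\<^sub>C \<xi>) x = c * coord \<xi> x"
  unfolding scaleC_def using ell2_scale_closed[OF coord_summable, of c \<xi>]
  by (simp add: Abs_ell2_inverse)

instantiation ell2 :: (type) real_inner
begin

definition "zero_ell2 = (Abs_ell2 (\<lambda>_. 0) :: 'a ell2)"
definition "plus_ell2 \<xi> \<eta> = (Abs_ell2 (\<lambda>x. coord \<xi> x + coord \<eta> x) :: 'a ell2)"
definition "scaleR_ell2 r \<xi> = complex_of_real r *\<^sub>C (\<xi> :: 'a ell2)"
definition "uminus_ell2 \<xi> = (- 1) *\<^sub>C (\<xi> :: 'a ell2)"
definition "minus_ell2 \<xi> \<eta> = (\<xi> :: 'a ell2) + - \<eta>"
definition "inner_ell2 (\<xi> :: 'a ell2) \<eta> = (\<Sum>\<^sub>\<infinity>x. Re (cnj (coord \<xi> x) * coord \<eta> x))"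
definition "norm_ell2 \<xi> = sqrt (inner \<xi> (\<xi> :: 'a ell2))"
definition "sgn_ell2 \<xi> = inverse (norm \<xi>) *\<^sub>R (\<xi> :: 'a ell2)"
definition "dist_ell2 \<xi> \<eta> = norm (\<xi> - \<eta> :: 'a ell2)"
definition "uniformity_ell2 = (INF e\<in>{0<..}. principal {(\<xi>, \<eta> :: 'a ell2). dist \<xi> \<eta> < e})"
definition "open_ell2 (U :: 'a ell2 set) \<longleftrightarrow>
  (\<forall>\<xi>\<in>U. eventually (\<lambda>(\<xi>', \<eta>). \<xi>' = \<xi> \<longrightarrow> \<eta> \<in> U) uniformity)"

lemma coord_zero: "coord 0 x = 0"
  by (simp add: zero_ell2_def Abs_ell2_inverse)

lemma coord_add: "coord (\<xi> + \<eta>) x = coord \<xi> x + coord \<eta> x"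
  using ell2_add_closed[OF coord_summable coord_summable, of \<xi> \<eta>]
  by (simp add: plus_ell2_def Abs_ell2_inverse)

lemma inner_summable: "(\<lambda>x. Re (cnj (coord \<xi> x) * coord \<eta> x)) summable_on UNIV"
proof (rule summable_bounded_by_squares[OF coord_summable[of \<xi>] coord_summable[of \<eta>], where c = 1])
  fix x
  have "\<bar>Re (cnj (coord \<xi> x) * coord \<eta> x)\<bar> \<le> cmod (coord \<xi> x) * cmod (coord \<eta> x)"
    by (metis abs_Re_le_cmod norm_mult complex_mod_cnj)
  also have "\<dots> \<le> (cmod (coord \<xi> x))\<^sup>2 + (cmod (coord \<eta> x))\<^sup>2"
    using sum_squares_ge_zero[of "cmod (coord \<xi> x) - cmod (coord \<eta> x)" 0]
      mult_nonneg_nonneg[OF norm_ge_zero[of "coord \<xi> x"] norm_ge_zero[of "coord \<eta> x"]]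
    by (simp only: power2_eq_square) (simp add: algebra_simps del: mult_nonneg_nonneg norm_ge_zero zero_le_mult_iff)
  finally show "\<bar>Re (cnj (coord \<xi> x) * coord \<eta> x)\<bar>
      \<le> 1 * (cmod (coord \<xi> x))\<^sup>2 + 1 * (cmod (coord \<eta> x))\<^sup>2" by simp
qed

lemma inner_self: "inner \<xi> \<xi> = (\<Sum>\<^sub>\<infinity>x. (cmod (coord \<xi> x))\<^sup>2)" for \<xi> :: "'a ell2"
  unfolding inner_ell2_def by (intro infsum_cong) (simp add: cmod_def power2_eq_square)

instance
proof
  fix \<xi> \<eta> \<zeta> :: "'a ell2" and a b :: real
  show "\<xi> + \<eta> + \<zeta> = \<xi> + (\<eta> + \<zeta>)" "\<xi> + \<eta> = \<eta> + \<xi>" "0 + \<xi> = \<xi>" "- \<xi> + \<xi> = 0"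
    "\<xi> - \<eta> = \<xi> + - \<eta>" "a *\<^sub>R (\<xi> + \<eta>) = a *\<^sub>R \<xi> + a *\<^sub>R \<eta>"
    "(a + b) *\<^sub>R \<xi> = a *\<^sub>R \<xi> + b *\<^sub>R \<xi>" "a *\<^sub>R b *\<^sub>R \<xi> = (a * b) *\<^sub>R \<xi>" "1 *\<^sub>R \<xi> = \<xi>"
    by (rule ell2_eqI; simp add: coord_add coord_zero uminus_ell2_def minus_ell2_def
        scaleR_ell2_def algebra_simps)+
  show "sgn \<xi> = inverse (norm \<xi>) *\<^sub>R \<xi>" by (rule sgn_ell2_def)
  show "dist \<xi> \<eta> = norm (\<xi> - \<eta>)" by (rule dist_ell2_def)
  show "uniformity = (INF e\<in>{0<..}. principal {(\<xi>, \<eta> :: 'a ell2). dist \<xi> \<eta> < e})"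
    by (rule uniformity_ell2_def)
  show "open U \<longleftrightarrow> (\<forall>\<xi>\<in>U. eventually (\<lambda>(\<xi>', \<eta>). \<xi>' = \<xi> \<longrightarrow> \<eta> \<in> U) uniformity)"
    for U :: "'a ell2 set" by (rule open_ell2_def)
  show "inner \<xi> \<eta> = inner \<eta> \<xi>"
    unfolding inner_ell2_def by (intro infsum_cong) (simp add: algebra_simps)
  show "inner (\<xi> + \<eta>) \<zeta> = inner \<xi> \<zeta> + inner \<eta> \<zeta>"
    unfolding inner_ell2_def infsum_add[OF inner_summable inner_summable, symmetric]
    by (intro infsum_cong) (simp add: coord_add algebra_simps)
  show "inner (a *\<^sub>R \<xi>) \<eta> = a * inner \<xi> \<eta>"
    unfolding inner_ell2_def infsum_cmult_right'[symmetric]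
    by (intro infsum_cong) (simp add: scaleR_ell2_def algebra_simps)
  show "0 \<le> inner \<xi> \<xi>"
    unfolding inner_self by (intro infsum_nonneg) simp
  show "inner \<xi> \<xi> = 0 \<longleftrightarrow> \<xi> = 0"
  proof
    assume "inner \<xi> \<xi> = 0"
    then have z: "(\<Sum>\<^sub>\<infinity>x. (cmod (coord \<xi> x))\<^sup>2) = 0" unfolding inner_self .
    have "(cmod (coord \<xi> x))\<^sup>2 = 0" for x
      by (rule nonneg_infsum_le_0D[where A = UNIV and f = "\<lambda>x. (cmod (coord \<xi> x))\<^sup>2"])
        (use z coord_summable[of \<xi>] in auto)
    then show "\<xi> = 0" by (intro ell2_eqI) (simp add: coord_zero)
  qed (simp add: inner_ell2_def coord_zero)
  show "norm \<xi> = sqrt (inner \<xi> \<xi>)" by (rule norm_ell2_def)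
qed

end

definition cinner :: "'x ell2 \<Rightarrow> 'x ell2 \<Rightarrow> complex"
  where "cinner \<xi> \<eta> = (\<Sum>\<^sub>\<infinity>x. cnj (coord \<xi> x) * coord \<eta> x)"

definition ket :: "'x \<Rightarrow> 'x ell2"
  where "ket x = Abs_ell2 (\<lambda>y. if y = x then 1 else 0)"

definition tensor_vec :: "'x ell2 \<Rightarrow> 'y ell2 \<Rightarrow> ('x \<times> 'y) ell2" (infixr "\<otimes>\<^sub>v" 70)
  where "\<xi> \<otimes>\<^sub>v \<eta> = Abs_ell2 (\<lambda>(x, y). coord \<xi> x * coord \<eta> y)"

text \<open>
  The type of \<open>blinfun\<close>s contains all real-linear bounded operators; \<open>bop\<close> is the set of the
  complex-linear ones, that is, \<open>\<bbbB>(\<ell>\<^sup>2(X))\<close>.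
\<close>

type_synonym 'x op = "'x ell2 \<Rightarrow>\<^sub>L 'x ell2"

definition clinear_op :: "('x ell2 \<Rightarrow>\<^sub>L 'y ell2) \<Rightarrow> bool"
  where "clinear_op T \<longleftrightarrow> (\<forall>c \<xi>. blinfun_apply T (c *\<^sub>C \<xi>) = c *\<^sub>C blinfun_apply T \<xi>)"

definition bop :: "'x op set"
  where "bop = {T. clinear_op T}"

definition scale_op :: "complex \<Rightarrow> 'x op \<Rightarrow> 'x op"
  where "scale_op c T = Blinfun (\<lambda>\<xi>. c *\<^sub>C blinfun_apply T \<xi>)"

definition adj :: "('x ell2 \<Rightarrow>\<^sub>L 'y ell2) \<Rightarrow> ('y ell2 \<Rightarrow>\<^sub>L 'x ell2)"
  where "adj T = (THE S. \<forall>\<xi> \<eta>. cinner (blinfun_apply S \<eta>) \<xi> = cinner \<eta> (blinfun_apply T \<xi>))"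

definition ad :: "('x ell2 \<Rightarrow>\<^sub>L 'y ell2) \<Rightarrow> 'x op \<Rightarrow> 'y op"
  where "ad b x = b o\<^sub>L x o\<^sub>L adj b"

definition tensor_op :: "'x op \<Rightarrow> 'y op \<Rightarrow> ('x \<times> 'y) op" (infixr "\<otimes>\<^sub>o" 70)
  where "S \<otimes>\<^sub>o T = (THE R. \<forall>\<xi> \<eta>. blinfun_apply R (\<xi> \<otimes>\<^sub>v \<eta>) = blinfun_apply S \<xi> \<otimes>\<^sub>v blinfun_apply T \<eta>)"

definition perm_op :: "('x \<Rightarrow> 'y) \<Rightarrow> ('x ell2 \<Rightarrow>\<^sub>L 'y ell2)"
  where "perm_op f = (THE U. clinear_op U \<and> (\<forall>x. blinfun_apply U (ket x) = ket (f x)))"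
  \<comment> \<open>used for injective \<open>f\<close> only; then it is an isometry\<close>

definition mat_unit :: "'x \<Rightarrow> 'x \<Rightarrow> 'x op"
  where "mat_unit s t = Blinfun (\<lambda>\<xi>. coord \<xi> t *\<^sub>C ket s)"

definition proj_on :: "'x set \<Rightarrow> 'x op"
  where "proj_on F = (\<Sum>s\<in>F. mat_unit s s)"


section \<open>C*-algebras, operator systems, completely positive maps\<close>

definition csubspace :: "'x op set \<Rightarrow> bool"
  where "csubspace V \<longleftrightarrow> V \<subseteq> bop \<and> 0 \<in> V \<and> (\<forall>x\<in>V. \<forall>y\<in>V. x + y \<in> V) \<and> (\<forall>c. \<forall>x\<in>V. scale_op c x \<in> V)"

definition cspan :: "'x op set \<Rightarrow> 'x op set"
  where "cspan G = csubspace hull G"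

definition cstar_algebra :: "'x op set \<Rightarrow> bool"
  where "cstar_algebra C \<longleftrightarrow> csubspace C \<and> closed C \<and> (\<forall>x\<in>C. \<forall>y\<in>C. x o\<^sub>L y \<in> C) \<and> (\<forall>x\<in>C. adj x \<in> C)"

definition unital_cstar_algebra :: "'x op set \<Rightarrow> bool"
  where "unital_cstar_algebra C \<longleftrightarrow> cstar_algebra C \<and> id_blinfun \<in> C"

definition clinear_on :: "'x op set \<Rightarrow> ('x op \<Rightarrow> 'y op) \<Rightarrow> bool"
  where "clinear_on V \<phi> \<longleftrightarrow> (\<forall>x\<in>V. \<forall>y\<in>V. \<phi> (x + y) = \<phi> x + \<phi> y) \<and>
    (\<forall>c. \<forall>x\<in>V. \<phi> (scale_op c x) = scale_op c (\<phi> x))"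

definition cfunctional_on :: "'x op set \<Rightarrow> ('x op \<Rightarrow> complex) \<Rightarrow> bool"
  where "cfunctional_on V f \<longleftrightarrow> (\<forall>x\<in>V. \<forall>y\<in>V. f (x + y) = f x + f y) \<and>
    (\<forall>c. \<forall>x\<in>V. f (scale_op c x) = c * f x)"

definition star_hom :: "'x op set \<Rightarrow> 'y op set \<Rightarrow> ('x op \<Rightarrow> 'y op) \<Rightarrow> bool"
  where "star_hom C D q \<longleftrightarrow> clinear_on C q \<and> (\<forall>x\<in>C. q x \<in> D) \<and>
    (\<forall>x\<in>C. \<forall>y\<in>C. q (x o\<^sub>L y) = q x o\<^sub>L q y) \<and> (\<forall>x\<in>C. q (adj x) = adj (q x))"

text \<open>
  An operator system is a closed self-adjoint space of operators containing a unit. The unit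
  is only required to be a projection \<open>p\<close> with \<open>V = p V p\<close>, i.e. \<open>V\<close> is a unital subspace
  of \<open>\<bbbB>(p H)\<close>; so \<open>\<bbbM>\<^sub>F(A)\<close>, whose unit is \<open>1 \<otimes> P\<^sub>F\<close>, is an operator system.
\<close>

definition is_unit_of :: "'x op set \<Rightarrow> 'x op \<Rightarrow> bool"
  where "is_unit_of V p \<longleftrightarrow> p \<in> V \<and> (\<forall>x\<in>V. p o\<^sub>L x = x \<and> x o\<^sub>L p = x)"

definition operator_system :: "'x op set \<Rightarrow> bool"
  where "operator_system V \<longleftrightarrow> csubspace V \<and> closed V \<and> (\<forall>x\<in>V. adj x \<in> V) \<and> (\<exists>p. is_unit_of V p)"

text \<open>\<open>n \<times> n\<close> matrices over \<open>\<bbbB>(H)\<close>, viewed as operators on \<open>H\<^sup>n\<close>.\<close>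

definition mat_positive :: "nat \<Rightarrow> (nat \<Rightarrow> nat \<Rightarrow> 'x op) \<Rightarrow> bool"
  where "mat_positive n M \<longleftrightarrow>
    (\<forall>\<xi>. (\<Sum>i<n. \<Sum>j<n. cinner (\<xi> i) (blinfun_apply (M i j) (\<xi> j))) \<in> \<real>\<^sub>\<ge>\<^sub>0)"

definition mat_norm :: "nat \<Rightarrow> (nat \<Rightarrow> nat \<Rightarrow> 'x op) \<Rightarrow> real"
  where "mat_norm n M = (SUP \<xi>\<in>{\<xi>. (\<Sum>j<n. (norm (\<xi> j))\<^sup>2) \<le> 1}.
     sqrt (\<Sum>i<n. (norm (\<Sum>j<n. blinfun_apply (M i j) (\<xi> j)))\<^sup>2))"

definition positive_op :: "'x op \<Rightarrow> bool"
  where "positive_op x \<longleftrightarrow> (\<forall>\<xi>. cinner \<xi> (blinfun_apply x \<xi>) \<in> \<real>\<^sub>\<ge>\<^sub>0)"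

definition cp_map :: "'x op set \<Rightarrow> 'y op set \<Rightarrow> ('x op \<Rightarrow> 'y op) \<Rightarrow> bool"
  where "cp_map V W \<phi> \<longleftrightarrow> clinear_on V \<phi> \<and> (\<forall>x\<in>V. \<phi> x \<in> W) \<and>
    (\<forall>n M. (\<forall>i<n. \<forall>j<n. M i j \<in> V) \<and> mat_positive n M \<longrightarrow> mat_positive n (\<lambda>i j. \<phi> (M i j)))"

definition ccp_map :: "'x op set \<Rightarrow> 'y op set \<Rightarrow> ('x op \<Rightarrow> 'y op) \<Rightarrow> bool"
  where "ccp_map V W \<phi> \<longleftrightarrow> cp_map V W \<phi> \<and> (\<forall>x\<in>V. norm (\<phi> x) \<le> norm x)"


section \<open>Minimal tensor products and exactness\<close>

definition min_tensor :: "'x op set \<Rightarrow> 'y op set \<Rightarrow> ('x \<times> 'y) op set" (infixr "\<otimes>\<^sub>m" 70)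
  where "V \<otimes>\<^sub>m C = closure (cspan {v \<otimes>\<^sub>o c | v c. v \<in> V \<and> c \<in> C})"

text \<open>
  The continuous linear map on \<open>V \<otimes>\<^sub>m C\<close> with \<open>v \<otimes> c \<mapsto> m v c\<close>; it is unique on \<open>V \<otimes>\<^sub>m C\<close> if it
  exists. E.g. \<open>tensor_ext V C (\<lambda>v c. \<phi> v \<otimes>\<^sub>o c)\<close> is \<open>\<phi> \<otimes> id\<close>.
\<close>

definition tensor_ext :: "'x op set \<Rightarrow> 'y op set \<Rightarrow> ('x op \<Rightarrow> 'y op \<Rightarrow> 'z op) \<Rightarrow> ('x \<times> 'y) op \<Rightarrow> 'z op"
  where "tensor_ext V C m = (SOME T. clinear_on (V \<otimes>\<^sub>m C) T \<and> continuous_on (V \<otimes>\<^sub>m C) T \<and>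
     (\<forall>v\<in>V. \<forall>c\<in>C. T (v \<otimes>\<^sub>o c) = m v c))"

text \<open>
  Short exact sequences \<open>0 \<rightarrow> J \<rightarrow> C \<rightarrow> D \<rightarrow> 0\<close> of C*-algebras are given by surjective
  *-homomorphisms \<open>q : C \<rightarrow> D\<close>, with \<open>J = ker q\<close>. Tensoring with \<open>A\<close> always preserves injectivity
  of \<open>J \<rightarrow> C\<close> and surjectivity of \<open>C \<rightarrow> D\<close>, so exactness of the tensored sequence is
  exactness at \<open>A \<otimes> C\<close>. The types of \<open>C\<close> and \<open>D\<close>, which a formula cannot quantify over, are
  parameters: \<open>A\<close> is exact if the predicate holds for all of them.
\<close>

definition exact_cstar :: "'y itself \<Rightarrow> 'z itself \<Rightarrow> 'x op set \<Rightarrow> bool"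
  where "exact_cstar _ _ A \<longleftrightarrow> (\<forall>(C :: 'y op set) (D :: 'z op set) q.
     cstar_algebra C \<and> cstar_algebra D \<and> star_hom C D q \<and> q ` C = D \<longrightarrow>
     {x \<in> A \<otimes>\<^sub>m C. tensor_ext A C (\<lambda>a c. a \<otimes>\<^sub>o q c) x = 0} = A \<otimes>\<^sub>m {c \<in> C. q c = 0})"


section \<open>Reduced crossed products\<close>

text \<open>
  The discrete group is a type of class \<^class>\<open>group_add\<close> (not necessarily commutative), so that
  \<open>s + t\<close>, \<open>- s\<close>, \<open>0\<close> stand for \<open>st\<close>, \<open>s\<^sup>-\<^sup>1\<close>, \<open>e\<close>.
\<close>

definition cstar_action :: "'h op set \<Rightarrow> ('g::group_add \<Rightarrow> 'h op \<Rightarrow> 'h op) \<Rightarrow> bool"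
  where "cstar_action A \<alpha> \<longleftrightarrow> (\<forall>s. star_hom A A (\<alpha> s)) \<and> (\<forall>a\<in>A. \<alpha> 0 a = a) \<and>
    (\<forall>s t. \<forall>a\<in>A. \<alpha> (s + t) a = \<alpha> s (\<alpha> t a))"

text \<open>
  For an index set with a map \<open>\<kappa>\<close> to the group, the diagonal operator
  \<open>\<Sum>\<^sub>i \<alpha>\<^bsub>\<kappa>(i)\<^sup>-\<^sup>1\<^esub>(a) \<otimes> e\<^sub>i\<^sub>i\<close>. The case \<open>\<kappa> = id\<close> is the representation of \<open>A\<close> in the crossed product,
  the case \<open>\<kappa>(t) = t\<^sub>1\<cdots>t\<^sub>\<ell>\<close> is the map \<open>\<pi>\<close> into operators over \<open>\<Gamma>\<^sup>\<infinity>\<close>.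
\<close>

definition diag_rep :: "('g::group_add \<Rightarrow> 'h op \<Rightarrow> 'h op) \<Rightarrow> ('i \<Rightarrow> 'g) \<Rightarrow> 'h op \<Rightarrow> ('h \<times> 'i) op"
  where "diag_rep \<alpha> \<kappa> a = (THE T. \<forall>\<xi> i. blinfun_apply T (\<xi> \<otimes>\<^sub>v ket i) = blinfun_apply (\<alpha> (- \<kappa> i) a) \<xi> \<otimes>\<^sub>v ket i)"

definition left_reg :: "'g::group_add \<Rightarrow> 'g op"
  where "left_reg s = perm_op (\<lambda>t. s + t)"

definition reduced_group_cstar :: "'g::group_add op set"
  where "reduced_group_cstar = closure (cspan (range left_reg))"

definition crossed_product :: "'h op set \<Rightarrow> ('g::group_add \<Rightarrow> 'h op \<Rightarrow> 'h op) \<Rightarrow> ('h \<times> 'g) op set"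
  where "crossed_product A \<alpha> =
     closure (cspan {diag_rep \<alpha> (\<lambda>s. s) a o\<^sub>L (id_blinfun \<otimes>\<^sub>o left_reg s) | a s. a \<in> A})"

text \<open>
  \<open>\<Gamma>\<^sup>\<infinity>\<close> consists of the nonempty tuples \<open>(t\<^sub>1, \<dots>, t\<^sub>\<ell>)\<close>, encoded as \<open>(t\<^sub>1, [t\<^sub>2, \<dots>, t\<^sub>\<ell>])\<close>.
\<close>

type_synonym 'g tuples = "'g \<times> 'g list"

definition tuple_prod :: "'g::group_add tuples \<Rightarrow> 'g"
  where "tuple_prod t = fst t + sum_list (snd t)"

definition tuple_shift :: "'g::group_add \<Rightarrow> 'g tuples \<Rightarrow> 'g tuples"
  where "tuple_shift r t = (r + fst t, snd t)"

definition mats :: "'h op set \<Rightarrow> 'i set \<Rightarrow> ('h \<times> 'i) op set"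
  where "mats A F = cspan {a \<otimes>\<^sub>o mat_unit s t | a s t. a \<in> A \<and> s \<in> F \<and> t \<in> F}"

text \<open>
  \<open>x \<mapsto> W (x \<otimes> 1) W\<^sup>*\<close> with \<open>W (\<delta>\<^sub>i \<otimes> \<delta>\<^sub>g) = \<delta>\<^sub>i \<otimes> \<delta>\<^bsub>\<kappa>(i)g\<^esub>\<close>. It maps \<open>e\<^sub>s\<^sub>t\<close> to \<open>e\<^sub>s\<^sub>t \<otimes> \<lambda>\<^bsub>\<kappa>(s)\<kappa>(t)\<^sup>-\<^sup>1\<^esub>\<close>.
  On the crossed product (\<open>\<kappa> = snd\<close>) this is the dual coaction \<open>as \<mapsto> as \<otimes> \<lambda>\<^sub>s\<close>, over
  \<open>\<Gamma>\<^sup>\<infinity>\<close> (\<open>\<kappa>(h, t) = t\<^sub>1\<cdots>t\<^sub>\<ell>\<close>) it restricts to \<open>\<delta>\<^sub>F\<close> on each \<open>\<bbbM>\<^sub>F(A)\<close>, and on the reduced group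
  C*-algebra (\<open>\<kappa> = id\<close>) it is the comultiplication \<open>\<lambda>\<^sub>s \<mapsto> \<lambda>\<^sub>s \<otimes> \<lambda>\<^sub>s\<close>.
\<close>

definition dual_coaction :: "('i \<Rightarrow> 'g::group_add) \<Rightarrow> 'i op \<Rightarrow> ('i \<times> 'g) op"
  where "dual_coaction \<kappa> x = ad (perm_op (\<lambda>(i, g). (i, \<kappa> i + g))) (x \<otimes>\<^sub>o id_blinfun)"


section \<open>Admissible maps\<close>

text \<open>
  The classes of admissible maps and families are closed under composition through arbitrary
  intermediate operator systems. These range over the operator systems on one Hilbert
  space \<open>\<ell>\<^sup>2('w)\<close>, which is as large as one likes since \<open>'w\<close> is arbitrary.

  The predicates take a set \<open>Ob\<close> of structured operator systems as parameter, because the formulas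
  for the module action and the coaction on \<open>A \<otimes> \<bbbB>(\<ell>\<^sup>2(\<Gamma>\<^sup>\<infinity>))\<close> need not preserve that space: they do
  on each \<open>\<bbbM>\<^sub>F(A)\<close>, but in general \<open>\<pi>(a)\<close> lies outside of the minimal tensor product.
  This operator system is therefore admitted as an object by hand, and the conditions on maps
  are imposed where the operations have values in the spaces concerned.
\<close>

subsection \<open>A-admissible maps\<close>

type_synonym ('w, 'h) module_str = "'w op set \<times> ('w op \<Rightarrow> 'h op \<Rightarrow> 'w op)"

definition right_module :: "'h op set \<Rightarrow> ('w, 'h) module_str \<Rightarrow> bool"
  where "right_module A X \<longleftrightarrow> (case X of (V, m) \<Rightarrow>
     operator_system V \<and> (\<forall>x\<in>V. \<forall>a\<in>A. m x a \<in> V) \<and>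
     (\<forall>x\<in>V. clinear_on A (m x)) \<and> (\<forall>a\<in>A. clinear_on V (\<lambda>x. m x a)) \<and>
     (\<forall>x\<in>V. \<forall>a\<in>A. \<forall>b\<in>A. m (m x a) b = m x (a o\<^sub>L b)) \<and> (\<forall>x\<in>V. m x id_blinfun = x))"

definition module_map :: "'h op set \<Rightarrow> ('w, 'h) module_str \<Rightarrow> ('w, 'h) module_str \<Rightarrow> ('w op \<Rightarrow> 'w op) \<Rightarrow> bool"
  where "module_map A X Y \<phi> \<longleftrightarrow>
     (\<forall>x\<in>fst X. \<forall>a\<in>A. snd X x a \<in> fst X \<longrightarrow> \<phi> (snd X x a) = snd Y (\<phi> x) a)"

inductive A_admissible ::
  "'h op set \<Rightarrow> ('w, 'h) module_str set \<Rightarrow> ('w, 'h) module_str \<Rightarrow> ('w, 'h) module_str \<Rightarrow> ('w op \<Rightarrow> 'w op) \<Rightarrow> bool"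
  for A Ob where
  module_map: "X \<in> Ob \<Longrightarrow> Y \<in> Ob \<Longrightarrow> cp_map (fst X) (fst Y) \<phi> \<Longrightarrow> module_map A X Y \<phi>
    \<Longrightarrow> A_admissible A Ob X Y \<phi>"
| conj_dom: "A_admissible A Ob X Y \<phi> \<Longrightarrow> b \<in> fst X \<Longrightarrow> (\<forall>x\<in>fst X. ad b x \<in> fst X)
    \<Longrightarrow> A_admissible A Ob X Y (\<lambda>x. \<phi> (ad b x))"
| conj_cod: "A_admissible A Ob X Y \<phi> \<Longrightarrow> d \<in> fst Y \<Longrightarrow> (\<forall>x\<in>fst X. ad d (\<phi> x) \<in> fst Y)
    \<Longrightarrow> A_admissible A Ob X Y (\<lambda>x. ad d (\<phi> x))"
| functional: "X \<in> Ob \<Longrightarrow> Y \<in> Ob \<Longrightarrow> cfunctional_on (fst X) \<rho>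
    \<Longrightarrow> (\<forall>x\<in>fst X. positive_op x \<longrightarrow> \<rho> x \<in> \<real>\<^sub>\<ge>\<^sub>0) \<Longrightarrow> d \<in> fst Y \<Longrightarrow> positive_op d
    \<Longrightarrow> A_admissible A Ob X Y (\<lambda>x. scale_op (\<rho> x) d)"
| comp: "A_admissible A Ob X Y \<phi> \<Longrightarrow> A_admissible A Ob Y Z \<psi> \<Longrightarrow> A_admissible A Ob X Z (\<lambda>x. \<psi> (\<phi> x))"
| scale: "A_admissible A Ob X Y \<phi> \<Longrightarrow> 0 < r \<Longrightarrow> A_admissible A Ob X Y (\<lambda>x. r *\<^sub>R \<phi> x)"
| sum: "A_admissible A Ob X Y \<phi> \<Longrightarrow> A_admissible A Ob X Y \<psi> \<Longrightarrow> A_admissible A Ob X Y (\<lambda>x. \<phi> x + \<psi> x)"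
| cong: "A_admissible A Ob X Y \<phi> \<Longrightarrow> (\<forall>x\<in>fst X. \<phi>' x = \<phi> x) \<Longrightarrow> A_admissible A Ob X Y \<phi>'"

subsection \<open>Families of maps\<close>

text \<open>
  A family of maps is a set of pairs of a domain \<open>U\<close> and a map, undefined off \<open>U\<close>. It serves as its
  own index set. No generality is lost: in a family for a group action, domain and map at the
  index \<open>t\<cdot>i\<close> are determined by those at \<open>i\<close>, and for cofamilies any map on the indices will do.
\<close>

type_synonym 'w map_family = "('w op set \<times> ('w op \<Rightarrow> 'w op)) set"

definition subsystem_map :: "'w op set \<Rightarrow> 'w op set \<Rightarrow> 'w op set \<times> ('w op \<Rightarrow> 'w op) \<Rightarrow> bool"
  where "subsystem_map V W f \<longleftrightarrow> operator_system (fst f) \<and> fst f \<subseteq> V \<and>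
     cp_map (fst f) W (snd f) \<and> snd f \<in> extensional (fst f)"

subsection \<open>Admissible families\<close>

type_synonym ('w, 'g) action_str = "'w op set \<times> ('g \<Rightarrow> 'w op \<Rightarrow> 'w op)"

definition complete_isometry_on :: "'w op set \<Rightarrow> ('w op \<Rightarrow> 'w op) \<Rightarrow> bool"
  where "complete_isometry_on V \<beta> \<longleftrightarrow> clinear_on V \<beta> \<and>
     (\<forall>n M. (\<forall>i<n. \<forall>j<n. M i j \<in> V) \<longrightarrow> mat_norm n (\<lambda>i j. \<beta> (M i j)) = mat_norm n M)"

definition group_system :: "('w, 'g::group_add) action_str \<Rightarrow> bool"
  where "group_system X \<longleftrightarrow> (case X of (V, \<beta>) \<Rightarrow> operator_system V \<and>
     (\<forall>t. complete_isometry_on V (\<beta> t) \<and> \<beta> t ` V = V) \<and>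
     (\<forall>x\<in>V. \<beta> 0 x = x) \<and> (\<forall>s t. \<forall>x\<in>V. \<beta> (s + t) x = \<beta> s (\<beta> t x)) \<and>
     (cstar_algebra V \<longrightarrow> (\<forall>t. star_hom V V (\<beta> t))))"

definition group_family ::
  "('w, 'g::group_add) action_str \<Rightarrow> ('w, 'g) action_str \<Rightarrow> 'w map_family \<Rightarrow> bool"
  where "group_family X Y \<F> \<longleftrightarrow> (case (X, Y) of ((V, \<beta>), (W, \<gamma>)) \<Rightarrow>
     (\<forall>f\<in>\<F>. subsystem_map V W f) \<and>
     (\<exists>tr. (\<forall>t. \<forall>f\<in>\<F>. tr t f \<in> \<F>) \<and> (\<forall>f\<in>\<F>. tr 0 f = f) \<and>
        (\<forall>s t. \<forall>f\<in>\<F>. tr (s + t) f = tr s (tr t f)) \<and>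
        (\<forall>t. \<forall>f\<in>\<F>. \<forall>b\<in>fst f. \<beta> t b \<in> fst (tr t f) \<and> snd (tr t f) (\<beta> t b) = \<gamma> t (snd f b))))"

text \<open>
  In the rules \<open>conj_dom\<close> and \<open>act_dom\<close>, the added map may live on any operator subsystem \<open>U'\<close> carried
  into \<open>U\<close>. The sum is over a nonempty list, so repetitions are allowed.
\<close>

inductive group_admissible ::
  "('w, 'g::group_add) action_str \<Rightarrow> ('w, 'g) action_str \<Rightarrow> 'w map_family \<Rightarrow> bool" where
  family: "group_system X \<Longrightarrow> group_system Y \<Longrightarrow> group_family X Y \<F> \<Longrightarrow> group_admissible X Y \<F>"
| conj_dom: "group_admissible X Y \<F> \<Longrightarrow> (U, \<psi>) \<in> \<F> \<Longrightarrow> b \<in> fst X \<Longrightarrow> (\<forall>x\<in>U'. ad b x \<in> U)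
    \<Longrightarrow> f = (U', \<lambda>x\<in>U'. \<psi> (ad b x)) \<Longrightarrow> subsystem_map (fst X) (fst Y) f
    \<Longrightarrow> group_admissible X Y (insert f \<F>)"
| conj_cod: "group_admissible X Y \<F> \<Longrightarrow> (U, \<psi>) \<in> \<F> \<Longrightarrow> d \<in> fst Y
    \<Longrightarrow> f = (U, \<lambda>x\<in>U. ad d (\<psi> x)) \<Longrightarrow> subsystem_map (fst X) (fst Y) f
    \<Longrightarrow> group_admissible X Y (insert f \<F>)"
| sum: "group_admissible X Y \<F> \<Longrightarrow> \<psi>s \<noteq> [] \<Longrightarrow> (\<forall>\<psi>\<in>set \<psi>s. (U, \<psi>) \<in> \<F>)
    \<Longrightarrow> f = (U, \<lambda>x\<in>U. \<Sum>\<psi>\<leftarrow>\<psi>s. \<psi> x) \<Longrightarrow> group_admissible X Y (insert f \<F>)"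
| act_cod: "group_admissible X Y \<F> \<Longrightarrow> (U, \<psi>) \<in> \<F>
    \<Longrightarrow> f = (U, \<lambda>x\<in>U. snd Y t (\<psi> x)) \<Longrightarrow> subsystem_map (fst X) (fst Y) f
    \<Longrightarrow> group_admissible X Y (insert f \<F>)"
| act_dom: "group_admissible X Y \<F> \<Longrightarrow> (U, \<psi>) \<in> \<F> \<Longrightarrow> (\<forall>x\<in>U'. snd X t x \<in> U)
    \<Longrightarrow> f = (U', \<lambda>x\<in>U'. \<psi> (snd X t x)) \<Longrightarrow> subsystem_map (fst X) (fst Y) f
    \<Longrightarrow> group_admissible X Y (insert f \<F>)"
| comp: "group_admissible X Y \<F> \<Longrightarrow> group_admissible Y Z \<G>
    \<Longrightarrow> group_admissible X Z
          {(U, \<lambda>x\<in>U. \<psi> (\<phi> x)) | U \<phi> U' \<psi>. (U, \<phi>) \<in> \<F> \<and> (U', \<psi>) \<in> \<G> \<and> \<phi> ` U \<subseteq> U'}"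
| union: "group_admissible X Y \<F> \<Longrightarrow> group_admissible X Y \<G> \<Longrightarrow> group_admissible X Y (\<F> \<union> \<G>)"

subsection \<open>Coadmissible families\<close>

type_synonym ('w, 'g) coaction_str = "'w op set \<times> ('w op \<Rightarrow> ('w \<times> 'g) op)"

text \<open>
  A non-degenerate c.p. map between unital systems is one that preserves the unit. The last
  condition is the coaction identity \<open>(\<delta> \<otimes> id)\<delta> = (id \<otimes> \<Delta>)\<delta>\<close>.
\<close>

definition cosystem :: "('w, 'g::group_add) coaction_str \<Rightarrow> bool"
  where "cosystem X \<longleftrightarrow> (case X of (V, \<delta>) \<Rightarrow> operator_system V \<and>
     cp_map V (V \<otimes>\<^sub>m reduced_group_cstar) \<delta> \<and>
     (\<forall>p. is_unit_of V p \<longrightarrow> \<delta> p = p \<otimes>\<^sub>o id_blinfun) \<and>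
     (cstar_algebra V \<longrightarrow> star_hom V (V \<otimes>\<^sub>m reduced_group_cstar) \<delta>) \<and>
     (\<forall>x\<in>V.
        tensor_ext V reduced_group_cstar
          (\<lambda>v c. ad (perm_op (\<lambda>((w, g), g'). (w, (g, g')))) (\<delta> v \<otimes>\<^sub>o c)) (\<delta> x) =
        tensor_ext V reduced_group_cstar (\<lambda>v c. v \<otimes>\<^sub>o dual_coaction (\<lambda>s. s) c) (\<delta> x)))"

definition cogroup_family ::
  "('w, 'g::group_add) coaction_str \<Rightarrow> ('w, 'g) coaction_str \<Rightarrow> 'w map_family \<Rightarrow> bool"
  where "cogroup_family X Y \<F> \<longleftrightarrow> (case (X, Y) of ((V, \<delta>), (W, \<epsilon>)) \<Rightarrow>
     (\<forall>f\<in>\<F>. subsystem_map V W f) \<and>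
     (\<exists>d. \<forall>f\<in>\<F>. d f \<in> \<F> \<and>
        (\<forall>b\<in>fst f. \<delta> b \<in> fst (d f) \<otimes>\<^sub>m reduced_group_cstar \<and>
           tensor_ext (fst (d f)) reduced_group_cstar (\<lambda>v c. snd (d f) v \<otimes>\<^sub>o c) (\<delta> b) = \<epsilon> (snd f b))))"

definition slice :: "'w op set \<Rightarrow> ('g::group_add op \<Rightarrow> complex) \<Rightarrow> ('w \<times> 'g) op \<Rightarrow> 'w op"
  where "slice V \<theta> = tensor_ext V reduced_group_cstar (\<lambda>v c. scale_op (\<theta> c) v)"

definition dual_element :: "('g::group_add op \<Rightarrow> complex) \<Rightarrow> bool"
  where "dual_element \<theta> \<longleftrightarrow> cfunctional_on reduced_group_cstar \<theta> \<and>
     (\<exists>K. \<forall>c\<in>reduced_group_cstar. cmod (\<theta> c) \<le> K * norm c)"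

text \<open>
  In the rules \<open>coact_cod\<close> and \<open>coact_dom\<close> the functional \<open>\<theta>\<close> need not be positive, but the added map
  is required to be c.p. (as part of \<open>subsystem_map\<close>).
\<close>

inductive cogroup_admissible ::
  "('w, 'g::group_add) coaction_str set \<Rightarrow> ('w, 'g) coaction_str \<Rightarrow> ('w, 'g) coaction_str \<Rightarrow> 'w map_family \<Rightarrow> bool"
  for Ob where
  family: "X \<in> Ob \<Longrightarrow> Y \<in> Ob \<Longrightarrow> cogroup_family X Y \<F> \<Longrightarrow> cogroup_admissible Ob X Y \<F>"
| conj_dom: "cogroup_admissible Ob X Y \<F> \<Longrightarrow> (U, \<psi>) \<in> \<F> \<Longrightarrow> b \<in> fst X \<Longrightarrow> (\<forall>x\<in>U'. ad b x \<in> U)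
    \<Longrightarrow> f = (U', \<lambda>x\<in>U'. \<psi> (ad b x)) \<Longrightarrow> subsystem_map (fst X) (fst Y) f
    \<Longrightarrow> cogroup_admissible Ob X Y (insert f \<F>)"
| conj_cod: "cogroup_admissible Ob X Y \<F> \<Longrightarrow> (U, \<psi>) \<in> \<F> \<Longrightarrow> d \<in> fst Y
    \<Longrightarrow> f = (U, \<lambda>x\<in>U. ad d (\<psi> x)) \<Longrightarrow> subsystem_map (fst X) (fst Y) f
    \<Longrightarrow> cogroup_admissible Ob X Y (insert f \<F>)"
| sum: "cogroup_admissible Ob X Y \<F> \<Longrightarrow> \<psi>s \<noteq> [] \<Longrightarrow> (\<forall>\<psi>\<in>set \<psi>s. (U, \<psi>) \<in> \<F>)
    \<Longrightarrow> f = (U, \<lambda>x\<in>U. \<Sum>\<psi>\<leftarrow>\<psi>s. \<psi> x) \<Longrightarrow> cogroup_admissible Ob X Y (insert f \<F>)"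
| coact_cod: "cogroup_admissible Ob X Y \<F> \<Longrightarrow> (U, \<psi>) \<in> \<F> \<Longrightarrow> dual_element \<theta>
    \<Longrightarrow> (\<forall>x\<in>U. snd Y (\<psi> x) \<in> fst Y \<otimes>\<^sub>m reduced_group_cstar)
    \<Longrightarrow> f = (U, \<lambda>x\<in>U. slice (fst Y) \<theta> (snd Y (\<psi> x))) \<Longrightarrow> subsystem_map (fst X) (fst Y) f
    \<Longrightarrow> cogroup_admissible Ob X Y (insert f \<F>)"
| coact_dom: "cogroup_admissible Ob X Y \<F> \<Longrightarrow> (U, \<psi>) \<in> \<F> \<Longrightarrow> dual_element \<theta>
    \<Longrightarrow> (\<forall>x\<in>U'. snd X x \<in> U \<otimes>\<^sub>m reduced_group_cstar)
    \<Longrightarrow> f = (U', \<lambda>x\<in>U'. \<psi> (slice U \<theta> (snd X x))) \<Longrightarrow> subsystem_map (fst X) (fst Y) f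
    \<Longrightarrow> cogroup_admissible Ob X Y (insert f \<F>)"
| comp: "cogroup_admissible Ob X Y \<F> \<Longrightarrow> cogroup_admissible Ob Y Z \<G>
    \<Longrightarrow> cogroup_admissible Ob X Z
          {(U, \<lambda>x\<in>U. \<psi> (\<phi> x)) | U \<phi> U' \<psi>. (U, \<phi>) \<in> \<F> \<and> (U', \<psi>) \<in> \<G> \<and> \<phi> ` U \<subseteq> U'}"
| union: "cogroup_admissible Ob X Y \<F> \<Longrightarrow> cogroup_admissible Ob X Y \<G> \<Longrightarrow> cogroup_admissible Ob X Y (\<F> \<union> \<G>)"


section \<open>Nuclearity\<close>

text \<open>
  The crossed product acts on \<open>\<ell>\<^sup>2('h \<times> 'g)\<close> and \<open>A \<otimes> \<bbbB>(\<ell>\<^sup>2(\<Gamma>\<^sup>\<infinity>))\<close> on \<open>\<ell>\<^sup>2('h \<times> 'g tuples)\<close>. Both are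
  moved to the Hilbert space over the following type, whose summand \<open>'u\<close> makes
  room for further operator systems: an injection \<open>j\<close> of basis sets induces an
  isometry \<open>J\<close>, and \<open>x\<close> becomes \<open>J x J\<^sup>*\<close>.
\<close>

type_synonym ('h, 'g, 'u) ambient = "('h \<times> 'g) + ('h \<times> 'g tuples) + 'u"

definition embed :: "('x \<Rightarrow> 'w) \<Rightarrow> 'x op \<Rightarrow> 'w op"
  where "embed j = ad (perm_op j)"

definition unembed :: "('x \<Rightarrow> 'w) \<Rightarrow> 'w op \<Rightarrow> 'x op"
  where "unembed j = ad (adj (perm_op j))"

definition embed_map :: "('x \<Rightarrow> 'w) \<Rightarrow> ('y \<Rightarrow> 'w) \<Rightarrow> 'x op set \<Rightarrow> ('x op \<Rightarrow> 'y op) \<Rightarrow> 'w op set \<times> ('w op \<Rightarrow> 'w op)"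
  where "embed_map j k V \<phi> = (embed j ` V, \<lambda>x\<in>embed j ` V. embed k (\<phi> (unembed j x)))"

definition embed_module :: "('x \<Rightarrow> 'w) \<Rightarrow> 'x op set \<Rightarrow> ('x op \<Rightarrow> 'h op \<Rightarrow> 'x op) \<Rightarrow> ('w, 'h) module_str"
  where "embed_module j V m = (embed j ` V, \<lambda>x a. embed j (m (unembed j x) a))"

definition embed_action :: "('x \<Rightarrow> 'w) \<Rightarrow> 'x op set \<Rightarrow> ('g \<Rightarrow> 'x op \<Rightarrow> 'x op) \<Rightarrow> ('w, 'g) action_str"
  where "embed_action j V \<beta> = (embed j ` V, \<lambda>t x. embed j (\<beta> t (unembed j x)))"

definition embed_coaction :: "('x \<Rightarrow> 'w) \<Rightarrow> 'x op set \<Rightarrow> ('x op \<Rightarrow> ('x \<times> 'g) op) \<Rightarrow> ('w, 'g) coaction_str"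
  where "embed_coaction j V \<delta> = (embed j ` V, \<lambda>x. embed (map_prod j id) (\<delta> (unembed j x)))"

definition cp_idx :: "'h \<times> 'g \<Rightarrow> ('h, 'g, 'u) ambient"
  where "cp_idx = Inl"

definition mat_idx :: "'h \<times> 'g tuples \<Rightarrow> ('h, 'g, 'u) ambient"
  where "mat_idx = Inr \<circ> Inl"

definition all_mats :: "'h op set \<Rightarrow> ('h \<times> 'g tuples) op set"
  where "all_mats A = A \<otimes>\<^sub>m bop"

definition cp_module :: "'h op set \<Rightarrow> ('g::group_add \<Rightarrow> 'h op \<Rightarrow> 'h op) \<Rightarrow> (('h, 'g, 'u) ambient, 'h) module_str"
  where "cp_module A \<alpha> = embed_module cp_idx (crossed_product A \<alpha>) (\<lambda>x a. x o\<^sub>L diag_rep \<alpha> (\<lambda>s. s) a)"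

definition mat_module :: "'h op set \<Rightarrow> ('g::group_add \<Rightarrow> 'h op \<Rightarrow> 'h op) \<Rightarrow> (('h, 'g, 'u) ambient, 'h) module_str"
  where "mat_module A \<alpha> = embed_module mat_idx (all_mats A) (\<lambda>x a. x o\<^sub>L diag_rep \<alpha> tuple_prod a)"

definition cp_action :: "'h op set \<Rightarrow> ('g::group_add \<Rightarrow> 'h op \<Rightarrow> 'h op) \<Rightarrow> (('h, 'g, 'u) ambient, 'g) action_str"
  where "cp_action A \<alpha> = embed_action cp_idx (crossed_product A \<alpha>) (\<lambda>r. ad (id_blinfun \<otimes>\<^sub>o left_reg r))"

definition mat_action :: "'h op set \<Rightarrow> (('h, 'g::group_add, 'u) ambient, 'g) action_str"
  where "mat_action A = embed_action mat_idx (all_mats A) (\<lambda>r. ad (id_blinfun \<otimes>\<^sub>o perm_op (tuple_shift r)))"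

definition cp_coaction :: "'h op set \<Rightarrow> ('g::group_add \<Rightarrow> 'h op \<Rightarrow> 'h op) \<Rightarrow> (('h, 'g, 'u) ambient, 'g) coaction_str"
  where "cp_coaction A \<alpha> = embed_coaction cp_idx (crossed_product A \<alpha>) (dual_coaction snd)"

definition mat_coaction :: "'h op set \<Rightarrow> (('h, 'g::group_add, 'u) ambient, 'g) coaction_str"
  where "mat_coaction A = embed_coaction mat_idx (all_mats A) (dual_coaction (\<lambda>(h, t). tuple_prod t))"

definition A_admissible_family ::
  "'h op set \<Rightarrow> ('g::group_add \<Rightarrow> 'h op \<Rightarrow> 'h op) \<Rightarrow> (('h, 'g, 'u) ambient, 'h) module_str \<Rightarrow>
   (('h, 'g, 'u) ambient, 'h) module_str \<Rightarrow> ('h, 'g, 'u) ambient map_family \<Rightarrow> bool"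
  where "A_admissible_family A \<alpha> X Y \<F> \<longleftrightarrow>
     (\<forall>(U, \<psi>)\<in>\<F>. A_admissible A (insert (mat_module A \<alpha>) {X. right_module A X}) (U, snd X) Y \<psi>)"

text \<open>The approximation property common to modules and comodules: \<open>adm\<close> singles out the (co)admissible
  maps \<open>\<phi>\<close>, and \<open>adm_fam\<close> the (co)admissible families \<open>(\<psi>\<^sub>F)\<^sub>F\<close>.\<close>

definition approximable ::
  "'h op set \<Rightarrow> ('g::group_add \<Rightarrow> 'h op \<Rightarrow> 'h op) \<Rightarrow>
   ((('h \<times> 'g) op \<Rightarrow> ('h \<times> 'g tuples) op) \<Rightarrow> bool) \<Rightarrow>
   (('g tuples set \<Rightarrow> ('h \<times> 'g tuples) op \<Rightarrow> ('h \<times> 'g) op) \<Rightarrow> bool) \<Rightarrow> bool"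
  where "approximable A \<alpha> adm adm_fam \<longleftrightarrow>
    (\<forall>\<epsilon>>0. \<forall>S. finite S \<and> S \<subseteq> crossed_product A \<alpha> \<longrightarrow>
      (\<exists>\<phi> \<psi>.
        ccp_map (crossed_product A \<alpha>) (all_mats A) \<phi> \<and> adm \<phi> \<and>
        (\<forall>F. finite F \<longrightarrow> ccp_map (mats A F) (crossed_product A \<alpha>) (\<psi> F)) \<and> adm_fam \<psi> \<and>
        (\<exists>F. finite F \<and>
          (\<forall>b\<in>S. norm (\<psi> F ((id_blinfun \<otimes>\<^sub>o proj_on F) o\<^sub>L \<phi> b o\<^sub>L (id_blinfun \<otimes>\<^sub>o proj_on F)) - b) \<le> \<epsilon>))))"

definition nuclear_module ::
  "'u itself \<Rightarrow> 'h op set \<Rightarrow> ('g::group_add \<Rightarrow> 'h op \<Rightarrow> 'h op) \<Rightarrow> bool"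
  where "nuclear_module _ A \<alpha> \<longleftrightarrow>
    approximable A \<alpha>
      (\<lambda>\<phi>. \<exists>\<F> :: ('h, 'g, 'u) ambient map_family.
         group_admissible (cp_action A \<alpha>) (mat_action A) \<F> \<and>
         A_admissible_family A \<alpha> (cp_module A \<alpha>) (mat_module A \<alpha>) \<F> \<and>
         embed_map cp_idx mat_idx (crossed_product A \<alpha>) \<phi> \<in> \<F>)
      (\<lambda>\<psi>. let \<F> = {embed_map mat_idx cp_idx (mats A F) (\<psi> F) | F. finite F}
             :: ('h, 'g, 'u) ambient map_family in
         group_admissible (mat_action A) (cp_action A \<alpha>) \<F> \<and>
         A_admissible_family A \<alpha> (mat_module A \<alpha>) (cp_module A \<alpha>) \<F>)"

definition nuclear_comodule ::
  "'u itself \<Rightarrow> 'h op set \<Rightarrow> ('g::group_add \<Rightarrow> 'h op \<Rightarrow> 'h op) \<Rightarrow> bool"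
  where "nuclear_comodule _ A \<alpha> \<longleftrightarrow>
    approximable A \<alpha>
      (\<lambda>\<phi>. \<exists>\<F> :: ('h, 'g, 'u) ambient map_family.
         cogroup_admissible (insert (mat_coaction A) {X. cosystem X}) (cp_coaction A \<alpha>) (mat_coaction A) \<F> \<and>
         A_admissible_family A \<alpha> (cp_module A \<alpha>) (mat_module A \<alpha>) \<F> \<and>
         embed_map cp_idx mat_idx (crossed_product A \<alpha>) \<phi> \<in> \<F>)
      (\<lambda>\<psi>. let \<F> = {embed_map mat_idx cp_idx (mats A F) (\<psi> F) | F. finite F}
             :: ('h, 'g, 'u) ambient map_family in
         cogroup_admissible (insert (mat_coaction A) {X. cosystem X}) (mat_coaction A) (cp_coaction A \<alpha>) \<F> \<and>
         A_admissible_family A \<alpha> (mat_module A \<alpha>) (cp_module A \<alpha>) \<F>)"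

end

theory Submission
  imports Defs
begin

text \<open>
  Nuclearity makes the identity of \<open>B = A \<rtimes>\<^sub>r \<Gamma>\<close> a point-norm limit of maps \<open>\<psi>\<^sub>F \<circ> \<phi>\<^sub>F\<close> through \<open>\<bbbM>\<^sub>F(A)\<close>
  with both factors completely contractive. Let \<open>q : C \<rightarrow> D\<close> be a quotient map and let \<open>x \<in> B \<otimes> C\<close> vanish
  under \<open>id \<otimes> q\<close>. If \<open>A\<close> is exact, then \<open>(\<phi>\<^sub>F \<otimes> id) x\<close>, which also vanishes under \<open>id \<otimes> q\<close>, has all its
  entries in \<open>A \<otimes> ker q\<close>. Hence \<open>(\<psi>\<^sub>F\<phi>\<^sub>F \<otimes> id) x\<close> lies in \<open>B \<otimes> ker q\<close>, and so does its limit \<open>x\<close>.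
  The converse is the same argument for the factorization of the identity of \<open>A\<close> through \<open>B\<close> given by
  the canonical embedding and the conditional expectation.

  On the minimal tensor product, \<open>\<phi> \<otimes> id\<close> acts entrywise with respect to the standard basis of the second
  factor; complete boundedness of \<open>\<phi>\<close> bounds the matrix so obtained, uniformly over finite blocks.
\<close>

section \<open>Vectors\<close>

text \<open>\<open>tensor_ext\<close> is a choice, so nothing can be said of \<phi> \<otimes> id or
  id \<otimes> q before a bounded extension from simple tensors is known to exist. This obstacle
  shapes the proof: it asks for complete boundedness of two kinds of maps. For *-homomorphisms of
  algebras that may lack a unit it follows from contractivity on matrix algebras, which is obtained
  without spectral theory from a fixed point. For c.p. maps it follows from positivity of a 2 x 2
  block matrix; contractivity is assumed on the first matrix level only, but the value at the unit
  controls all levels. The uniform constant 1 permits the passage to the limit: x is replaced by a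
  finite sum of simple tensors, whose finitely many left legs decide which approximating maps are
  taken, and these maps do not enlarge the error of the replacement. The kernel of id \<otimes> q
  survives because \<phi> \<otimes> id and id \<otimes> q act on different legs and so commute. That
  M_F(A) inherits exactness from A is again a factorization argument, with the maps from M_F(A) to A
  and back given by single matrix positions.\<close>

lemma coord_uminus [simp]: "coord (- \<xi>) x = - coord \<xi> x"
  by (simp add: uminus_ell2_def)

lemma coord_diff [simp]: "coord (\<xi> - \<eta>) x = coord \<xi> x - coord \<eta> x"
  by (simp only: minus_ell2_def coord_add coord_uminus) simp

lemma coord_scaleR [simp]: "coord (r *\<^sub>R \<xi>) x = of_real r * coord \<xi> x"
  by (simp add: scaleR_ell2_def)

declare coord_add [simp] coord_zero [simp]

lemma coord_sum [simp]: "coord (sum f I) x = (\<Sum>i\<in>I. coord (f i) x)"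
  by (induction I rule: infinite_finite_induct) auto

lemma scaleC_simps [simp]:
  "1 *\<^sub>C \<xi> = \<xi>" "0 *\<^sub>C \<xi> = 0" "c *\<^sub>C 0 = (0 :: 'x ell2)"
  "c *\<^sub>C d *\<^sub>C \<xi> = (c * d) *\<^sub>C \<xi>"
  by (auto intro!: ell2_eqI)

lemma scaleC_distribs:
  "c *\<^sub>C (\<xi> + \<eta>) = c *\<^sub>C \<xi> + c *\<^sub>C \<eta>" "(c + d) *\<^sub>C \<xi> = c *\<^sub>C \<xi> + d *\<^sub>C \<xi>"
  "c *\<^sub>C (\<xi> - \<eta>) = c *\<^sub>C \<xi> - c *\<^sub>C \<eta>" "c *\<^sub>C (r *\<^sub>R \<xi>) = r *\<^sub>R (c *\<^sub>C \<xi>)"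
  by (auto intro!: ell2_eqI simp: algebra_simps)

lemma scaleC_of_real: "complex_of_real r *\<^sub>C \<xi> = r *\<^sub>R \<xi>"
  by (simp add: scaleR_ell2_def)

section \<open>Norms of vectors and expansions in the standard basis\<close>

lemma norm_ell2_sq: "(norm \<xi>)\<^sup>2 = (\<Sum>\<^sub>\<infinity>x. (cmod (coord \<xi> x))\<^sup>2)" for \<xi> :: "'x ell2"
  by (metis inner_self power2_norm_eq_inner)

lemma norm_ell2_le:
  assumes "\<And>F. finite F \<Longrightarrow> (\<Sum>x\<in>F. (cmod (coord \<xi> x))\<^sup>2) \<le> N\<^sup>2" "0 \<le> N"
  shows "norm \<xi> \<le> N"
proof -
  have "(norm \<xi>)\<^sup>2 \<le> N\<^sup>2"
    unfolding norm_ell2_sq by (rule infsum_le_finite_sums[OF coord_summable]) (use assms in auto)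
  then show ?thesis using assms(2) by (rule power2_le_imp_le)
qed

lemma sum_coord_le_norm: "finite F \<Longrightarrow> (\<Sum>x\<in>F. (cmod (coord \<xi> x))\<^sup>2) \<le> (norm \<xi>)\<^sup>2"
  unfolding norm_ell2_sq by (intro finite_sum_le_infsum coord_summable) auto

lemma L2_coord_le_norm: "finite F \<Longrightarrow> L2_set (\<lambda>x. cmod (coord \<xi> x)) F \<le> norm \<xi>"
  using sum_coord_le_norm[of F \<xi>] by (simp add: L2_set_def real_le_lsqrt)

lemma cmod_coord_le: "cmod (coord \<xi> x) \<le> norm \<xi>"
  using L2_coord_le_norm[of "{x}" \<xi>] by simp

lemma square_summable_if_bounded:
  assumes "\<And>F. finite F \<Longrightarrow> (\<Sum>x\<in>F. (cmod (f x))\<^sup>2) \<le> N"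
  shows "(\<lambda>x. (cmod (f x))\<^sup>2) summable_on UNIV"
  by (rule nonneg_bdd_above_summable_on) (use assms in \<open>auto intro!: bdd_aboveI2\<close>)

text \<open>\<open>Abs_ell2\<close> is meaningful on square summable families only. A bound
  \<open>N\<close> uniform over finite sets is the form in which summability is available for the
  vectors constructed by coordinates.\<close>

lemma coord_Abs:
  assumes "\<And>F. finite F \<Longrightarrow> (\<Sum>x\<in>F. (cmod (f x))\<^sup>2) \<le> N"
  shows "coord (Abs_ell2 f) = f"
  using square_summable_if_bounded[OF assms] by (simp add: Abs_ell2_inverse)

lemma norm_scaleC [simp]: "norm (c *\<^sub>C \<xi>) = cmod c * norm \<xi>"
proof -
  have "(norm (c *\<^sub>C \<xi>))\<^sup>2 = (cmod c * norm \<xi>)\<^sup>2"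
    by (simp add: norm_ell2_sq power_mult_distrib norm_mult infsum_cmult_right')
  then show ?thesis by (simp add: power2_eq_iff_nonneg)
qed

lemma coord_ket [simp]: "coord (ket x) y = (if y = x then 1 else 0)"
proof -
  have "coord (ket x) = (\<lambda>y. if y = x then 1 else 0)"
    unfolding ket_def
  proof (rule coord_Abs[where N = 1])
    fix F :: "'a set" assume "finite F"
    then show "(\<Sum>y\<in>F. (cmod (if y = x then 1 else 0))\<^sup>2) \<le> 1"
      by (simp add: if_distrib[of cmod] if_distrib[of "\<lambda>a. a\<^sup>2"] cong: if_cong)
  qed
  then show ?thesis by simp
qed

lemma coord_sum_ket: "finite F \<Longrightarrow> coord (\<Sum>x\<in>F. f x *\<^sub>C ket x) y = (if y \<in> F then f y else 0)"
  by (simp add: if_distrib[of "(*) _"] cong: if_cong)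

lemma norm_sum_ket:
  assumes "finite F"
  shows "norm (\<Sum>x\<in>F. f x *\<^sub>C ket x) = L2_set (\<lambda>x. cmod (f x)) F"
proof -
  have "(norm (\<Sum>x\<in>F. f x *\<^sub>C ket x))\<^sup>2 = (\<Sum>\<^sub>\<infinity>x. (cmod (if x \<in> F then f x else 0))\<^sup>2)"
    by (simp only: norm_ell2_sq coord_sum_ket[OF assms])
  also have "\<dots> = (\<Sum>\<^sub>\<infinity>x\<in>F. (cmod (f x))\<^sup>2)"
    by (intro infsum_cong_neutral) auto
  also have "\<dots> = (L2_set (\<lambda>x. cmod (f x)) F)\<^sup>2"
    using assms by (simp add: L2_set_def sum_nonneg)
  finally show ?thesis by (simp add: power2_eq_iff_nonneg L2_set_nonneg)
qed

lemma norm_ket [simp]: "norm (ket x) = 1"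
  using norm_sum_ket[of "{x}" "\<lambda>_. 1"] by simp

text \<open>By Pythagoras the squared distance from \<xi> to a finite partial sum is the squared
  norm minus the partial sum of squares, which tends to 0.\<close>

lemma has_sum_ket: "((\<lambda>x. coord \<xi> x *\<^sub>C ket x) has_sum \<xi>) UNIV"
proof -
  have "((\<lambda>x. (cmod (coord \<xi> x))\<^sup>2) has_sum (norm \<xi>)\<^sup>2) UNIV"
    unfolding norm_ell2_sq using coord_summable by (rule has_sum_infsum)
  then have lim: "((\<lambda>F. \<Sum>x\<in>F. (cmod (coord \<xi> x))\<^sup>2) \<longlongrightarrow> (norm \<xi>)\<^sup>2) (finite_subsets_at_top UNIV)"
    by (simp add: has_sum_def)
  have eq: "(norm ((\<Sum>x\<in>F. coord \<xi> x *\<^sub>C ket x) - \<xi>))\<^sup>2 = (norm \<xi>)\<^sup>2 - (\<Sum>x\<in>F. (cmod (coord \<xi> x))\<^sup>2)"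
    if F: "finite F" for F
  proof -
    have "(norm ((\<Sum>x\<in>F. coord \<xi> x *\<^sub>C ket x) - \<xi>))\<^sup>2
        = (\<Sum>\<^sub>\<infinity>x. (cmod ((if x \<in> F then coord \<xi> x else 0) - coord \<xi> x))\<^sup>2)"
      by (simp only: norm_ell2_sq coord_diff coord_sum_ket[OF F])
    also have "\<dots> = (\<Sum>\<^sub>\<infinity>x\<in>UNIV - F. (cmod (coord \<xi> x))\<^sup>2)"
      by (intro infsum_cong_neutral) auto
    also have "\<dots> = (norm \<xi>)\<^sup>2 - (\<Sum>x\<in>F. (cmod (coord \<xi> x))\<^sup>2)"
      using F by (subst infsum_Diff) (auto simp: norm_ell2_sq coord_summable)
    finally show ?thesis .
  qed
  have "((\<lambda>F. (norm ((\<Sum>x\<in>F. coord \<xi> x *\<^sub>C ket x) - \<xi>))\<^sup>2) \<longlongrightarrow> (norm \<xi>)\<^sup>2 - (norm \<xi>)\<^sup>2)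
      (finite_subsets_at_top UNIV)"
    by (rule Lim_transform_eventually[OF tendsto_diff[OF tendsto_const lim]])
      (auto intro!: eventually_finite_subsets_at_top_weakI simp: eq)
  then have "((\<lambda>F. sqrt ((norm ((\<Sum>x\<in>F. coord \<xi> x *\<^sub>C ket x) - \<xi>))\<^sup>2)) \<longlongrightarrow> sqrt 0)
      (finite_subsets_at_top UNIV)"
    by (intro tendsto_real_sqrt) simp
  then show ?thesis
    by (simp add: has_sum_def tendsto_norm_zero_iff LIM_zero_iff)
qed

text \<open>Bounded linear means real linear here, so the values are compared on all complex
  multiples of basis vectors; continuity does the rest.\<close>

lemma bounded_linear_eq_on_kets:
  fixes f g :: "'x ell2 \<Rightarrow> 'b::real_normed_vector"
  assumes "bounded_linear f" "bounded_linear g" "\<And>c x. f (c *\<^sub>C ket x) = g (c *\<^sub>C ket x)"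
  shows "f = g"
proof
  fix \<xi>
  have "((\<lambda>x. f (coord \<xi> x *\<^sub>C ket x)) has_sum f \<xi>) UNIV"
    using has_sum_bounded_linear[OF assms(1) has_sum_ket] by (simp add: o_def)
  moreover have "((\<lambda>x. g (coord \<xi> x *\<^sub>C ket x)) has_sum g \<xi>) UNIV"
    using has_sum_bounded_linear[OF assms(2) has_sum_ket] by (simp add: o_def)
  ultimately show "f \<xi> = g \<xi>" by (simp add: assms(3) has_sum_unique)
qed

text \<open>Operators inherit completeness from vectors; the contraction principle behind
  \<open>one_minus_sqrt_exists\<close> takes place in a closed set of operators.\<close>

instance ell2 :: (type) complete_space
proof
  fix X :: "nat \<Rightarrow> 'a ell2" assume "Cauchy X"
  then have ev: "\<And>e. e > 0 \<Longrightarrow> \<exists>M. \<forall>m\<ge>M. \<forall>n\<ge>M. norm (X m - X n) < e"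
    by (auto simp: Cauchy_def dist_norm)
  define f where "f x = lim (\<lambda>n. coord (X n) x)" for x
  have "Cauchy (\<lambda>n. coord (X n) x)" for x
  proof (rule CauchyI)
    fix e :: real assume "e > 0"
    from ev[OF this] obtain M where "\<forall>m\<ge>M. \<forall>n\<ge>M. norm (X m - X n) < e" by blast
    moreover have "norm (coord (X m) x - coord (X n) x) \<le> norm (X m - X n)" for m n
      using cmod_coord_le[of "X m - X n" x] by simp
    ultimately show "\<exists>M. \<forall>m\<ge>M. \<forall>n\<ge>M. norm (coord (X m) x - coord (X n) x) < e"
      using le_less_trans by blast
  qed
  then have f: "(\<lambda>n. coord (X n) x) \<longlonglongrightarrow> f x" for x
    using Cauchy_convergent convergent_LIMSEQ_iff by (auto simp: f_def)
  \<comment> \<open>The estimate is kept on finite coordinate sets, where the limit in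
    \<open>n\<close> may be taken term by term.\<close>
  have near: "\<exists>M. \<forall>m\<ge>M. \<forall>F. finite F \<longrightarrow> (\<Sum>x\<in>F. (cmod (coord (X m) x - f x))\<^sup>2) \<le> e\<^sup>2"
    if e: "e > 0" for e
  proof -
    obtain M where M: "\<forall>m\<ge>M. \<forall>n\<ge>M. norm (X m - X n) < e" using ev[OF e] by blast
    have "(\<Sum>x\<in>F. (cmod (coord (X m) x - f x))\<^sup>2) \<le> e\<^sup>2" if m: "m \<ge> M" and F: "finite F" for m F
    proof (rule LIMSEQ_le_const2)
      show "(\<lambda>n. \<Sum>x\<in>F. (cmod (coord (X m) x - coord (X n) x))\<^sup>2)
          \<longlonglongrightarrow> (\<Sum>x\<in>F. (cmod (coord (X m) x - f x))\<^sup>2)"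
        by (intro tendsto_intros f)
      have "(\<Sum>x\<in>F. (cmod (coord (X m) x - coord (X n) x))\<^sup>2) \<le> e\<^sup>2" if "n \<ge> M" for n
      proof -
        have "(\<Sum>x\<in>F. (cmod (coord (X m) x - coord (X n) x))\<^sup>2) \<le> (norm (X m - X n))\<^sup>2"
          using sum_coord_le_norm[OF F, of "X m - X n"] by simp
        also have "\<dots> \<le> e\<^sup>2" using M m that by (meson less_imp_le norm_ge_zero power_mono)
        finally show ?thesis .
      qed
      then show "\<exists>N. \<forall>n\<ge>N. (\<Sum>x\<in>F. (cmod (coord (X m) x - coord (X n) x))\<^sup>2) \<le> e\<^sup>2" by blast
    qed
    then show ?thesis by blast
  qed
  obtain M where M: "\<And>F. finite F \<Longrightarrow> (\<Sum>x\<in>F. (cmod (coord (X M) x - f x))\<^sup>2) \<le> 1\<^sup>2"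
    using near[of 1] by auto
  \<comment> \<open>Square summability is known for the differences
    \<open>coord (X M) x - f x\<close>, not yet for \<open>f\<close> itself, so the limit is reached
    by subtracting from \<open>X M\<close>.\<close>
  define \<zeta> where "\<zeta> = X M - Abs_ell2 (\<lambda>x. coord (X M) x - f x)"
  have \<zeta>: "coord \<zeta> x = f x" for x
    by (simp add: \<zeta>_def coord_Abs[OF M])
  have "X \<longlonglongrightarrow> \<zeta>"
  proof (rule LIMSEQ_I)
    fix r :: real assume r: "r > 0"
    obtain M where M: "\<forall>m\<ge>M. \<forall>F. finite F \<longrightarrow> (\<Sum>x\<in>F. (cmod (coord (X m) x - f x))\<^sup>2) \<le> (r/2)\<^sup>2"
      using near[of "r/2"] r by auto
    have *: "norm (X m - \<zeta>) \<le> r/2" if "m \<ge> M" for m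
      by (rule norm_ell2_le) (use M that r in \<open>auto simp: \<zeta>\<close>)
    have "norm (X m - \<zeta>) < r" if "m \<ge> M" for m
      using *[OF that] r by linarith
    then show "\<exists>no. \<forall>n\<ge>no. norm (X n - \<zeta>) < r" by blast
  qed
  then show "convergent X" by (auto simp: convergent_def)
qed

instance ell2 :: (type) banach ..

text \<open>Two real inner products, with \<open>\<i> *\<^sub>C \<xi>\<close> for the imaginary
  part, let additivity come from the class \<open>real_inner\<close>.\<close>

lemma cinner_eq: "cinner \<xi> \<eta> = complex_of_real (inner \<xi> \<eta>) + \<i> * complex_of_real (inner (\<i> *\<^sub>C \<xi>) \<eta>)"
proof -
  have *: "cnj (coord \<xi> x) * coord \<eta> x
     = complex_of_real (Re (cnj (coord \<xi> x) * coord \<eta> x))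
       + \<i> * complex_of_real (Re (cnj (coord (\<i> *\<^sub>C \<xi>) x) * coord \<eta> x))" for x
    by (simp add: complex_eq_iff)
  have s: "(\<lambda>x. complex_of_real (Re (cnj (coord \<xi> x) * coord \<eta> x))) summable_on UNIV" for \<xi> \<eta> :: "'a ell2"
    by (rule summable_on_of_real[OF inner_summable])
  have o: "(\<Sum>\<^sub>\<infinity>x. complex_of_real (Re (cnj (coord \<xi> x) * coord \<eta> x))) = of_real (inner \<xi> \<eta>)"
    for \<xi> \<eta> :: "'a ell2"
    unfolding inner_ell2_def by (intro infsumI has_sum_of_real has_sum_infsum inner_summable)
  have "cinner \<xi> \<eta> = (\<Sum>\<^sub>\<infinity>x. complex_of_real (Re (cnj (coord \<xi> x) * coord \<eta> x))
       + \<i> * complex_of_real (Re (cnj (coord (\<i> *\<^sub>C \<xi>) x) * coord \<eta> x)))"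
    unfolding cinner_def using * by presburger
  also have "\<dots> = (\<Sum>\<^sub>\<infinity>x. complex_of_real (Re (cnj (coord \<xi> x) * coord \<eta> x)))
       + \<i> * (\<Sum>\<^sub>\<infinity>x. complex_of_real (Re (cnj (coord (\<i> *\<^sub>C \<xi>) x) * coord \<eta> x)))"
    by (subst infsum_add[OF s summable_on_cmult_right[OF s]]) (simp only: infsum_cmult_right')
  finally show ?thesis by (simp only: o)
qed

lemma Re_cinner: "Re (cinner \<xi> \<eta>) = inner \<xi> \<eta>"
  by (simp add: cinner_eq)

lemma cinner_add: "cinner (\<xi> + \<xi>') \<eta> = cinner \<xi> \<eta> + cinner \<xi>' \<eta>"
  "cinner \<xi> (\<eta> + \<eta>') = cinner \<xi> \<eta> + cinner \<xi> \<eta>'"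
  by (simp_all add: cinner_eq inner_simps scaleC_distribs algebra_simps)

lemma cinner_scaleC [simp]: "cinner (c *\<^sub>C \<xi>) \<eta> = cnj c * cinner \<xi> \<eta>"
  "cinner \<xi> (c *\<^sub>C \<eta>) = c * cinner \<xi> \<eta>"
  unfolding cinner_def by (simp_all add: infsum_cmult_right'[symmetric] algebra_simps)

lemma cinner_scaleR: "cinner (r *\<^sub>R \<xi>) \<eta> = r * cinner \<xi> \<eta>" "cinner \<xi> (r *\<^sub>R \<eta>) = r * cinner \<xi> \<eta>"
  by (simp_all add: scaleR_ell2_def)

lemma cinner_commute: "cinner \<eta> \<xi> = cnj (cinner \<xi> \<eta>)"
  unfolding cinner_def by (simp add: infsum_cnj[symmetric] mult.commute)

lemma cinner_self: "cinner \<xi> \<xi> = of_real ((norm \<xi>)\<^sup>2)"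
proof -
  have "Im (cinner \<xi> \<xi>) = 0" using cinner_commute[of \<xi> \<xi>] by (simp add: complex_eq_iff)
  then show ?thesis by (simp add: complex_eq_iff Re_cinner power2_norm_eq_inner)
qed

lemma cinner_zero [simp]: "cinner 0 \<eta> = 0" "cinner \<xi> 0 = 0"
  by (simp_all add: cinner_def)

lemma cmod_cinner_le: "cmod (cinner \<xi> \<eta>) \<le> norm \<xi> * norm \<eta>"
proof (cases "cinner \<xi> \<eta> = 0")
  case False
  \<comment> \<open>This phase turns the inner product into its modulus, a real number, to which the
    real Cauchy-Schwarz inequality applies.\<close>
  define c where "c = cnj (cinner \<xi> \<eta>) / cmod (cinner \<xi> \<eta>)"
  have c: "cmod c = 1" using False by (simp add: c_def norm_divide)
  have "cinner \<xi> (c *\<^sub>C \<eta>) = cmod (cinner \<xi> \<eta>)"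
    using False by (simp add: c_def complex_norm_square[symmetric] power2_eq_square field_simps)
  then have "cmod (cinner \<xi> \<eta>) = inner \<xi> (c *\<^sub>C \<eta>)" by (metis Re_cinner Re_complex_of_real)
  also have "\<dots> \<le> norm \<xi> * norm (c *\<^sub>C \<eta>)" by (rule norm_cauchy_schwarz)
  finally show ?thesis by (simp add: c)
qed simp

lemma bounded_bilinear_cinner: "bounded_bilinear cinner"
  by (rule bounded_bilinear.intro)
    (auto simp: cinner_add cinner_scaleR scaleR_conv_of_real intro!: exI[of _ 1] cmod_cinner_le)

lemmas cinner_linear_simps =
  bounded_bilinear.diff_left[OF bounded_bilinear_cinner]
  bounded_bilinear.diff_right[OF bounded_bilinear_cinner]
  bounded_bilinear.minus_left[OF bounded_bilinear_cinner]
  bounded_bilinear.minus_right[OF bounded_bilinear_cinner]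
lemmas cinner_sum_left = bounded_bilinear.sum_left[OF bounded_bilinear_cinner]
lemmas cinner_sum_right = bounded_bilinear.sum_right[OF bounded_bilinear_cinner]
lemmas bounded_linear_cinner_left = bounded_bilinear.bounded_linear_left[OF bounded_bilinear_cinner]
lemmas bounded_linear_cinner_right = bounded_bilinear.bounded_linear_right[OF bounded_bilinear_cinner]

lemma cinner_ket [simp]: "cinner (ket x) \<eta> = coord \<eta> x"
proof -
  have "cinner (ket x) \<eta> = (\<Sum>\<^sub>\<infinity>y\<in>{x}. coord \<eta> y)"
    unfolding cinner_def by (intro infsum_cong_neutral) auto
  then show ?thesis by simp
qed

lemma cinner_ket_right [simp]: "cinner \<eta> (ket x) = cnj (coord \<eta> x)"
  by (subst cinner_commute) simp

lemma cinner_ext: "(\<And>\<xi>. cinner \<xi> \<eta> = cinner \<xi> \<eta>') \<Longrightarrow> \<eta> = \<eta>'"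
  by (metis cinner_ket ell2_eqI)

lemma cinner_ext_left: "(\<And>\<xi>. cinner \<eta> \<xi> = cinner \<eta>' \<xi>) \<Longrightarrow> \<eta> = \<eta>'"
  by (metis cinner_commute cinner_ext)

section \<open>Operators and adjoints\<close>

lemma clinear_opD: "clinear_op T \<Longrightarrow> blinfun_apply T (c *\<^sub>C \<xi>) = c *\<^sub>C blinfun_apply T \<xi>"
  by (simp add: clinear_op_def)

lemma bop_iff [simp]: "T \<in> bop \<longleftrightarrow> clinear_op T"
  by (simp add: bop_def)

lemma blinfun_eq_on_kets:
  fixes S T :: "'x ell2 \<Rightarrow>\<^sub>L 'b::real_normed_vector"
  assumes "\<And>c x. blinfun_apply S (c *\<^sub>C ket x) = blinfun_apply T (c *\<^sub>C ket x)"
  shows "S = T"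
  using bounded_linear_eq_on_kets[OF blinfun.bounded_linear_right blinfun.bounded_linear_right assms]
  by (simp add: blinfun_apply_inject)

lemma clinear_op_eqI:
  assumes "clinear_op S" "clinear_op T" "\<And>x. blinfun_apply S (ket x) = blinfun_apply T (ket x)"
  shows "S = T"
  by (rule blinfun_eq_on_kets) (simp add: assms clinear_opD)

lemma bounded_linear_scaleC: "bounded_linear (\<lambda>\<xi>. c *\<^sub>C \<xi>)"
  by (rule bounded_linear_intro[where K = "cmod c"]) (auto simp: scaleC_distribs)

lemma scale_op_apply [simp]: "blinfun_apply (scale_op c T) \<xi> = c *\<^sub>C blinfun_apply T \<xi>"
  unfolding scale_op_def
  by (subst bounded_linear_Blinfun_apply)
    (auto intro: bounded_linear_compose[OF bounded_linear_scaleC] blinfun.bounded_linear_right)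

lemma scale_op_simps [simp]:
  "scale_op 1 T = T" "scale_op 0 T = 0" "scale_op c 0 = 0" "scale_op c (scale_op d T) = scale_op (c * d) T"
  "scale_op (-1) T = - T"
  by (auto intro!: blinfun_eqI ell2_eqI simp: blinfun.zero_left blinfun.minus_left)

lemma scale_op_distribs:
  "scale_op c (S + T) = scale_op c S + scale_op c T" "scale_op (c + d) T = scale_op c T + scale_op d T"
  "scale_op c (S - T) = scale_op c S - scale_op c T"
  by (auto intro!: blinfun_eqI simp: blinfun.add_left blinfun.diff_left scaleC_distribs)

lemma scale_op_of_real: "scale_op (complex_of_real r) T = r *\<^sub>R T"
  by (rule blinfun_eqI) (simp add: blinfun.scaleR_left scaleC_of_real)

lemma norm_scale_op: "norm (scale_op c T) \<le> cmod c * norm T"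
  by (rule norm_blinfun_bound)
    (auto intro: order_trans[OF mult_left_mono[OF norm_blinfun]] simp: mult_ac)

lemma scale_op_sum: "scale_op c (\<Sum>i\<in>I. T i) = (\<Sum>i\<in>I. scale_op c (T i))"
  by (induction I rule: infinite_finite_induct) (auto simp: scale_op_distribs)

lemma bounded_linear_scale_op: "bounded_linear (scale_op c)"
proof (rule bounded_linear_intro[where K = "cmod c"])
  show "scale_op c (r *\<^sub>R T) = r *\<^sub>R scale_op c T" for r T
    by (simp add: scale_op_of_real[symmetric] mult.commute)
qed (auto simp: scale_op_distribs mult.commute intro: order_trans[OF norm_scale_op])

lemma compose_distribs:
  "(S + S') o\<^sub>L T = (S o\<^sub>L T) + (S' o\<^sub>L T)" "S o\<^sub>L (T + T') = (S o\<^sub>L T) + (S o\<^sub>L T')"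
  "(S - S') o\<^sub>L T = (S o\<^sub>L T) - (S' o\<^sub>L T)" "S o\<^sub>L (T - T') = (S o\<^sub>L T) - (S o\<^sub>L T')"
  "0 o\<^sub>L T = 0" "S o\<^sub>L 0 = 0"
  by (auto intro!: blinfun_eqI simp: blinfun.bilinear_simps)

lemma compose_sum: "(\<Sum>i\<in>I. S i) o\<^sub>L T = (\<Sum>i\<in>I. S i o\<^sub>L T)" "T o\<^sub>L (\<Sum>i\<in>I. S' i) = (\<Sum>i\<in>I. T o\<^sub>L S' i)"
  by (induction I rule: infinite_finite_induct) (auto simp: compose_distribs)

lemma compose_assoc: "(S o\<^sub>L T) o\<^sub>L U = S o\<^sub>L (T o\<^sub>L U)"
  by (rule blinfun_eqI) simp

lemma id_compose [simp]: "id_blinfun o\<^sub>L T = T" "T o\<^sub>L id_blinfun = T"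
  by (auto intro: blinfun_eqI)

lemma clinear_op_intros [simp, intro]:
  "clinear_op id_blinfun" "clinear_op 0"
  "clinear_op S \<Longrightarrow> clinear_op S' \<Longrightarrow> clinear_op (S + S')"
  "clinear_op S \<Longrightarrow> clinear_op S' \<Longrightarrow> clinear_op (S - S')"
  "clinear_op S \<Longrightarrow> clinear_op (- S)"
  "clinear_op V \<Longrightarrow> clinear_op (scale_op c V)"
  by (auto simp: clinear_op_def blinfun.add_left blinfun.diff_left blinfun.minus_left blinfun.zero_left
      algebra_simps intro!: ell2_eqI)

lemma clinear_op_compose [simp, intro]:
  "clinear_op S \<Longrightarrow> clinear_op T \<Longrightarrow> clinear_op (S o\<^sub>L T)"
  by (simp add: clinear_op_def)

lemma clinear_op_sum [simp, intro]: "(\<And>i. i \<in> I \<Longrightarrow> clinear_op (T i)) \<Longrightarrow> clinear_op (\<Sum>i\<in>I. T i)"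
  by (induction I rule: infinite_finite_induct) auto

lemma closed_bop: "closed (bop :: 'x op set)"
proof -
  have *: "bop = (\<Inter>c. \<Inter>\<xi>. {T :: 'x op. blinfun_apply T (c *\<^sub>C \<xi>) = c *\<^sub>C blinfun_apply T \<xi>})"
    by (auto simp: clinear_op_def)
  show ?thesis
    unfolding * by (intro closed_INT ballI closed_Collect_eq bounded_linear.continuous_on[OF bounded_linear_scaleC]
        continuous_intros)
qed

section \<open>Operators given by forms and by scalar matrices\<close>

lemma norm_le_form:
  fixes T :: "'x ell2 \<Rightarrow>\<^sub>L 'y ell2"
  assumes "\<And>\<xi> \<eta>. cmod (cinner \<xi> (blinfun_apply T \<eta>)) \<le> N * norm \<xi> * norm \<eta>" "0 \<le> N"
  shows "norm T \<le> N"
proof (rule norm_blinfun_bound)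
  fix \<eta>
  have "norm (blinfun_apply T \<eta>) * norm (blinfun_apply T \<eta>) \<le> N * norm \<eta> * norm (blinfun_apply T \<eta>)"
    using assms(1)[of "blinfun_apply T \<eta>" \<eta>] by (simp add: cinner_self norm_mult power2_eq_square mult_ac)
  then show "norm (blinfun_apply T \<eta>) \<le> N * norm \<eta>"
    by (cases "norm (blinfun_apply T \<eta>) = 0") (use assms(2) in \<open>simp_all\<close>)
qed (use assms in auto)

lemma form_le_norm: "cmod (cinner \<xi> (blinfun_apply T \<eta>)) \<le> norm T * norm \<xi> * norm \<eta>"
proof -
  have "cmod (cinner \<xi> (blinfun_apply T \<eta>)) \<le> norm \<xi> * norm (blinfun_apply T \<eta>)"
    by (rule cmod_cinner_le)
  also have "\<dots> \<le> norm \<xi> * (norm T * norm \<eta>)"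
    by (intro mult_left_mono norm_blinfun) auto
  finally show ?thesis by (simp add: mult_ac)
qed

lemma L2_sq: "(L2_set f F)\<^sup>2 = (\<Sum>x\<in>F. (f x)\<^sup>2)"
  by (simp add: L2_set_def sum_nonneg)

text \<open>The bound on finite sections makes the rows square summable, so an operator can be
  defined by pairing with the rows. Adjoints and operators with prescribed blocks are obtained from
  this existence statement.\<close>

lemma matrix_op:
  fixes r :: "'a \<Rightarrow> 'b \<Rightarrow> complex"
  assumes bd: "\<And>F G u v. finite F \<Longrightarrow> finite G \<Longrightarrow>
      cmod (\<Sum>a\<in>F. \<Sum>b\<in>G. cnj (u a) * r a b * v b)
        \<le> N * L2_set (\<lambda>a. cmod (u a)) F * L2_set (\<lambda>b. cmod (v b)) G"
    and N: "0 \<le> N"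
  obtains R :: "'b ell2 \<Rightarrow>\<^sub>L 'a ell2"
  where "clinear_op R" "norm R \<le> N" "\<And>a b. coord (blinfun_apply R (ket b)) a = r a b"
proof -
  \<comment> \<open>Testing a form against its own value \<open>w\<close> gives a square on the
    left; cancelling one factor leaves the bound \<open>K\<close>.\<close>
  have self_bd: "(L2_set (\<lambda>x. cmod (w x)) F)\<^sup>2 \<le> K\<^sup>2"
    if "cmod (\<Sum>x\<in>F. cnj (w x) * w x) \<le> K * L2_set (\<lambda>x. cmod (w x)) F" "0 \<le> K" for w :: "'z \<Rightarrow> complex" and F K
  proof -
    have "(\<Sum>x\<in>F. cnj (w x) * w x) = of_real ((L2_set (\<lambda>x. cmod (w x)) F)\<^sup>2)"
      unfolding L2_sq of_real_sum by (intro sum.cong refl) (metis complex_norm_square mult.commute)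
    then have "L2_set (\<lambda>x. cmod (w x)) F * L2_set (\<lambda>x. cmod (w x)) F \<le> K * L2_set (\<lambda>x. cmod (w x)) F"
      using that by (simp add: norm_mult power2_eq_square)
    then have "L2_set (\<lambda>x. cmod (w x)) F \<le> K"
      using that(2) by (cases "L2_set (\<lambda>x. cmod (w x)) F = 0") (auto simp: L2_set_nonneg less_le)
    then show ?thesis by (intro power_mono L2_set_nonneg)
  qed
  have row: "(\<Sum>b\<in>G. (cmod (cnj (r a b)))\<^sup>2) \<le> N\<^sup>2" if G: "finite G" for a G
    using self_bd[of "\<lambda>b. cnj (r a b)" G N] bd[of "{a}" G "\<lambda>_. 1" "\<lambda>b. cnj (r a b)"] G N
    by (simp add: L2_sq)
  define \<rho> where "\<rho> a = Abs_ell2 (\<lambda>b. cnj (r a b))" for a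
  have \<rho>: "coord (\<rho> a) b = cnj (r a b)" for a b
    unfolding \<rho>_def by (subst coord_Abs[OF row]) auto
  \<comment> \<open>The hypothesis covers finitely supported \<eta> only; a general \<eta> is the
    limit of its partial sums, and finitely many coordinates pass to the limit.\<close>
  have col: "(\<Sum>a\<in>F. (cmod (cinner (\<rho> a) \<eta>))\<^sup>2) \<le> (N * norm \<eta>)\<^sup>2" if F: "finite F" for F \<eta>
  proof (rule tendsto_upperbound)
    have "((\<lambda>G. \<Sum>b\<in>G. coord \<eta> b *\<^sub>C ket b) \<longlongrightarrow> \<eta>) (finite_subsets_at_top UNIV)"
      using has_sum_ket[of \<eta>] by (simp add: has_sum_def)
    then show "((\<lambda>G. \<Sum>a\<in>F. (cmod (cinner (\<rho> a) (\<Sum>b\<in>G. coord \<eta> b *\<^sub>C ket b)))\<^sup>2)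
        \<longlongrightarrow> (\<Sum>a\<in>F. (cmod (cinner (\<rho> a) \<eta>))\<^sup>2)) (finite_subsets_at_top UNIV)"
      by (intro tendsto_intros bounded_linear.tendsto[OF bounded_linear_cinner_right])
    show "\<forall>\<^sub>F G in finite_subsets_at_top UNIV.
        (\<Sum>a\<in>F. (cmod (cinner (\<rho> a) (\<Sum>b\<in>G. coord \<eta> b *\<^sub>C ket b)))\<^sup>2) \<le> (N * norm \<eta>)\<^sup>2"
    proof (rule eventually_finite_subsets_at_top_weakI)
      fix G :: "'b set" assume G: "finite G"
      define w where "w a = cinner (\<rho> a) (\<Sum>b\<in>G. coord \<eta> b *\<^sub>C ket b)" for a
      have w: "w a = (\<Sum>b\<in>G. r a b * coord \<eta> b)" for a
        by (simp add: w_def cinner_sum_right \<rho> mult.commute)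
      have "(L2_set (\<lambda>a. cmod (w a)) F)\<^sup>2 \<le> (N * norm \<eta>)\<^sup>2"
      proof (rule self_bd)
        have "(\<Sum>a\<in>F. cnj (w a) * w a) = (\<Sum>a\<in>F. \<Sum>b\<in>G. cnj (w a) * r a b * coord \<eta> b)"
          unfolding w[of _] by (simp add: sum_distrib_left mult.assoc)
        then have "cmod (\<Sum>a\<in>F. cnj (w a) * w a)
            \<le> N * L2_set (\<lambda>a. cmod (w a)) F * L2_set (\<lambda>b. cmod (coord \<eta> b)) G"
          using bd[OF F G] by simp
        also have "\<dots> \<le> N * L2_set (\<lambda>a. cmod (w a)) F * norm \<eta>"
          using N by (intro mult_left_mono L2_coord_le_norm G mult_nonneg_nonneg L2_set_nonneg)
        finally show "cmod (\<Sum>a\<in>F. cnj (w a) * w a) \<le> N * norm \<eta> * L2_set (\<lambda>a. cmod (w a)) F"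
          by (simp add: mult_ac)
      qed (use N in auto)
      then show "(\<Sum>a\<in>F. (cmod (cinner (\<rho> a) (\<Sum>b\<in>G. coord \<eta> b *\<^sub>C ket b)))\<^sup>2) \<le> (N * norm \<eta>)\<^sup>2"
        by (simp add: L2_sq w_def)
    qed
  qed simp
  define f where "f \<eta> = Abs_ell2 (\<lambda>a. cinner (\<rho> a) \<eta>)" for \<eta>
  have f: "coord (f \<eta>) a = cinner (\<rho> a) \<eta>" for \<eta> a
    unfolding f_def by (subst coord_Abs[OF col]) auto
  have nf: "norm (f \<eta>) \<le> norm \<eta> * N" for \<eta>
    by (rule norm_ell2_le) (use col N in \<open>auto simp: f mult.commute\<close>)
  have bl: "bounded_linear f"
    by (rule bounded_linear_intro[OF _ _ nf]) (auto intro!: ell2_eqI simp: f cinner_add cinner_scaleR)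
  show ?thesis
  proof
    show "clinear_op (Blinfun f)"
      by (auto simp: clinear_op_def bounded_linear_Blinfun_apply[OF bl] f intro!: ell2_eqI)
    show "norm (Blinfun f) \<le> N"
      by (rule norm_blinfun_bound) (use nf N in \<open>auto simp: bounded_linear_Blinfun_apply[OF bl] mult.commute\<close>)
    show "coord (blinfun_apply (Blinfun f) (ket b)) a = r a b" for a b
      by (simp add: bounded_linear_Blinfun_apply[OF bl] f \<rho>)
  qed
qed

section \<open>Adjoints\<close>

lemma clinear_op_sum_ket:
  "clinear_op T \<Longrightarrow> blinfun_apply T (\<Sum>x\<in>F. f x *\<^sub>C ket x) = (\<Sum>x\<in>F. f x *\<^sub>C blinfun_apply T (ket x))"
  by (simp add: blinfun.sum_right clinear_opD)

text \<open>The conjugate transpose of the matrix of \<open>T\<close> satisfies the form bound of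
  \<open>T\<close>. The adjoint relation is then extended from basis vectors, one argument at a
  time.\<close>

lemma adj_exists:
  fixes T :: "'x ell2 \<Rightarrow>\<^sub>L 'y ell2"
  assumes T: "clinear_op T"
  obtains S where "clinear_op S" "\<And>\<xi> \<eta>. cinner (blinfun_apply S \<eta>) \<xi> = cinner \<eta> (blinfun_apply T \<xi>)"
proof -
  define r where "r a b = cnj (coord (blinfun_apply T (ket a)) b)" for a b
  obtain S where S: "clinear_op S" "\<And>a b. coord (blinfun_apply S (ket b)) a = r a b"
  proof (rule matrix_op[of r "norm T"])
    fix F :: "'x set" and G :: "'y set" and u :: "'x \<Rightarrow> complex" and v :: "'y \<Rightarrow> complex" assume fin: "finite F" "finite G"
    have "cinner (blinfun_apply T (\<Sum>a\<in>F. u a *\<^sub>C ket a)) (\<Sum>b\<in>G. v b *\<^sub>C ket b)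
        = (\<Sum>a\<in>F. \<Sum>b\<in>G. cnj (u a) * r a b * v b)"
      by (simp add: clinear_op_sum_ket[OF T] cinner_sum_left cinner_sum_right r_def mult_ac sum_distrib_left)
        (rule sum.swap)
    moreover have "cmod (cinner (blinfun_apply T (\<Sum>a\<in>F. u a *\<^sub>C ket a)) (\<Sum>b\<in>G. v b *\<^sub>C ket b))
        \<le> norm T * norm (\<Sum>a\<in>F. u a *\<^sub>C ket a) * norm (\<Sum>b\<in>G. v b *\<^sub>C ket b)"
      by (rule order_trans[OF cmod_cinner_le mult_right_mono[OF norm_blinfun]]) auto
    ultimately show "cmod (\<Sum>a\<in>F. \<Sum>b\<in>G. cnj (u a) * r a b * v b)
        \<le> norm T * L2_set (\<lambda>a. cmod (u a)) F * L2_set (\<lambda>b. cmod (v b)) G"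
      using fin by (simp add: norm_sum_ket)
  qed auto
  have "cinner (blinfun_apply S \<eta>) \<xi> = cinner \<eta> (blinfun_apply T \<xi>)" for \<xi> \<eta>
  proof -
    have "(\<lambda>\<xi>. cinner (blinfun_apply S (ket b)) \<xi>) = (\<lambda>\<xi>. cinner (ket b) (blinfun_apply T \<xi>))" for b
      by (rule bounded_linear_eq_on_kets[OF bounded_linear_cinner_right
            bounded_linear_compose[OF bounded_linear_cinner_right blinfun.bounded_linear_right]])
        (simp add: S clinear_opD[OF T] r_def)
    then have *: "cinner (blinfun_apply S (ket b)) \<xi> = cinner (ket b) (blinfun_apply T \<xi>)" for b \<xi>
      by metis
    have "(\<lambda>\<eta>. cinner (blinfun_apply S \<eta>) \<xi>) = (\<lambda>\<eta>. cinner \<eta> (blinfun_apply T \<xi>))"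
      by (rule bounded_linear_eq_on_kets[OF
            bounded_linear_compose[OF bounded_linear_cinner_left blinfun.bounded_linear_right]
            bounded_linear_cinner_left])
        (simp add: * clinear_opD[OF S(1)])
    then show ?thesis by metis
  qed
  with S that show ?thesis by blast
qed

text \<open>The description in \<open>adj\<close> has at most one solution since the inner product
  separates vectors; exhibiting a candidate therefore computes the adjoint.\<close>

lemma adj_eqI:
  assumes "\<And>\<xi> \<eta>. cinner (blinfun_apply S \<eta>) \<xi> = cinner \<eta> (blinfun_apply T \<xi>)"
  shows "adj T = S"
  unfolding adj_def
proof (rule the_equality)
  show "S' = S" if "\<forall>\<xi> \<eta>. cinner (blinfun_apply S' \<eta>) \<xi> = cinner \<eta> (blinfun_apply T \<xi>)" for S'
    using that assms by (intro blinfun_eqI cinner_ext_left) simp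
qed (use assms in auto)

lemma
  assumes "clinear_op T"
  shows clinear_op_adj [simp, intro]: "clinear_op (adj T)"
    and cinner_adj: "cinner (blinfun_apply (adj T) \<eta>) \<xi> = cinner \<eta> (blinfun_apply T \<xi>)"
  using adj_exists[OF assms] adj_eqI by metis+

lemma cinner_adj_right:
  "clinear_op T \<Longrightarrow> cinner \<xi> (blinfun_apply (adj T) \<eta>) = cinner (blinfun_apply T \<xi>) \<eta>"
  by (metis cinner_adj cinner_commute)

lemma adj_adj [simp]: "clinear_op T \<Longrightarrow> adj (adj T) = T"
  by (rule adj_eqI) (simp add: cinner_adj_right)

lemma adj_compose: "clinear_op S \<Longrightarrow> clinear_op T \<Longrightarrow> adj (S o\<^sub>L T) = adj T o\<^sub>L adj S"
  by (rule adj_eqI) (simp add: cinner_adj)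

lemma adj_add: "clinear_op S \<Longrightarrow> clinear_op T \<Longrightarrow> adj (S + T) = adj S + adj T"
  by (rule adj_eqI) (simp add: cinner_adj blinfun.bilinear_simps cinner_add)

lemma adj_diff: "clinear_op S \<Longrightarrow> clinear_op T \<Longrightarrow> adj (S - T) = adj S - adj T"
  by (rule adj_eqI) (simp add: cinner_adj blinfun.bilinear_simps cinner_linear_simps)

lemma adj_zero [simp]: "adj 0 = 0"
  by (rule adj_eqI) (simp add: blinfun.zero_left)

lemma adj_id [simp]: "adj id_blinfun = id_blinfun"
  by (rule adj_eqI) simp

lemma adj_scale_op: "clinear_op T \<Longrightarrow> adj (scale_op c T) = scale_op (cnj c) (adj T)"
  by (rule adj_eqI) (simp add: cinner_adj)

lemma adj_sum: "(\<And>i. i \<in> I \<Longrightarrow> clinear_op (T i)) \<Longrightarrow> adj (\<Sum>i\<in>I. T i) = (\<Sum>i\<in>I. adj (T i))"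
  by (induction I rule: infinite_finite_induct) (auto simp: adj_add)

lemma norm_adj_le: "clinear_op T \<Longrightarrow> norm (adj T) \<le> norm T"
proof (rule norm_le_form)
  fix \<xi> \<eta> assume "clinear_op T"
  then have "cmod (cinner \<xi> (blinfun_apply (adj T) \<eta>)) = cmod (cinner \<eta> (blinfun_apply T \<xi>))"
    by (simp add: cinner_adj_right) (metis cinner_commute complex_mod_cnj)
  then show "cmod (cinner \<xi> (blinfun_apply (adj T) \<eta>)) \<le> norm T * norm \<xi> * norm \<eta>"
    using form_le_norm[of \<eta> T \<xi>] by (simp add: mult_ac)
qed simp

lemma norm_adj: "clinear_op T \<Longrightarrow> norm (adj T) = norm T"
  by (metis adj_adj antisym clinear_op_adj norm_adj_le)

text \<open>The nontrivial half of the C*-identity. It reduces norm estimates for homomorphisms to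
  self-adjoint elements.\<close>

lemma norm_sq_le_adj_compose:
  assumes "clinear_op T"
  shows "(norm T)\<^sup>2 \<le> norm (adj T o\<^sub>L T)"
proof -
  have "norm T \<le> sqrt (norm (adj T o\<^sub>L T))"
  proof (rule norm_blinfun_bound)
    fix \<xi>
    have "(norm (blinfun_apply T \<xi>))\<^sup>2 = cmod (cinner \<xi> (blinfun_apply (adj T o\<^sub>L T) \<xi>))"
      by (simp add: cinner_adj_right[OF assms] cinner_self norm_power)
    also have "\<dots> \<le> norm (adj T o\<^sub>L T) * (norm \<xi>)\<^sup>2"
      using form_le_norm[of \<xi> "adj T o\<^sub>L T" \<xi>] by (simp add: power2_eq_square mult_ac)
    finally show "norm (blinfun_apply T \<xi>) \<le> sqrt (norm (adj T o\<^sub>L T)) * norm \<xi>"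
      using power2_le_imp_le[of "norm (blinfun_apply T \<xi>)" "sqrt (norm (adj T o\<^sub>L T)) * norm \<xi>"]
      by (simp add: power_mult_distrib)
  qed simp
  then show ?thesis by (metis norm_ge_zero power_mono real_sqrt_pow2)
qed

lemma norm_compose_le: "norm (S o\<^sub>L T) \<le> norm S * norm T"
  by (rule norm_blinfun_compose)

lemma norm_compose3_le: "norm (S o\<^sub>L x o\<^sub>L T) \<le> norm S * norm x * norm T"
  by (rule order_trans[OF norm_compose_le mult_right_mono[OF norm_compose_le]]) simp

lemma bounded_linear_compose_op: "bounded_linear (\<lambda>x. S o\<^sub>L x o\<^sub>L T)"
proof (rule bounded_linear_intro)
  show "norm (S o\<^sub>L x o\<^sub>L T) \<le> norm x * (norm S * norm T)" for x
    using norm_compose3_le[of S x T] by (simp add: mult_ac)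
  show "S o\<^sub>L (r *\<^sub>R x) o\<^sub>L T = r *\<^sub>R (S o\<^sub>L x o\<^sub>L T)" for r x
    by (rule blinfun_eqI) (simp add: blinfun.scaleR_left blinfun.scaleR_right)
qed (simp add: compose_distribs)

section \<open>Block decompositions over an index set\<close>

lemma sum_tensor_le:
  assumes "finite F"
  shows "(\<Sum>p\<in>F. (cmod (case p of (x, y) \<Rightarrow> coord \<xi> x * coord \<eta> y))\<^sup>2) \<le> (norm \<xi> * norm \<eta>)\<^sup>2"
proof -
  have "(\<Sum>p\<in>F. (cmod (case p of (x, y) \<Rightarrow> coord \<xi> x * coord \<eta> y))\<^sup>2)
      \<le> (\<Sum>p\<in>fst ` F \<times> snd ` F. (cmod (case p of (x, y) \<Rightarrow> coord \<xi> x * coord \<eta> y))\<^sup>2)"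
    using assms by (intro sum_mono2) force+
  also have "\<dots> = (\<Sum>x\<in>fst ` F. (cmod (coord \<xi> x))\<^sup>2) * (\<Sum>y\<in>snd ` F. (cmod (coord \<eta> y))\<^sup>2)"
    by (simp add: sum_product sum.cartesian_product norm_mult power_mult_distrib split_beta)
  also have "\<dots> \<le> (norm \<xi>)\<^sup>2 * (norm \<eta>)\<^sup>2"
    using assms by (intro mult_mono sum_coord_le_norm sum_nonneg) auto
  finally show ?thesis by (simp add: power_mult_distrib)
qed

lemma coord_tensor [simp]: "coord (\<xi> \<otimes>\<^sub>v \<eta>) p = coord \<xi> (fst p) * coord \<eta> (snd p)"
  unfolding tensor_vec_def by (subst coord_Abs[OF sum_tensor_le]) (auto simp: split_beta)

lemma norm_tensor_vec_le: "norm (\<xi> \<otimes>\<^sub>v \<eta>) \<le> norm \<xi> * norm \<eta>"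
  by (rule norm_ell2_le) (use sum_tensor_le in \<open>auto simp: split_beta\<close>)

lemma bounded_bilinear_tensor_vec: "bounded_bilinear tensor_vec"
  by (rule bounded_bilinear.intro)
    (auto intro!: ell2_eqI exI[of _ 1] norm_tensor_vec_le simp: algebra_simps)

lemma tensor_vec_scaleC [simp]:
  "(c *\<^sub>C \<xi>) \<otimes>\<^sub>v \<eta> = c *\<^sub>C (\<xi> \<otimes>\<^sub>v \<eta>)" "\<xi> \<otimes>\<^sub>v (c *\<^sub>C \<eta>) = c *\<^sub>C (\<xi> \<otimes>\<^sub>v \<eta>)"
  by (auto intro: ell2_eqI)

lemma tensor_ket: "ket x \<otimes>\<^sub>v ket y = ket (x, y)"
  by (rule ell2_eqI) auto

lemma blinfun_eq_on_tensors:
  fixes S T :: "('x \<times> 'y) ell2 \<Rightarrow>\<^sub>L 'b::real_normed_vector"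
  assumes "\<And>\<xi> y. blinfun_apply S (\<xi> \<otimes>\<^sub>v ket y) = blinfun_apply T (\<xi> \<otimes>\<^sub>v ket y)"
  shows "S = T"
proof (rule blinfun_eq_on_kets)
  fix c and p :: "'x \<times> 'y"
  have "c *\<^sub>C ket p = (c *\<^sub>C ket (fst p)) \<otimes>\<^sub>v ket (snd p)" by (simp add: tensor_ket)
  then show "blinfun_apply S (c *\<^sub>C ket p) = blinfun_apply T (c *\<^sub>C ket p)"
    using assms by presburger
qed

text \<open>The isometry onto the i-th copy of H in H \<otimes> l^2, viewed as a direct sum; its
  adjoint cuts out the i-th component.\<close>

definition ins :: "'i \<Rightarrow> 'x ell2 \<Rightarrow>\<^sub>L ('x \<times> 'i) ell2"
  where "ins i = Blinfun (\<lambda>\<xi>. \<xi> \<otimes>\<^sub>v ket i)"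

lemma ins_apply [simp]: "blinfun_apply (ins i) \<xi> = \<xi> \<otimes>\<^sub>v ket i"
  unfolding ins_def
  by (simp add: bounded_linear_Blinfun_apply bounded_bilinear.bounded_linear_left[OF bounded_bilinear_tensor_vec])

lemma clinear_ins [simp, intro]: "clinear_op (ins i)"
  by (simp add: clinear_op_def)

lemma norm_ins_le: "norm (ins i) \<le> 1"
  using norm_tensor_vec_le[of _ "ket i"] by (intro norm_blinfun_bound) auto

lemma coord_adj_ins [simp]: "coord (blinfun_apply (adj (ins i)) \<zeta>) x = coord \<zeta> (x, i)"
proof -
  have "coord (blinfun_apply (adj (ins i)) \<zeta>) x = cinner (blinfun_apply (ins i) (ket x)) \<zeta>"
    by (subst cinner_adj_right[symmetric]) auto
  then show ?thesis by (simp add: tensor_ket)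
qed

lemma adj_ins_tensor [simp]: "blinfun_apply (adj (ins i)) (\<xi> \<otimes>\<^sub>v \<eta>) = coord \<eta> i *\<^sub>C \<xi>"
  by (rule ell2_eqI) simp

lemma adj_ins_compose_ins: "adj (ins i) o\<^sub>L ins j = (if i = j then id_blinfun else 0)"
  by (auto intro!: blinfun_eqI ell2_eqI simp: blinfun.zero_left)

lemma blinfun_eq_on_ins:
  fixes S T :: "('x \<times> 'y) ell2 \<Rightarrow>\<^sub>L 'b::real_normed_vector"
  shows "(\<And>i. S o\<^sub>L ins i = T o\<^sub>L ins i) \<Longrightarrow> S = T"
  by (rule blinfun_eq_on_tensors) (metis blinfun_apply_blinfun_compose ins_apply)

lemma blinfun_eq_adj_ins:
  fixes S T :: "'b::real_normed_vector \<Rightarrow>\<^sub>L ('x \<times> 'y) ell2"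
  assumes "\<And>i. adj (ins i) o\<^sub>L S = adj (ins i) o\<^sub>L T"
  shows "S = T"
proof (intro blinfun_eqI ell2_eqI)
  fix b and p :: "'x \<times> 'y"
  have "coord (blinfun_apply (adj (ins (snd p)) o\<^sub>L S) b) (fst p) = coord (blinfun_apply (adj (ins (snd p)) o\<^sub>L T) b) (fst p)"
    using assms by presburger
  then show "coord (blinfun_apply S b) p = coord (blinfun_apply T b) p" by simp
qed

text \<open>This is the slice map id \<otimes> f for the vector functional f(c) = <e_i, c e_j> on
  the second leg, hence the means of reading off elements of A from A \<otimes> C.\<close>

definition entry :: "'i \<Rightarrow> 'i \<Rightarrow> ('x \<times> 'i) op \<Rightarrow> 'x op"
  where "entry i j X = adj (ins i) o\<^sub>L X o\<^sub>L ins j"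

lemma op_eq_entries:
  assumes "\<And>i j. entry i j X = entry i j Y"
  shows "X = Y"
  by (rule blinfun_eq_on_ins, rule blinfun_eq_adj_ins)
    (use assms in \<open>simp add: entry_def compose_assoc\<close>)

lemma clinear_entry [simp, intro]: "clinear_op X \<Longrightarrow> clinear_op (entry i j X)"
  by (simp add: entry_def)

lemma entry_linear:
  "entry i j (X + Y) = entry i j X + entry i j Y" "entry i j 0 = 0"
  "entry i j (scale_op c X) = scale_op c (entry i j X)"
  by (auto intro!: blinfun_eqI simp: entry_def blinfun.add_left blinfun.add_right blinfun.zero_left clinear_opD)

lemma bounded_linear_entry: "bounded_linear (entry i j)"
  unfolding entry_def[abs_def] by (rule bounded_linear_compose_op)

lemma norm_sum_ins:
  assumes "finite I"
  shows "norm (\<Sum>i\<in>I. \<xi> i \<otimes>\<^sub>v ket i) = L2_set (\<lambda>i. norm (\<xi> i)) I"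
proof -
  let ?S = "\<Sum>i\<in>I. \<xi> i \<otimes>\<^sub>v ket i"
  have "cinner ?S ?S = (\<Sum>i\<in>I. cinner (\<xi> i) (blinfun_apply (adj (ins i)) ?S))"
    by (simp add: cinner_sum_left cinner_adj_right)
  also have "\<dots> = (\<Sum>i\<in>I. cinner (\<xi> i) (\<xi> i))"
    using assms by (intro sum.cong refl)
      (simp add: blinfun.sum_right if_distrib[of "\<lambda>c. c *\<^sub>C _"] cong: if_cong)
  also have "\<dots> = of_real ((L2_set (\<lambda>i. norm (\<xi> i)) I)\<^sup>2)"
    by (simp only: cinner_self L2_sq of_real_sum)
  finally have "(norm ?S)\<^sup>2 = (L2_set (\<lambda>i. norm (\<xi> i)) I)\<^sup>2"
    unfolding cinner_self of_real_eq_iff .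
  then show ?thesis by (simp add: power2_eq_iff_nonneg L2_set_nonneg)
qed

text \<open>Bessel's inequality: pairing the truncation \<open>?P\<close> with \<zeta> gives the
  square of \<open>?L\<close>, and Cauchy-Schwarz bounds it by \<open>?L\<close> times the norm of
  \<zeta>.\<close>

lemma L2_adj_ins_le:
  assumes "finite I"
  shows "L2_set (\<lambda>i. norm (blinfun_apply (adj (ins i)) \<zeta>)) I \<le> norm \<zeta>"
proof -
  let ?L = "L2_set (\<lambda>i. norm (blinfun_apply (adj (ins i)) \<zeta>)) I"
  let ?P = "\<Sum>i\<in>I. blinfun_apply (adj (ins i)) \<zeta> \<otimes>\<^sub>v ket i"
  have "cinner ?P \<zeta> = (\<Sum>i\<in>I. cinner (blinfun_apply (adj (ins i)) \<zeta>) (blinfun_apply (adj (ins i)) \<zeta>))"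
    by (simp add: cinner_sum_left cinner_adj_right)
  also have "\<dots> = of_real (?L\<^sup>2)"
    by (simp only: cinner_self L2_sq of_real_sum)
  finally have "?L\<^sup>2 = cmod (cinner ?P \<zeta>)" by (simp add: norm_power)
  also have "\<dots> \<le> ?L * norm \<zeta>"
    using cmod_cinner_le[of ?P \<zeta>] by (simp add: norm_sum_ins[OF assms])
  finally show ?thesis
    by (cases "?L = 0") (auto simp: power2_eq_square L2_set_nonneg less_le)
qed

definition blk :: "'i set \<Rightarrow> ('i \<Rightarrow> 'i \<Rightarrow> 'x op) \<Rightarrow> ('x \<times> 'i) op"
  where "blk I M = (\<Sum>i\<in>I. \<Sum>j\<in>I. ins i o\<^sub>L M i j o\<^sub>L adj (ins j))"

text \<open>A bound for the norm of the matrix as an operator, put as a form estimate. It makes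
  sense for any finite index set without a Hilbert space for each; \<open>norm_blk_le\<close> and
  \<open>mat_bdd_entry\<close> translate it to and from operators.\<close>

definition mat_bdd :: "'i set \<Rightarrow> ('i \<Rightarrow> 'i \<Rightarrow> 'x op) \<Rightarrow> real \<Rightarrow> bool"
  where "mat_bdd I M N \<longleftrightarrow> (\<forall>\<xi> \<eta>. cmod (\<Sum>i\<in>I. \<Sum>j\<in>I. cinner (\<xi> i) (blinfun_apply (M i j) (\<eta> j)))
     \<le> N * L2_set (\<lambda>i. norm (\<xi> i)) I * L2_set (\<lambda>i. norm (\<eta> i)) I)"

lemma cinner_blk:
  "cinner \<zeta> (blinfun_apply (blk I M) \<zeta>')
   = (\<Sum>i\<in>I. \<Sum>j\<in>I. cinner (blinfun_apply (adj (ins i)) \<zeta>) (blinfun_apply (M i j) (blinfun_apply (adj (ins j)) \<zeta>')))"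
  unfolding blk_def by (simp add: blinfun.sum_left cinner_sum_right cinner_adj del: ins_apply)

lemma norm_blk_le:
  assumes "mat_bdd I M N" "0 \<le> N" "finite I"
  shows "norm (blk I M) \<le> N"
proof (rule norm_le_form[OF _ assms(2)])
  fix \<zeta> \<zeta>'
  have "cmod (cinner \<zeta> (blinfun_apply (blk I M) \<zeta>'))
     \<le> N * L2_set (\<lambda>i. norm (blinfun_apply (adj (ins i)) \<zeta>)) I * L2_set (\<lambda>i. norm (blinfun_apply (adj (ins i)) \<zeta>')) I"
    unfolding cinner_blk using assms(1) by (simp add: mat_bdd_def)
  also have "\<dots> \<le> N * norm \<zeta> * norm \<zeta>'"
    using assms by (intro mult_mono L2_adj_ins_le mult_nonneg_nonneg L2_set_nonneg) auto
  finally show "cmod (cinner \<zeta> (blinfun_apply (blk I M) \<zeta>')) \<le> N * norm \<zeta> * norm \<zeta>'" .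
qed

lemma mat_bdd_entry:
  assumes "finite I"
  shows "mat_bdd I (\<lambda>i j. entry i j X) (norm X)"
  unfolding mat_bdd_def
proof (intro allI)
  fix \<xi> \<eta>
  have "(\<Sum>i\<in>I. \<Sum>j\<in>I. cinner (\<xi> i) (blinfun_apply (entry i j X) (\<eta> j)))
      = cinner (\<Sum>i\<in>I. \<xi> i \<otimes>\<^sub>v ket i) (blinfun_apply X (\<Sum>i\<in>I. \<eta> i \<otimes>\<^sub>v ket i))"
    by (simp add: entry_def cinner_adj_right cinner_sum_left cinner_sum_right blinfun.sum_right) (rule sum.swap)
  then show "cmod (\<Sum>i\<in>I. \<Sum>j\<in>I. cinner (\<xi> i) (blinfun_apply (entry i j X) (\<eta> j)))
      \<le> norm X * L2_set (\<lambda>i. norm (\<xi> i)) I * L2_set (\<lambda>i. norm (\<eta> i)) I"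
    using form_le_norm[of "\<Sum>i\<in>I. \<xi> i \<otimes>\<^sub>v ket i" X "\<Sum>i\<in>I. \<eta> i \<otimes>\<^sub>v ket i"] by (simp add: norm_sum_ins assms)
qed

lemma clinear_blk: "(\<And>i j. i \<in> I \<Longrightarrow> j \<in> I \<Longrightarrow> clinear_op (M i j)) \<Longrightarrow> clinear_op (blk I M)"
  unfolding blk_def by auto

lemma blk_cong: "(\<And>i j. i \<in> I \<Longrightarrow> j \<in> I \<Longrightarrow> M i j = M' i j) \<Longrightarrow> blk I M = blk I M'"
  unfolding blk_def by (intro sum.cong) auto

lemma entry_ins: "entry i j (ins k o\<^sub>L x o\<^sub>L adj (ins l)) = (if i = k \<and> j = l then x else 0)"
proof -
  have "entry i j (ins k o\<^sub>L x o\<^sub>L adj (ins l)) = (adj (ins i) o\<^sub>L ins k) o\<^sub>L x o\<^sub>L (adj (ins l) o\<^sub>L ins j)"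
    by (simp add: entry_def compose_assoc)
  then show ?thesis by (simp add: adj_ins_compose_ins compose_distribs)
qed

lemma entry_blk:
  assumes "finite I"
  shows "entry i j (blk I M) = (if i \<in> I \<and> j \<in> I then M i j else 0)"
proof -
  have "entry i j (blk I M) = (\<Sum>k\<in>I. \<Sum>l\<in>I. if i = k \<and> j = l then M k l else 0)"
    unfolding blk_def bounded_linear.linear[OF bounded_linear_entry, THEN linear_sum] entry_ins ..
  also have "\<dots> = (\<Sum>k\<in>I. if i = k then (\<Sum>l\<in>I. if j = l then M k l else 0) else 0)"
    by (intro sum.cong) auto
  finally show ?thesis using assms by auto
qed

lemma blk_mult:
  assumes "finite I"
  shows "blk I M o\<^sub>L blk I M' = blk I (\<lambda>i j. \<Sum>k\<in>I. M i k o\<^sub>L M' k j)"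
proof -
  have *: "(ins i o\<^sub>L M i k o\<^sub>L adj (ins k)) o\<^sub>L (ins l o\<^sub>L M' l j o\<^sub>L adj (ins j))
     = (if l = k then ins i o\<^sub>L (M i k o\<^sub>L M' k j) o\<^sub>L adj (ins j) else 0)" for i j k l
  proof -
    have "(ins i o\<^sub>L M i k o\<^sub>L adj (ins k)) o\<^sub>L (ins l o\<^sub>L M' l j o\<^sub>L adj (ins j))
      = ins i o\<^sub>L M i k o\<^sub>L (adj (ins k) o\<^sub>L ins l) o\<^sub>L M' l j o\<^sub>L adj (ins j)"
      by (simp add: compose_assoc)
    then show ?thesis by (simp add: adj_ins_compose_ins compose_assoc compose_distribs)
  qed
  have "blk I M o\<^sub>L blk I M' = (\<Sum>i\<in>I. \<Sum>k\<in>I. \<Sum>l\<in>I. \<Sum>j\<in>I.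
      (ins i o\<^sub>L M i k o\<^sub>L adj (ins k)) o\<^sub>L (ins l o\<^sub>L M' l j o\<^sub>L adj (ins j)))"
    unfolding blk_def compose_sum(1) unfolding compose_sum(2) ..
  also have "\<dots> = (\<Sum>i\<in>I. \<Sum>k\<in>I. \<Sum>j\<in>I. \<Sum>l\<in>I.
      (ins i o\<^sub>L M i k o\<^sub>L adj (ins k)) o\<^sub>L (ins l o\<^sub>L M' l j o\<^sub>L adj (ins j)))"
    by (intro sum.cong refl sum.swap)
  also have "\<dots> = (\<Sum>i\<in>I. \<Sum>k\<in>I. \<Sum>j\<in>I. ins i o\<^sub>L (M i k o\<^sub>L M' k j) o\<^sub>L adj (ins j))"
    unfolding * using assms by simp
  also have "\<dots> = (\<Sum>i\<in>I. \<Sum>j\<in>I. \<Sum>k\<in>I. ins i o\<^sub>L (M i k o\<^sub>L M' k j) o\<^sub>L adj (ins j))"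
    by (intro sum.cong refl sum.swap)
  finally show ?thesis by (simp add: blk_def compose_sum)
qed

lemma adj_blk:
  assumes "\<And>i j. i \<in> I \<Longrightarrow> j \<in> I \<Longrightarrow> clinear_op (M i j)"
  shows "adj (blk I M) = blk I (\<lambda>i j. adj (M j i))"
proof -
  have "adj (blk I M) = (\<Sum>i\<in>I. \<Sum>j\<in>I. ins j o\<^sub>L adj (M i j) o\<^sub>L adj (ins i))"
    unfolding blk_def using assms by (simp add: adj_sum adj_compose compose_assoc)
  also have "\<dots> = blk I (\<lambda>i j. adj (M j i))"
    unfolding blk_def by (rule sum.swap)
  finally show ?thesis .
qed

lemma blk_add: "blk I M + blk I M' = blk I (\<lambda>i j. M i j + M' i j)"
  unfolding blk_def by (simp add: compose_distribs sum.distrib)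

lemma scale_blk: "scale_op c (blk I M) = blk I (\<lambda>i j. scale_op c (M i j))"
  unfolding blk_def scale_op_sum by (intro sum.cong refl blinfun_eqI) simp

text \<open>Two finite sets of basis pairs involve only finitely many second coordinates, so each
  finite section of the scalar matrix sits in one block operator, of norm at most \<open>N\<close>.
  Uniformity over finite blocks thus gives the infinite matrix.\<close>

lemma blk_op_exists:
  fixes M :: "'i \<Rightarrow> 'i \<Rightarrow> 'x op"
  assumes M: "\<And>i j. clinear_op (M i j)" and bd: "\<And>I. finite I \<Longrightarrow> mat_bdd I M N" and N: "0 \<le> N"
  obtains R where "clinear_op R" "norm R \<le> N" "\<And>i j. entry i j R = M i j"
proof -
  define r where "r a b = coord (blinfun_apply (M (snd a) (snd b)) (ket (fst b))) (fst a)" for a b :: "'x \<times> 'i"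
  obtain R where R: "clinear_op R" "norm R \<le> N" "\<And>a b. coord (blinfun_apply R (ket b)) a = r a b"
  proof (rule matrix_op[of r N])
    fix F G :: "('x \<times> 'i) set" and u v :: "'x \<times> 'i \<Rightarrow> complex" assume fin: "finite F" "finite G"
    define I where "I = snd ` F \<union> snd ` G"
    have I: "finite I" using fin by (simp add: I_def)
    have c: "clinear_op (blk I M)" by (simp add: clinear_blk M)
    have entry_r: "coord (blinfun_apply (blk I M) (ket b)) a = r a b" if ab: "a \<in> F" "b \<in> G" for a b
    proof -
      have "coord (blinfun_apply (blk I M) (ket b)) a = coord (blinfun_apply (entry (snd a) (snd b) (blk I M)) (ket (fst b))) (fst a)"
        by (simp add: entry_def tensor_ket)
      moreover have "snd a \<in> I" "snd b \<in> I" using ab by (auto simp: I_def)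
      ultimately show ?thesis by (simp add: entry_blk[OF I] r_def)
    qed
    have "cinner (\<Sum>a\<in>F. u a *\<^sub>C ket a) (blinfun_apply (blk I M) (\<Sum>b\<in>G. v b *\<^sub>C ket b))
        = (\<Sum>a\<in>F. \<Sum>b\<in>G. cnj (u a) * r a b * v b)"
      by (simp add: clinear_op_sum_ket[OF c] cinner_sum_left cinner_sum_right entry_r sum_distrib_left mult_ac)
        (rule sum.swap)
    moreover have "cmod (cinner (\<Sum>a\<in>F. u a *\<^sub>C ket a) (blinfun_apply (blk I M) (\<Sum>b\<in>G. v b *\<^sub>C ket b)))
        \<le> N * norm (\<Sum>a\<in>F. u a *\<^sub>C ket a) * norm (\<Sum>b\<in>G. v b *\<^sub>C ket b)"
      using norm_blk_le[OF bd[OF I] N I] by (intro order_trans[OF form_le_norm] mult_right_mono) auto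
    ultimately show "cmod (\<Sum>a\<in>F. \<Sum>b\<in>G. cnj (u a) * r a b * v b)
        \<le> N * L2_set (\<lambda>a. cmod (u a)) F * L2_set (\<lambda>b. cmod (v b)) G"
      using fin by (simp add: norm_sum_ket)
  qed (use N in auto)
  have "entry i j R = M i j" for i j
  proof (rule clinear_op_eqI)
    fix y
    show "blinfun_apply (entry i j R) (ket y) = blinfun_apply (M i j) (ket y)"
      by (rule ell2_eqI) (simp add: entry_def tensor_ket R r_def)
  qed (auto simp: R M)
  with R that show ?thesis by blast
qed

section \<open>Tensor products of operators\<close>

lemma tensor_op_eqI:
  assumes "\<And>\<xi> \<eta>. blinfun_apply R (\<xi> \<otimes>\<^sub>v \<eta>) = blinfun_apply S \<xi> \<otimes>\<^sub>v blinfun_apply T \<eta>"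
  shows "S \<otimes>\<^sub>o T = R"
  unfolding tensor_op_def by (rule the_equality) (use assms in \<open>auto intro: blinfun_eq_on_tensors\<close>)

text \<open>The form reduces to a single sum over the diagonal, which Cauchy-Schwarz bounds by
  \<open>K\<close>. Constant families give S \<otimes> 1; the translates of an element of A give its
  image in the crossed product.\<close>

lemma diag_op_exists:
  fixes S :: "'i \<Rightarrow> 'x op"
  assumes S: "\<And>i. clinear_op (S i)" "\<And>i. norm (S i) \<le> K"
  obtains R where "clinear_op R" "norm R \<le> K" "\<And>\<xi> i. blinfun_apply R (\<xi> \<otimes>\<^sub>v ket i) = blinfun_apply (S i) \<xi> \<otimes>\<^sub>v ket i"
proof -
  have K: "0 \<le> K" using S(2) norm_ge_zero order_trans by blast
  define M where "M i j = (if i = j then S i else 0)" for i j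
  obtain R where R: "clinear_op R" "norm R \<le> K" "\<And>i j. entry i j R = M i j"
  proof (rule blk_op_exists[of M K])
    fix I :: "'i set" assume I: "finite I"
    show "mat_bdd I M K"
      unfolding mat_bdd_def
    proof (intro allI)
      fix \<xi> \<eta> :: "'i \<Rightarrow> 'x ell2"
      have "(\<Sum>j\<in>I. cinner (\<xi> i) (blinfun_apply (M i j) (\<eta> j))) = cinner (\<xi> i) (blinfun_apply (S i) (\<eta> i))"
        if "i \<in> I" for i
      proof -
        have "(\<Sum>j\<in>I. cinner (\<xi> i) (blinfun_apply (M i j) (\<eta> j)))
            = (\<Sum>j\<in>I. if i = j then cinner (\<xi> i) (blinfun_apply (S i) (\<eta> j)) else 0)"
          by (intro sum.cong) (auto simp: M_def blinfun.zero_left)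
        then show ?thesis using that I by simp
      qed
      then have "cmod (\<Sum>i\<in>I. \<Sum>j\<in>I. cinner (\<xi> i) (blinfun_apply (M i j) (\<eta> j)))
          = cmod (\<Sum>i\<in>I. cinner (\<xi> i) (blinfun_apply (S i) (\<eta> i)))"
        by simp
      also have "\<dots> \<le> (\<Sum>i\<in>I. K * (norm (\<xi> i) * norm (\<eta> i)))"
      proof (intro order_trans[OF norm_sum] sum_mono order_trans[OF form_le_norm])
        show "norm (S i) * norm (\<xi> i) * norm (\<eta> i) \<le> K * (norm (\<xi> i) * norm (\<eta> i))" for i
          using S(2)[of i] by (simp add: mult.assoc mult_right_mono)
      qed
      also have "\<dots> = K * (\<Sum>i\<in>I. \<bar>norm (\<xi> i)\<bar> * \<bar>norm (\<eta> i)\<bar>)"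
        by (simp add: sum_distrib_left)
      also have "\<dots> \<le> K * (L2_set (\<lambda>i. norm (\<xi> i)) I * L2_set (\<lambda>i. norm (\<eta> i)) I)"
        using K by (intro mult_left_mono L2_set_mult_ineq)
      finally show "cmod (\<Sum>i\<in>I. \<Sum>j\<in>I. cinner (\<xi> i) (blinfun_apply (M i j) (\<eta> j)))
          \<le> K * L2_set (\<lambda>i. norm (\<xi> i)) I * L2_set (\<lambda>i. norm (\<eta> i)) I"
        by (simp add: mult.assoc)
    qed
  qed (auto simp: M_def S K)
  have "blinfun_apply R (\<xi> \<otimes>\<^sub>v ket j) = blinfun_apply (S j) \<xi> \<otimes>\<^sub>v ket j" for \<xi> j
  proof (rule ell2_eqI)
    fix p :: "'x \<times> 'i"
    have "coord (blinfun_apply R (\<xi> \<otimes>\<^sub>v ket j)) p = coord (blinfun_apply (entry (snd p) j R) \<xi>) (fst p)"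
      by (simp add: entry_def)
    also have "\<dots> = coord (blinfun_apply (S j) \<xi> \<otimes>\<^sub>v ket j) p"
      unfolding R by (simp add: M_def blinfun.zero_left)
    finally show "coord (blinfun_apply R (\<xi> \<otimes>\<^sub>v ket j)) p = coord (blinfun_apply (S j) \<xi> \<otimes>\<^sub>v ket j) p" .
  qed
  with R that show ?thesis by blast
qed

lemma amplification_exists:
  fixes S :: "'x op"
  assumes S: "clinear_op S"
  obtains R :: "('x \<times> 'i) op"
  where "clinear_op R" "norm R \<le> norm S" "\<And>\<xi> \<eta>. blinfun_apply R (\<xi> \<otimes>\<^sub>v \<eta>) = blinfun_apply S \<xi> \<otimes>\<^sub>v \<eta>"
proof -
  obtain R :: "('x \<times> 'i) op" where R: "clinear_op R" "norm R \<le> norm S"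
    "\<And>\<xi> i. blinfun_apply R (\<xi> \<otimes>\<^sub>v ket i) = blinfun_apply S \<xi> \<otimes>\<^sub>v ket i"
    using diag_op_exists[of "\<lambda>_. S" "norm S"] S by auto
  have "blinfun_apply R (\<xi> \<otimes>\<^sub>v \<eta>) = blinfun_apply S \<xi> \<otimes>\<^sub>v \<eta>" for \<xi> \<eta>
  proof -
    have "(\<lambda>\<eta>. blinfun_apply R (\<xi> \<otimes>\<^sub>v \<eta>)) = (\<lambda>\<eta>. blinfun_apply S \<xi> \<otimes>\<^sub>v \<eta>)"
      by (rule bounded_linear_eq_on_kets[OF bounded_linear_compose[OF blinfun.bounded_linear_right
              bounded_bilinear.bounded_linear_right[OF bounded_bilinear_tensor_vec]]
            bounded_bilinear.bounded_linear_right[OF bounded_bilinear_tensor_vec]])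
        (simp add: clinear_opD[OF R(1)] R(3))
    then show ?thesis by metis
  qed
  with R that show ?thesis by blast
qed

lemma sum_reindex_le:
  assumes "inj g" "finite F"
  shows "(\<Sum>p\<in>F. (cmod (coord \<zeta> (g p)))\<^sup>2) \<le> (norm \<zeta>)\<^sup>2"
proof -
  have "(\<Sum>p\<in>F. (cmod (coord \<zeta> (g p)))\<^sup>2) = (\<Sum>p\<in>g ` F. (cmod (coord \<zeta> p))\<^sup>2)"
    using assms by (subst sum.reindex) (auto simp: inj_on_def)
  then show ?thesis using sum_coord_le_norm[of "g ` F" \<zeta>] assms by simp
qed

text \<open>Coordinates are pulled back along \<open>g\<close>, so basis vectors move the opposite
  way: for injective \<open>g\<close>, \<open>ket (g p)\<close> goes to
  \<open>ket p\<close>.\<close>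

definition reindex_op :: "('y \<Rightarrow> 'x) \<Rightarrow> 'x ell2 \<Rightarrow>\<^sub>L 'y ell2"
  where "reindex_op g = Blinfun (\<lambda>\<zeta>. Abs_ell2 (\<lambda>p. coord \<zeta> (g p)))"

lemma
  assumes "inj g"
  shows coord_reindex_op: "coord (blinfun_apply (reindex_op g) \<zeta>) p = coord \<zeta> (g p)"
    and norm_reindex_op_le: "norm (reindex_op g) \<le> 1"
proof -
  define h where "h \<zeta> = Abs_ell2 (\<lambda>p. coord \<zeta> (g p))" for \<zeta>
  have c: "coord (h \<zeta>) p = coord \<zeta> (g p)" for \<zeta> p
    unfolding h_def by (subst coord_Abs[OF sum_reindex_le[OF assms]]) auto
  have n: "norm (h \<zeta>) \<le> norm \<zeta>" for \<zeta>
    by (rule norm_ell2_le) (simp_all add: c sum_reindex_le[OF assms])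
  have bl: "bounded_linear h"
    by (rule bounded_linear_intro[where K = 1]) (auto intro: ell2_eqI simp: c n)
  have s: "blinfun_apply (reindex_op g) \<zeta> = h \<zeta>" for \<zeta>
    using bounded_linear_Blinfun_apply[OF bl] by (simp add: reindex_op_def h_def[abs_def])
  show "coord (blinfun_apply (reindex_op g) \<zeta>) p = coord \<zeta> (g p)"
    by (simp only: s c)
  show "norm (reindex_op g) \<le> 1"
    by (rule norm_blinfun_bound) (simp_all add: s n)
qed

lemma clinear_reindex_op: "inj g \<Longrightarrow> clinear_op (reindex_op g)"
  by (auto simp: clinear_op_def coord_reindex_op intro: ell2_eqI)

definition swap_op :: "('x \<times> 'y) ell2 \<Rightarrow>\<^sub>L ('y \<times> 'x) ell2"
  where "swap_op = reindex_op prod.swap"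

lemma coord_swap_op [simp]: "coord (blinfun_apply swap_op \<zeta>) p = coord \<zeta> (prod.swap p)"
  by (simp add: swap_op_def coord_reindex_op)

lemma norm_swap_op_le: "norm swap_op \<le> 1"
  by (simp add: swap_op_def norm_reindex_op_le)

lemma clinear_swap_op [simp, intro]: "clinear_op swap_op"
  by (simp add: swap_op_def clinear_reindex_op)

lemma swap_op_tensor [simp]: "blinfun_apply swap_op (\<xi> \<otimes>\<^sub>v \<eta>) = \<eta> \<otimes>\<^sub>v \<xi>"
  by (rule ell2_eqI) simp

text \<open>S \<otimes> T is the product of S \<otimes> 1 and 1 \<otimes> T, and 1 \<otimes> T is T
  \<otimes> 1 conjugated by the exchange of the two legs.\<close>

lemma tensor_op_exists:
  fixes S :: "'x op" and T :: "'y op"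
  assumes S: "clinear_op S" and T: "clinear_op T"
  obtains R where "clinear_op R" "norm R \<le> norm S * norm T"
    "\<And>\<xi> \<eta>. blinfun_apply R (\<xi> \<otimes>\<^sub>v \<eta>) = blinfun_apply S \<xi> \<otimes>\<^sub>v blinfun_apply T \<eta>"
proof -
  obtain S' :: "('x \<times> 'y) op" where S': "clinear_op S'" "norm S' \<le> norm S"
    "\<And>\<xi> \<eta>. blinfun_apply S' (\<xi> \<otimes>\<^sub>v \<eta>) = blinfun_apply S \<xi> \<otimes>\<^sub>v \<eta>"
    using amplification_exists[OF S] by blast
  obtain T' :: "('y \<times> 'x) op" where T': "clinear_op T'" "norm T' \<le> norm T"
    "\<And>\<xi> \<eta>. blinfun_apply T' (\<xi> \<otimes>\<^sub>v \<eta>) = blinfun_apply T \<xi> \<otimes>\<^sub>v \<eta>"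
    using amplification_exists[OF T] by blast
  have "norm (swap_op o\<^sub>L T' o\<^sub>L (swap_op :: ('x \<times> 'y) ell2 \<Rightarrow>\<^sub>L _)) \<le> 1 * norm T * 1"
    by (rule order_trans[OF norm_compose3_le]) (intro mult_mono norm_swap_op_le T' mult_nonneg_nonneg norm_ge_zero, simp_all)
  then have "norm (S' o\<^sub>L (swap_op o\<^sub>L T' o\<^sub>L swap_op)) \<le> norm S * norm T"
    by (intro order_trans[OF norm_compose_le[of S']] mult_mono S') simp_all
  then show ?thesis
    by (intro that[of "S' o\<^sub>L (swap_op o\<^sub>L T' o\<^sub>L swap_op)"]) (auto simp: S' T')
qed

lemma
  assumes "clinear_op S" "clinear_op T"
  shows tensor_op_apply [simp]:
      "blinfun_apply (S \<otimes>\<^sub>o T) (\<xi> \<otimes>\<^sub>v \<eta>) = blinfun_apply S \<xi> \<otimes>\<^sub>v blinfun_apply T \<eta>"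
    and clinear_tensor_op [simp, intro]: "clinear_op (S \<otimes>\<^sub>o T)"
    and norm_tensor_op_le: "norm (S \<otimes>\<^sub>o T) \<le> norm S * norm T"
  using tensor_op_exists[OF assms] tensor_op_eqI by metis+

lemmas tensor_vec_bilinear_simps =
  bounded_bilinear.add_left[OF bounded_bilinear_tensor_vec]
  bounded_bilinear.add_right[OF bounded_bilinear_tensor_vec]
  bounded_bilinear.diff_left[OF bounded_bilinear_tensor_vec]
  bounded_bilinear.diff_right[OF bounded_bilinear_tensor_vec]
  bounded_bilinear.zero_left[OF bounded_bilinear_tensor_vec]
  bounded_bilinear.zero_right[OF bounded_bilinear_tensor_vec]

lemma tensor_op_add_left: "clinear_op S \<Longrightarrow> clinear_op S' \<Longrightarrow> clinear_op T \<Longrightarrow> (S + S') \<otimes>\<^sub>o T = S \<otimes>\<^sub>o T + S' \<otimes>\<^sub>o T"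
  by (rule tensor_op_eqI) (simp add: blinfun.add_left tensor_vec_bilinear_simps)

lemma tensor_op_diff_left: "clinear_op S \<Longrightarrow> clinear_op S' \<Longrightarrow> clinear_op T \<Longrightarrow> (S - S') \<otimes>\<^sub>o T = S \<otimes>\<^sub>o T - S' \<otimes>\<^sub>o T"
  by (rule tensor_op_eqI) (simp add: blinfun.diff_left tensor_vec_bilinear_simps)

lemma tensor_op_zero [simp]: "0 \<otimes>\<^sub>o T = 0" "S \<otimes>\<^sub>o 0 = 0"
  by (auto intro!: tensor_op_eqI simp: blinfun.zero_left tensor_vec_bilinear_simps)

lemma entry_tensor_op:
  "clinear_op S \<Longrightarrow> clinear_op T \<Longrightarrow> entry i j (S \<otimes>\<^sub>o T) = scale_op (coord (blinfun_apply T (ket j)) i) S"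
  by (rule blinfun_eqI) (simp add: entry_def)

definition flip :: "('x \<times> 'y) op \<Rightarrow> ('y \<times> 'x) op"
  where "flip X = swap_op o\<^sub>L X o\<^sub>L swap_op"

lemma flip_tensor [simp]: "clinear_op S \<Longrightarrow> clinear_op T \<Longrightarrow> flip (S \<otimes>\<^sub>o T) = T \<otimes>\<^sub>o S"
  by (rule sym, rule tensor_op_eqI) (simp add: flip_def)

lemma norm_flip_le: "norm (flip X) \<le> norm X"
proof -
  have "norm (flip X) \<le> 1 * norm X * 1"
    unfolding flip_def by (rule order_trans[OF norm_compose3_le]) (intro mult_mono norm_swap_op_le, auto)
  then show ?thesis by simp
qed

lemma bounded_linear_flip: "bounded_linear flip"
  unfolding flip_def[abs_def] by (rule bounded_linear_compose_op)

lemma flip_linear: "flip (X + Y) = flip X + flip Y" "flip (scale_op c X) = scale_op c (flip X)"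
  by (auto intro!: blinfun_eqI simp: flip_def blinfun.add_left blinfun.add_right clinear_opD)

section \<open>Complex subspaces and closed spans\<close>

lemma csubspaceD:
  assumes "csubspace V"
  shows csubspace_bop: "x \<in> V \<Longrightarrow> clinear_op x"
    and csubspace_0: "0 \<in> V"
    and csubspace_add: "x \<in> V \<Longrightarrow> y \<in> V \<Longrightarrow> x + y \<in> V"
    and csubspace_scale: "x \<in> V \<Longrightarrow> scale_op c x \<in> V"
  using assms by (auto simp: csubspace_def)

lemma csubspaceI:
  assumes "\<And>x. x \<in> V \<Longrightarrow> clinear_op x" "0 \<in> V" "\<And>x y. x \<in> V \<Longrightarrow> y \<in> V \<Longrightarrow> x + y \<in> V"
    "\<And>c x. x \<in> V \<Longrightarrow> scale_op c x \<in> V"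
  shows "csubspace V"
  using assms by (auto simp: csubspace_def)

lemma csubspace_diff: "csubspace V \<Longrightarrow> x \<in> V \<Longrightarrow> y \<in> V \<Longrightarrow> x - y \<in> V"
  using csubspace_add[of V x "scale_op (-1) y"] csubspace_scale[of V y "-1"] by simp

lemma csubspace_sum: "csubspace V \<Longrightarrow> (\<And>i. i \<in> I \<Longrightarrow> f i \<in> V) \<Longrightarrow> (\<Sum>i\<in>I. f i) \<in> V"
  by (induction I rule: infinite_finite_induct) (auto simp: csubspace_0 csubspace_add)

lemma csubspace_bop_univ [simp]: "csubspace bop"
  by (rule csubspaceI) auto

lemma csubspace_zero [simp]: "csubspace {0}"
  by (rule csubspaceI) auto

lemma csubspace_closure:
  assumes V: "csubspace V"
  shows "csubspace (closure V)"
proof (rule csubspaceI)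
  have "closure V \<subseteq> bop"
    using V closed_bop by (intro closure_minimal) (auto simp: csubspace_def)
  then show "clinear_op x" if "x \<in> closure V" for x using that by auto
  show "0 \<in> closure V" using csubspace_0[OF V] closure_subset by blast
  fix x assume "x \<in> closure V"
  then obtain f where f: "\<And>n. f n \<in> V" "f \<longlonglongrightarrow> x" by (auto simp: closure_sequential)
  show "scale_op c x \<in> closure V" for c
    unfolding closure_sequential
    by (intro exI[of _ "\<lambda>n. scale_op c (f n)"] conjI allI csubspace_scale V f
        bounded_linear.tendsto[OF bounded_linear_scale_op])
  fix y assume "y \<in> closure V"
  then obtain g where g: "\<And>n. g n \<in> V" "g \<longlonglongrightarrow> y" by (auto simp: closure_sequential)
  show "x + y \<in> closure V"
    unfolding closure_sequential
    by (intro exI[of _ "\<lambda>n. f n + g n"] conjI allI csubspace_add V f g tendsto_add)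
qed

lemma cspan_minimal: "csubspace W \<Longrightarrow> G \<subseteq> W \<Longrightarrow> cspan G \<subseteq> W"
  by (simp add: cspan_def hull_minimal)

lemma csubspace_cspan: "G \<subseteq> bop \<Longrightarrow> csubspace (cspan G)"
proof (rule csubspaceI)
  assume G: "G \<subseteq> bop"
  show "clinear_op x" if "x \<in> cspan G" for x
    using that cspan_minimal[OF csubspace_bop_univ G] by auto
qed (auto simp: cspan_def hull_def csubspace_0 csubspace_add csubspace_scale)

lemma cspan_superset: "G \<subseteq> cspan G"
  by (simp add: cspan_def hull_subset)

lemma closed_cspan_superset: "x \<in> G \<Longrightarrow> x \<in> closure (cspan G)"
  using cspan_superset closure_subset by blast

lemma csubspace_closed_cspan: "G \<subseteq> bop \<Longrightarrow> csubspace (closure (cspan G))"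
  by (intro csubspace_closure csubspace_cspan)

text \<open>The preimage of \<open>W\<close> is a closed subspace containing the generators. Most
  statements about closed spans and minimal tensor products are reduced to generators by this
  principle.\<close>

lemma closed_cspan_map:
  assumes "G \<subseteq> bop" "clinear_on (closure (cspan G)) f" "continuous_on (closure (cspan G)) f"
    and W: "csubspace W" "closed W" and fW: "\<And>x. x \<in> G \<Longrightarrow> f x \<in> W"
    and x: "x \<in> closure (cspan G)"
  shows "f x \<in> W"
proof -
  let ?X = "closure (cspan G)"
  let ?W = "?X \<inter> f -` W"
  have X: "csubspace ?X" using assms(1) by (rule csubspace_closed_cspan)
  have f0: "f 0 = 0"
    using assms(2) csubspace_0[OF X] unfolding clinear_on_def by (metis scale_op_simps(2))
  have "csubspace ?W"
    using assms(2) by (intro csubspaceI)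
      (auto simp: clinear_on_def f0 csubspaceD[OF X] csubspaceD[OF W(1)] intro: csubspace_bop[OF X])
  moreover have "closed ?W"
    by (intro continuous_closed_preimage assms) simp
  moreover have "G \<subseteq> ?W"
    using fW closed_cspan_superset by blast
  ultimately have "?X \<subseteq> ?W"
    by (intro closure_minimal cspan_minimal)
  then show ?thesis using x by blast
qed

lemma clinear_on_diff_fun:
  assumes "clinear_on V f" "clinear_on V g"
  shows "clinear_on V (\<lambda>x. f x - g x)"
  using assms by (auto simp: clinear_on_def scale_op_distribs)

lemma closed_cspan_eq:
  assumes "G \<subseteq> bop" "clinear_on (closure (cspan G)) f" "continuous_on (closure (cspan G)) f"
    "clinear_on (closure (cspan G)) g" "continuous_on (closure (cspan G)) g"
    and "\<And>x. x \<in> G \<Longrightarrow> f x = g x" and "x \<in> closure (cspan G)"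
  shows "f x = g x"
proof -
  have "f x - g x \<in> {0}"
    by (rule closed_cspan_map[OF assms(1) clinear_on_diff_fun continuous_on_diff])
      (use assms in auto)
  then show ?thesis by simp
qed

lemma clinear_on_subset: "clinear_on V f \<Longrightarrow> U \<subseteq> V \<Longrightarrow> clinear_on U f"
  unfolding clinear_on_def by blast

lemma clinear_on_compose:
  "clinear_on V f \<Longrightarrow> clinear_on W g \<Longrightarrow> f ` V \<subseteq> W \<Longrightarrow> clinear_on V (\<lambda>x. g (f x))"
  unfolding clinear_on_def by (simp add: image_subset_iff)

lemma clinear_on_zero:
  "csubspace V \<Longrightarrow> clinear_on V f \<Longrightarrow> f 0 = 0"
  unfolding clinear_on_def using csubspace_0 by (metis scale_op_simps(2))

lemma clinear_on_diff:
  assumes "csubspace V" "clinear_on V f" "x \<in> V" "y \<in> V"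
  shows "f (x - y) = f x - f y"
proof -
  have "f (x + scale_op (-1) y) = f x + scale_op (-1) (f y)"
    using assms csubspace_scale unfolding clinear_on_def by metis
  then show ?thesis by simp
qed

lemma clinear_on_sum:
  assumes "csubspace V" "clinear_on V f" "\<And>i. i \<in> I \<Longrightarrow> x i \<in> V"
  shows "f (\<Sum>i\<in>I. x i) = (\<Sum>i\<in>I. f (x i))"
  using assms(3)
proof (induction I rule: infinite_finite_induct)
  case (insert i I)
  then have "f (x i + (\<Sum>i\<in>I. x i)) = f (x i) + f (\<Sum>i\<in>I. x i)"
    using assms csubspace_sum[OF assms(1)] unfolding clinear_on_def by (metis insertCI)
  then show ?case using insert by simp
qed (use assms clinear_on_zero in auto)

lemma clinear_on_bounded_continuous:
  assumes V: "csubspace V" and f: "clinear_on V f" and K: "\<And>x. x \<in> V \<Longrightarrow> norm (f x) \<le> K * norm x"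
  shows "continuous_on V f"
proof -
  have "(max K 0)-lipschitz_on V f"
  proof (rule lipschitz_onI)
    fix x y assume xy: "x \<in> V" "y \<in> V"
    have "dist (f x) (f y) = norm (f (x - y))"
      by (simp add: dist_norm clinear_on_diff[OF V f xy])
    also have "\<dots> \<le> max K 0 * norm (x - y)"
      by (rule order_trans[OF K[OF csubspace_diff[OF V xy]]]) (simp add: mult_right_mono)
    finally show "dist (f x) (f y) \<le> max K 0 * dist x y" by (simp add: dist_norm)
  qed simp
  then show ?thesis by (rule lipschitz_on_continuous_on)
qed

section \<open>Minimal tensor products and extension from simple tensors\<close>

abbreviation simple_tensors :: "'x op set \<Rightarrow> 'y op set \<Rightarrow> ('x \<times> 'y) op set"
  where "simple_tensors V C \<equiv> {v \<otimes>\<^sub>o c | v c. v \<in> V \<and> c \<in> C}"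

lemma simple_tensors_bop: "V \<subseteq> bop \<Longrightarrow> C \<subseteq> bop \<Longrightarrow> simple_tensors V C \<subseteq> bop"
  by (auto simp: subset_iff)

lemma csubspace_min_tensor: "V \<subseteq> bop \<Longrightarrow> C \<subseteq> bop \<Longrightarrow> csubspace (V \<otimes>\<^sub>m C)"
  unfolding min_tensor_def by (intro csubspace_closed_cspan simple_tensors_bop)

lemma closed_min_tensor: "closed (V \<otimes>\<^sub>m C)"
  by (simp add: min_tensor_def)

lemma min_tensor_simple: "v \<in> V \<Longrightarrow> c \<in> C \<Longrightarrow> v \<otimes>\<^sub>o c \<in> V \<otimes>\<^sub>m C"
  unfolding min_tensor_def by (rule closed_cspan_superset) auto

lemma min_tensor_map:
  assumes "V \<subseteq> bop" "C \<subseteq> bop" "clinear_on (V \<otimes>\<^sub>m C) f" "continuous_on (V \<otimes>\<^sub>m C) f"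
    and "csubspace W" "closed W" "\<And>v c. v \<in> V \<Longrightarrow> c \<in> C \<Longrightarrow> f (v \<otimes>\<^sub>o c) \<in> W"
    and "x \<in> V \<otimes>\<^sub>m C"
  shows "f x \<in> W"
  using assms closed_cspan_map[OF simple_tensors_bop[OF assms(1,2)], of f W x]
  unfolding min_tensor_def by blast

lemma min_tensor_eq:
  assumes "V \<subseteq> bop" "C \<subseteq> bop" "clinear_on (V \<otimes>\<^sub>m C) f" "continuous_on (V \<otimes>\<^sub>m C) f"
    "clinear_on (V \<otimes>\<^sub>m C) g" "continuous_on (V \<otimes>\<^sub>m C) g"
    and "\<And>v c. v \<in> V \<Longrightarrow> c \<in> C \<Longrightarrow> f (v \<otimes>\<^sub>o c) = g (v \<otimes>\<^sub>o c)"
    and "x \<in> V \<otimes>\<^sub>m C"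
  shows "f x = g x"
  using assms closed_cspan_eq[OF simple_tensors_bop[OF assms(1,2)], of f g x]
  unfolding min_tensor_def by blast

lemma min_tensor_mono:
  assumes "V \<subseteq> V'" "C \<subseteq> C'" "V' \<subseteq> bop" "C' \<subseteq> bop"
  shows "V \<otimes>\<^sub>m C \<subseteq> V' \<otimes>\<^sub>m C'"
  unfolding min_tensor_def[of V C]
  using assms by (intro closure_minimal cspan_minimal csubspace_min_tensor closed_min_tensor)
    (auto intro: min_tensor_simple)

text \<open>\<open>tensor_ext_bdd K V C m\<close> makes \<^const>\<open>tensor_ext\<close> meaningful: the map it selects exists and
  has norm at most \<open>K\<close>.\<close>

definition tensor_ext_bdd :: "real \<Rightarrow> 'x op set \<Rightarrow> 'y op set \<Rightarrow> ('x op \<Rightarrow> 'y op \<Rightarrow> 'z op) \<Rightarrow> bool"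
  where "tensor_ext_bdd K V C m \<longleftrightarrow> (\<exists>T. clinear_on (V \<otimes>\<^sub>m C) T \<and>
     (\<forall>x\<in>V \<otimes>\<^sub>m C. norm (T x) \<le> K * norm x) \<and> (\<forall>v\<in>V. \<forall>c\<in>C. T (v \<otimes>\<^sub>o c) = m v c))"

text \<open>\<open>tensor_ext\<close> picks some continuous linear map; on the dense span of simple
  tensors it must agree with the bounded witness \<open>T\<close>, and so it inherits the
  bound.\<close>

lemma
  assumes V: "V \<subseteq> bop" and C: "C \<subseteq> bop" and "tensor_ext_bdd K V C m"
  shows clinear_tensor_ext: "clinear_on (V \<otimes>\<^sub>m C) (tensor_ext V C m)"
    and continuous_tensor_ext: "continuous_on (V \<otimes>\<^sub>m C) (tensor_ext V C m)"
    and tensor_ext_simple: "v \<in> V \<Longrightarrow> c \<in> C \<Longrightarrow> tensor_ext V C m (v \<otimes>\<^sub>o c) = m v c"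
    and norm_tensor_ext_le: "x \<in> V \<otimes>\<^sub>m C \<Longrightarrow> norm (tensor_ext V C m x) \<le> K * norm x"
proof -
  obtain T where T: "clinear_on (V \<otimes>\<^sub>m C) T" "\<And>x. x \<in> V \<otimes>\<^sub>m C \<Longrightarrow> norm (T x) \<le> K * norm x"
    "\<And>v c. v \<in> V \<Longrightarrow> c \<in> C \<Longrightarrow> T (v \<otimes>\<^sub>o c) = m v c"
    using assms(3) unfolding tensor_ext_bdd_def by blast
  have cT: "continuous_on (V \<otimes>\<^sub>m C) T"
    by (rule clinear_on_bounded_continuous[OF csubspace_min_tensor[OF V C] T(1,2)])
  have "clinear_on (V \<otimes>\<^sub>m C) (tensor_ext V C m) \<and> continuous_on (V \<otimes>\<^sub>m C) (tensor_ext V C m) \<and>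
     (\<forall>v\<in>V. \<forall>c\<in>C. tensor_ext V C m (v \<otimes>\<^sub>o c) = m v c)"
    unfolding tensor_ext_def by (rule someI[of _ T]) (use T cT in auto)
  then show E: "clinear_on (V \<otimes>\<^sub>m C) (tensor_ext V C m)" "continuous_on (V \<otimes>\<^sub>m C) (tensor_ext V C m)"
    "\<And>v c. v \<in> V \<Longrightarrow> c \<in> C \<Longrightarrow> tensor_ext V C m (v \<otimes>\<^sub>o c) = m v c"
    by auto
  show "norm (tensor_ext V C m x) \<le> K * norm x" if x: "x \<in> V \<otimes>\<^sub>m C"
    using min_tensor_eq[OF V C E(1,2) T(1) cT _ x] T(2)[OF x] by (simp add: E T)
qed

text \<open>The cb-norm of \<phi> is at most \<open>K\<close>. Matrices are total functions on
  \<open>nat\<close>; when \<open>V\<close> is a subspace, the entries beyond \<open>n\<close> can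
  be filled with 0.\<close>

definition cbdd :: "real \<Rightarrow> 'x op set \<Rightarrow> ('x op \<Rightarrow> 'y op) \<Rightarrow> bool"
  where "cbdd K V \<phi> \<longleftrightarrow> (\<forall>(n :: nat) M N. (\<forall>i j. M i j \<in> V) \<longrightarrow> 0 \<le> N \<longrightarrow> mat_bdd {..<n} M N
     \<longrightarrow> mat_bdd {..<n} (\<lambda>i j. \<phi> (M i j)) (K * N))"

lemma mat_bdd_reindex_imp:
  assumes f: "bij_betw f J I" and "mat_bdd I M N"
  shows "mat_bdd J (\<lambda>i j. M (f i) (f j)) N"
  unfolding mat_bdd_def
proof (intro allI)
  fix \<xi> \<eta>
  define g where "g = the_inv_into J f"
  have g: "g (f i) = i" if "i \<in> J" for i
    using f that by (auto simp: g_def bij_betw_def the_inv_into_f_f)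
  have "(\<Sum>i\<in>J. \<Sum>j\<in>J. cinner (\<xi> i) (blinfun_apply (M (f i) (f j)) (\<eta> j)))
      = (\<Sum>i\<in>J. \<Sum>j\<in>J. cinner (\<xi> (g (f i))) (blinfun_apply (M (f i) (f j)) (\<eta> (g (f j)))))"
    by (simp add: g cong: sum.cong)
  also have "\<dots> = (\<Sum>i\<in>I. \<Sum>j\<in>I. cinner (\<xi> (g i)) (blinfun_apply (M i j) (\<eta> (g j))))"
    unfolding sum.reindex_bij_betw[OF f, of "\<lambda>k. cinner _ (blinfun_apply (M _ k) (\<eta> (g k)))"]
      sum.reindex_bij_betw[OF f, of "\<lambda>i. \<Sum>k\<in>I. cinner (\<xi> (g i)) (blinfun_apply (M i k) (\<eta> (g k)))"] ..
  finally have 1: "(\<Sum>i\<in>J. \<Sum>j\<in>J. cinner (\<xi> i) (blinfun_apply (M (f i) (f j)) (\<eta> j)))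
      = (\<Sum>i\<in>I. \<Sum>j\<in>I. cinner (\<xi> (g i)) (blinfun_apply (M i j) (\<eta> (g j))))" .
  have 2: "L2_set (\<lambda>i. norm (\<zeta> i)) J = L2_set (\<lambda>i. norm (\<zeta> (g i))) I" for \<zeta> :: "_ \<Rightarrow> 'c ell2"
    unfolding L2_set_def sum.reindex_bij_betw[OF f, of "\<lambda>i. (norm (\<zeta> (g i)))\<^sup>2", symmetric]
    by (simp add: g cong: sum.cong)
  show "cmod (\<Sum>i\<in>J. \<Sum>j\<in>J. cinner (\<xi> i) (blinfun_apply (M (f i) (f j)) (\<eta> j)))
      \<le> N * L2_set (\<lambda>i. norm (\<xi> i)) J * L2_set (\<lambda>i. norm (\<eta> i)) J"
    unfolding 1 2 using assms(2) by (simp add: mat_bdd_def)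
qed

lemma mat_bdd_cong:
  assumes "\<And>i j. i \<in> I \<Longrightarrow> j \<in> I \<Longrightarrow> M i j = M' i j" "mat_bdd I M N"
  shows "mat_bdd I M' N"
  using assms by (simp add: mat_bdd_def cong: sum.cong)

text \<open>Numbering \<open>I\<close> transports the bound, so that blocks indexed by finite sets
  of basis vectors are covered.\<close>

lemma cbdd_finite:
  fixes I :: "'i set"
  assumes "cbdd K V \<phi>" "finite I" "\<And>i j. M i j \<in> V" "0 \<le> N" "mat_bdd I M N"
  shows "mat_bdd I (\<lambda>i j. \<phi> (M i j)) (K * N)"
proof -
  obtain f where f: "bij_betw f {..<card I} I"
    using ex_bij_betw_nat_finite[OF assms(2)] by (auto simp: atLeast0LessThan)
  define g where "g = the_inv_into {..<card I} f"
  have g: "bij_betw g I {..<card I}" unfolding g_def using f by (rule bij_betw_the_inv_into)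
  have fg: "f (g i) = i" if "i \<in> I" for i
    using f that by (auto simp: g_def bij_betw_def f_the_inv_into_f)
  have "mat_bdd {..<card I} (\<lambda>i j. \<phi> (M (f i) (f j))) (K * N)"
    using assms mat_bdd_reindex_imp[OF f assms(5)] by (simp add: cbdd_def)
  from mat_bdd_reindex_imp[OF g this] show ?thesis
    by (rule mat_bdd_cong[rotated]) (simp add: fg)
qed

text \<open>On a simple tensor the slice is a scalar multiple of the left leg; closedness of
  \<open>V\<close> carries this to the completed tensor product.\<close>

lemma entry_min_tensor:
  assumes V: "csubspace V" "closed V" and C: "C \<subseteq> bop" and x: "x \<in> V \<otimes>\<^sub>m C"
  shows "entry i j x \<in> V"
proof (rule min_tensor_map[OF _ C _ _ V _ x])
  show "V \<subseteq> bop" using V by (simp add: csubspace_def)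
  show "clinear_on (V \<otimes>\<^sub>m C) (entry i j)" by (simp add: clinear_on_def entry_linear)
  show "continuous_on (V \<otimes>\<^sub>m C) (entry i j)"
    by (rule linear_continuous_on[OF bounded_linear_entry])
  show "entry i j (v \<otimes>\<^sub>o c) \<in> V" if "v \<in> V" "c \<in> C" for v c
    using that V C by (auto simp: entry_tensor_op csubspace_scale csubspace_bop subset_iff)
qed

text \<open>The entries \<phi>(x_ij) form a matrix whose finite blocks are bounded by complete
  boundedness, so they belong to an operator. Entries determine an operator, hence linearity and the
  value on simple tensors are inherited from \<phi> although the operator is chosen.\<close>

lemma tensor_ext_bdd_left:
  fixes V :: "'x op set" and C :: "'y op set" and \<phi> :: "'x op \<Rightarrow> 'w op"
  assumes V: "csubspace V" "closed V" and C: "C \<subseteq> bop"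
    and \<phi>: "clinear_on V \<phi>" "\<And>v. v \<in> V \<Longrightarrow> clinear_op (\<phi> v)" "cbdd K V \<phi>" "0 \<le> K"
  shows "tensor_ext_bdd K V C (\<lambda>v c. \<phi> v \<otimes>\<^sub>o c)"
proof -
  let ?P = "\<lambda>x R. clinear_op R \<and> norm R \<le> K * norm x \<and> (\<forall>i j. entry i j R = \<phi> (entry i j x))"
  define T where "T x = (SOME R. ?P x R)" for x :: "('x \<times> 'y) op"
  have Vb: "V \<subseteq> bop" using V by (simp add: csubspace_def)
  have X: "csubspace (V \<otimes>\<^sub>m C)" by (rule csubspace_min_tensor[OF Vb C])
  have T: "?P x (T x)" if x: "x \<in> V \<otimes>\<^sub>m C" for x
  proof -
    have e: "entry i j x \<in> V" for i j by (rule entry_min_tensor[OF V C x])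
    obtain R where "?P x R"
    proof (rule blk_op_exists[of "\<lambda>i j. \<phi> (entry i j x)" "K * norm x"])
      show "mat_bdd I (\<lambda>i j. \<phi> (entry i j x)) (K * norm x)" if "finite I" for I
        using \<phi>(3) that e mat_bdd_entry[OF that] by (intro cbdd_finite) auto
    qed (use \<phi> e in auto)
    then show ?thesis unfolding T_def by (rule someI)
  qed
  show ?thesis
    unfolding tensor_ext_bdd_def
  proof (intro exI[of _ T] conjI ballI)
    show "clinear_on (V \<otimes>\<^sub>m C) T"
      unfolding clinear_on_def
    proof (intro conjI ballI allI)
      fix x y c assume xy: "x \<in> V \<otimes>\<^sub>m C" "y \<in> V \<otimes>\<^sub>m C"
      show "T (x + y) = T x + T y"
      proof (rule op_eq_entries)
        fix i j
        have "\<phi> (entry i j x + entry i j y) = \<phi> (entry i j x) + \<phi> (entry i j y)"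
          using \<phi>(1) entry_min_tensor[OF V C] xy by (simp add: clinear_on_def)
        then show "entry i j (T (x + y)) = entry i j (T x + T y)"
          using T xy csubspace_add[OF X] by (simp add: entry_linear)
      qed
    next
      fix x c assume x: "x \<in> V \<otimes>\<^sub>m C"
      show "T (scale_op c x) = scale_op c (T x)"
      proof (rule op_eq_entries)
        fix i j
        have "\<phi> (scale_op c (entry i j x)) = scale_op c (\<phi> (entry i j x))"
          using \<phi>(1) entry_min_tensor[OF V C] x by (simp add: clinear_on_def)
        then show "entry i j (T (scale_op c x)) = entry i j (scale_op c (T x))"
          using T x csubspace_scale[OF X] by (simp add: entry_linear)
      qed
    qed
    show "norm (T x) \<le> K * norm x" if "x \<in> V \<otimes>\<^sub>m C" for x using T that by blast
    fix v c assume v: "v \<in> V" and c: "c \<in> C"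
    have lin: "clinear_op v" "clinear_op c" using v c Vb C by auto
    show "T (v \<otimes>\<^sub>o c) = \<phi> v \<otimes>\<^sub>o c"
    proof (rule op_eq_entries)
      fix i j
      have "entry i j (T (v \<otimes>\<^sub>o c)) = \<phi> (scale_op (coord (blinfun_apply c (ket j)) i) v)"
        using T min_tensor_simple[OF v c] lin by (simp add: entry_tensor_op)
      then show "entry i j (T (v \<otimes>\<^sub>o c)) = entry i j (\<phi> v \<otimes>\<^sub>o c)"
        using \<phi> v lin by (simp add: entry_tensor_op clinear_on_def)
    qed
  qed
qed

lemma flip_min_tensor:
  assumes "V \<subseteq> bop" "C \<subseteq> bop" "x \<in> V \<otimes>\<^sub>m C"
  shows "flip x \<in> C \<otimes>\<^sub>m V"
proof (rule min_tensor_map[OF assms(1,2) _ _ _ _ _ assms(3)])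
  show "clinear_on (V \<otimes>\<^sub>m C) flip" by (simp add: clinear_on_def flip_linear)
  show "continuous_on (V \<otimes>\<^sub>m C) flip"
    by (rule linear_continuous_on[OF bounded_linear_flip])
  show "flip (v \<otimes>\<^sub>o c) \<in> C \<otimes>\<^sub>m V" if "v \<in> V" "c \<in> C" for v c
    using that assms min_tensor_simple[of c C v V] by (subst flip_tensor) auto
qed (intro csubspace_min_tensor closed_min_tensor assms)+

text \<open>Exchanging the legs before and after reduces id \<otimes> q to q \<otimes> id.\<close>

lemma tensor_ext_bdd_right:
  fixes V :: "'x op set" and C :: "'y op set" and q :: "'y op \<Rightarrow> 'w op"
  assumes V: "V \<subseteq> bop" and C: "csubspace C" "closed C"
    and q: "clinear_on C q" "\<And>c. c \<in> C \<Longrightarrow> clinear_op (q c)" "cbdd K C q" "0 \<le> K"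
  shows "tensor_ext_bdd K V C (\<lambda>v c. v \<otimes>\<^sub>o q c)"
proof -
  have Cb: "C \<subseteq> bop" using C by (simp add: csubspace_def)
  let ?T = "tensor_ext C V (\<lambda>c v. q c \<otimes>\<^sub>o v)"
  note b = tensor_ext_bdd_left[OF C V q]
  show ?thesis
    unfolding tensor_ext_bdd_def
  proof (intro exI[of _ "\<lambda>x. flip (?T (flip x))"] conjI ballI)
    show "clinear_on (V \<otimes>\<^sub>m C) (\<lambda>x. flip (?T (flip x)))"
      using clinear_tensor_ext[OF Cb V b] flip_min_tensor[OF V Cb]
      by (simp add: clinear_on_def flip_linear)
    show "norm (flip (?T (flip x))) \<le> K * norm x" if "x \<in> V \<otimes>\<^sub>m C" for x
    proof -
      have "norm (flip (?T (flip x))) \<le> K * norm (flip x)"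
        by (rule order_trans[OF norm_flip_le norm_tensor_ext_le[OF Cb V b flip_min_tensor[OF V Cb that]]])
      also have "\<dots> \<le> K * norm x" by (intro mult_left_mono norm_flip_le q)
      finally show ?thesis .
    qed
    fix v c assume vc: "v \<in> V" "c \<in> C"
    then have "clinear_op v" "clinear_op c" using V Cb by auto
    then show "flip (?T (flip (v \<otimes>\<^sub>o c))) = v \<otimes>\<^sub>o q c"
      using vc q(2) by (simp add: tensor_ext_simple[OF Cb V b])
  qed
qed

section \<open>Complete boundedness of homomorphisms and c.p. maps\<close>

lemma clinear_if_subset_bop: "V \<subseteq> bop \<Longrightarrow> x \<in> V \<Longrightarrow> clinear_op x"
  by auto

lemma cstar_algebraD:
  assumes "cstar_algebra C"
  shows cstar_csubspace: "csubspace C" and cstar_closed: "closed C"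
    and cstar_mult: "x \<in> C \<Longrightarrow> y \<in> C \<Longrightarrow> x o\<^sub>L y \<in> C" and cstar_adj: "x \<in> C \<Longrightarrow> adj x \<in> C"
    and cstar_bop: "C \<subseteq> bop"
  using assms by (auto simp: cstar_algebra_def csubspace_def)

lemma csubspace_scaleR: "csubspace V \<Longrightarrow> x \<in> V \<Longrightarrow> r *\<^sub>R x \<in> V"
  by (metis csubspace_scale scale_op_of_real)

lemma adj_eq_self_iff:
  "clinear_op a \<Longrightarrow> adj a = a \<longleftrightarrow> (\<forall>\<xi> \<eta>. cinner (blinfun_apply a \<eta>) \<xi> = cinner \<eta> (blinfun_apply a \<xi>))"
  by (metis adj_eqI cinner_adj)

text \<open>The fixed point \<open>b = (a\<^sup>2 + b\<^sup>2) / 2\<close> satisfies \<open>1 - a\<^sup>2 = (1 - b)\<^sup>2\<close>. It stands in for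
  \<open>1 - sqrt (1 - a\<^sup>2)\<close>, which makes sense in algebras without unit.\<close>

lemma one_minus_sqrt_exists:
  assumes C: "cstar_algebra C" and a: "a \<in> C" "adj a = a" "norm a < 1"
  obtains b where "b \<in> C" "adj b = b" "(a o\<^sub>L a) + (b o\<^sub>L b) = 2 *\<^sub>R b"
proof -
  note Cs = cstar_csubspace[OF C]
  \<comment> \<open>Self-adjointness is written as equations in the form, which makes the set
    visibly closed.\<close>
  define SA where "SA = {b :: 'a op. \<forall>\<xi> \<eta>. cinner (blinfun_apply b \<eta>) \<xi> = cinner \<eta> (blinfun_apply b \<xi>)}"
  define S where "S = C \<inter> SA \<inter> cball 0 (norm a)"
  have SA: "b \<in> SA \<longleftrightarrow> adj b = b" if "b \<in> C" for b
    using adj_eq_self_iff[of b] that cstar_bop[OF C] by (auto simp: SA_def)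
  have "SA = (\<Inter>\<xi>. \<Inter>\<eta>. {b. cinner (blinfun_apply b \<eta>) \<xi> = cinner \<eta> (blinfun_apply b \<xi>)})"
    by (auto simp: SA_def)
  then have "closed SA"
    by (auto intro!: closed_INT closed_Collect_eq
        bounded_linear.continuous_on[OF bounded_linear_cinner_left]
        bounded_linear.continuous_on[OF bounded_linear_cinner_right] continuous_intros)
  then have "complete S"
    unfolding S_def complete_eq_closed using cstar_closed[OF C] by auto
  moreover have "S \<noteq> {}"
    using a SA by (auto simp: S_def)
  \<comment> \<open>On the ball of radius \<open>norm a\<close> < 1 this map is stable, as the
    square of \<open>norm a\<close> is at most \<open>norm a\<close>, and it contracts with factor
    \<open>norm a\<close>.\<close>
  moreover define f where "f b = (1/2) *\<^sub>R ((a o\<^sub>L a) + (b o\<^sub>L b))" for b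
  have "f ` S \<subseteq> S"
  proof
    fix y assume "y \<in> f ` S"
    then obtain b where b: "b \<in> S" and y: "y = f b" by blast
    have b': "b \<in> C" "adj b = b" "norm b \<le> norm a" using b SA by (auto simp: S_def)
    have lin: "clinear_op a" "clinear_op b" using a b' cstar_bop[OF C] by auto
    have aa: "(a o\<^sub>L a) + (b o\<^sub>L b) \<in> C"
      by (intro csubspace_add[OF Cs] cstar_mult[OF C] a b')
    then have yC: "y \<in> C" unfolding y f_def by (rule csubspace_scaleR[OF Cs])
    have "adj ((a o\<^sub>L a) + (b o\<^sub>L b)) = (a o\<^sub>L a) + (b o\<^sub>L b)"
      using a b' lin by (simp add: adj_add adj_compose)
    then have "adj y = y"
      using lin unfolding y f_def scale_op_of_real[symmetric] by (subst adj_scale_op) auto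
    have "norm ((a o\<^sub>L a) + (b o\<^sub>L b)) \<le> norm a * norm a + norm b * norm b"
      by (intro order_trans[OF norm_triangle_ineq] add_mono norm_compose_le)
    also have "\<dots> \<le> norm a * 1 + norm a * 1"
      using a b' by (intro add_mono mult_mono) auto
    finally have "norm y \<le> norm a" by (simp add: y f_def)
    then show "y \<in> S" using yC \<open>adj y = y\<close> SA by (auto simp: S_def)
  qed
  moreover have "\<forall>x\<in>S. \<forall>y\<in>S. dist (f x) (f y) \<le> norm a * dist x y"
  proof (intro ballI)
    fix x y assume "x \<in> S" "y \<in> S"
    then have n: "norm x \<le> norm a" "norm y \<le> norm a" by (auto simp: S_def)
    \<comment> \<open>The factors need not commute, so x^2 - y^2 is split as x(x - y) + (x -
      y)y.\<close>
    have "f x - f y = (1/2) *\<^sub>R ((x o\<^sub>L (x - y)) + ((x - y) o\<^sub>L y))"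
      by (simp add: f_def compose_distribs scaleR_diff_right[symmetric])
    then have "norm (f x - f y) = norm ((x o\<^sub>L (x - y)) + ((x - y) o\<^sub>L y)) / 2" by simp
    also have "norm ((x o\<^sub>L (x - y)) + ((x - y) o\<^sub>L y)) \<le> norm x * norm (x - y) + norm (x - y) * norm y"
      by (intro order_trans[OF norm_triangle_ineq] add_mono norm_compose_le)
    also have "\<dots> \<le> norm a * norm (x - y) + norm (x - y) * norm a"
      using n by (intro add_mono mult_mono) auto
    finally show "dist (f x) (f y) \<le> norm a * dist x y" by (simp add: dist_norm mult.commute)
  qed
  ultimately have "\<exists>!b\<in>S. f b = b"
    using a by (intro Banach_fix[where c = "norm a"]) auto
  then obtain b where b: "b \<in> S" "f b = b" by blast
  have "(a o\<^sub>L a) + (b o\<^sub>L b) = 2 *\<^sub>R f b" by (simp add: f_def)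
  then show ?thesis using that[of b] b SA by (auto simp: S_def)
qed

lemma star_homD:
  assumes "star_hom C D q"
  shows star_hom_clinear: "clinear_on C q" and star_hom_in: "x \<in> C \<Longrightarrow> q x \<in> D"
    and star_hom_mult: "x \<in> C \<Longrightarrow> y \<in> C \<Longrightarrow> q (x o\<^sub>L y) = q x o\<^sub>L q y"
    and star_hom_adj: "x \<in> C \<Longrightarrow> q (adj x) = adj (q x)"
    and star_hom_add: "x \<in> C \<Longrightarrow> y \<in> C \<Longrightarrow> q (x + y) = q x + q y"
    and star_hom_scale: "x \<in> C \<Longrightarrow> q (scale_op c x) = scale_op c (q x)"
  using assms by (auto simp: star_hom_def clinear_on_def)

lemma star_hom_scaleR: "star_hom C D q \<Longrightarrow> x \<in> C \<Longrightarrow> q (r *\<^sub>R x) = r *\<^sub>R q x"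
  by (metis scale_op_of_real star_hom_scale)

text \<open>Applying \<open>q\<close> to a^2 + b^2 = 2b gives q(a)^2 + (1 - q(b))^2 = 1 on the
  Hilbert space of \<open>D\<close>, where 1 is the identity operator whether or not it lies in
  \<open>D\<close>. Hence q(a)^2 is at most 1.\<close>

lemma norm_star_hom_le_one:
  assumes C: "cstar_algebra C" and D: "D \<subseteq> bop" and q: "star_hom C D q"
    and a: "a \<in> C" "adj a = a" "norm a < 1"
  shows "norm (q a) \<le> 1"
proof -
  obtain b where b: "b \<in> C" "adj b = b" "(a o\<^sub>L a) + (b o\<^sub>L b) = 2 *\<^sub>R b"
    using one_minus_sqrt_exists[OF C a] .
  have lin: "clinear_op (q a)" "clinear_op (q b)" by (rule clinear_if_subset_bop[OF D star_hom_in[OF q]], rule a b)+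
  have sa: "adj (q a) = q a" "adj (q b) = q b" using star_hom_adj[OF q] a b by metis+
  have "q ((a o\<^sub>L a) + (b o\<^sub>L b)) = (q a o\<^sub>L q a) + (q b o\<^sub>L q b)"
    by (simp only: star_hom_add[OF q] star_hom_mult[OF q] cstar_mult[OF C] a(1) b(1))
  then have eq: "(q a o\<^sub>L q a) + (q b o\<^sub>L q b) = 2 *\<^sub>R q b"
    unfolding b(3) star_hom_scaleR[OF q b(1)] ..
  have sq: "(norm (blinfun_apply x \<xi>))\<^sup>2 = inner \<xi> (blinfun_apply (x o\<^sub>L x) \<xi>)"
    if "clinear_op x" "adj x = x" for x :: "'b op" and \<xi>
    using cinner_adj_right[OF that(1), of \<xi> "blinfun_apply x \<xi>"] that(2)
    by (metis Re_cinner blinfun_apply_blinfun_compose power2_norm_eq_inner)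
  have "norm (blinfun_apply (q a) \<xi>) \<le> 1 * norm \<xi>" for \<xi>
  proof -
    have "(norm (blinfun_apply (q a) \<xi>))\<^sup>2 + (norm (blinfun_apply (q b) \<xi>))\<^sup>2
        = inner \<xi> (blinfun_apply ((q a o\<^sub>L q a) + (q b o\<^sub>L q b)) \<xi>)"
      using lin sa by (simp add: sq blinfun.add_left inner_add_right)
    also have "\<dots> = 2 * inner \<xi> (blinfun_apply (q b) \<xi>)"
      unfolding eq by (simp add: blinfun.scaleR_left)
    finally have "(norm (blinfun_apply (q a) \<xi>))\<^sup>2 + (norm (\<xi> - blinfun_apply (q b) \<xi>))\<^sup>2 = (norm \<xi>)\<^sup>2"
      by (simp add: power2_norm_eq_inner inner_diff_left inner_diff_right inner_commute)
    then have "(norm (blinfun_apply (q a) \<xi>))\<^sup>2 \<le> (norm \<xi>)\<^sup>2"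
      using zero_le_power2[of "norm (\<xi> - blinfun_apply (q b) \<xi>)"] by linarith
    then show ?thesis by (simp add: power2_le_iff_abs_le)
  qed
  then show ?thesis by (intro norm_blinfun_bound) auto
qed

text \<open>Self-adjoint elements are scaled to norm below 1; a general \<open>x\<close> is handled
  through \<open>adj x o\<^sub>L x\<close> and the C*-identity.\<close>

lemma norm_star_hom_le:
  assumes C: "cstar_algebra C" and D: "D \<subseteq> bop" and q: "star_hom C D q" and x: "x \<in> C"
  shows "norm (q x) \<le> norm x"
proof -
  have sa: "norm (q a) \<le> norm a" if a: "a \<in> C" "adj a = a" for a
  proof (rule dense_ge)
    fix t assume t: "norm a < t"
    then have t0: "t > 0" using norm_ge_zero[of a] by linarith
    have "norm (q ((1/t) *\<^sub>R a)) \<le> 1"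
    proof (rule norm_star_hom_le_one[OF C D q])
      show "(1/t) *\<^sub>R a \<in> C" by (rule csubspace_scaleR[OF cstar_csubspace[OF C] a(1)])
      show "adj ((1/t) *\<^sub>R a) = (1/t) *\<^sub>R a"
        using a cstar_bop[OF C] unfolding scale_op_of_real[symmetric] by (subst adj_scale_op) auto
      show "norm ((1/t) *\<^sub>R a) < 1" using t t0 by simp
    qed
    then show "norm (q a) \<le> t" using t0 by (simp add: star_hom_scaleR[OF q a(1)] field_simps)
  qed
  have lin: "clinear_op x" "clinear_op (q x)"
    by (rule clinear_if_subset_bop[OF cstar_bop[OF C] x], rule clinear_if_subset_bop[OF D star_hom_in[OF q x]])
  have "(norm (q x))\<^sup>2 \<le> norm (adj (q x) o\<^sub>L q x)" by (rule norm_sq_le_adj_compose[OF lin(2)])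
  also have "adj (q x) o\<^sub>L q x = q (adj x o\<^sub>L x)"
    using x by (simp add: star_hom_mult[OF q] star_hom_adj[OF q] cstar_adj[OF C])
  also have "norm \<dots> \<le> norm (adj x o\<^sub>L x)"
    using x lin by (intro sa cstar_mult[OF C] cstar_adj[OF C]) (auto simp: adj_compose)
  also have "\<dots> \<le> (norm x)\<^sup>2"
    using norm_compose_le[of "adj x" x] by (simp add: norm_adj[OF lin(1)] power2_eq_square)
  finally show ?thesis by (simp add: power2_le_iff_abs_le)
qed

text \<open>M_I(C) for finite \<open>I\<close>: the second condition makes the entries outside I x I
  vanish. Unlike a span, this description is closed at sight; \<open>mats_eq_blk_alg\<close>
  compares it with \<open>mats\<close>.\<close>

definition blk_alg :: "'i set \<Rightarrow> 'x op set \<Rightarrow> ('x \<times> 'i) op set"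
  where "blk_alg I C = {X. (\<forall>i j. entry i j X \<in> C) \<and> blk I (\<lambda>i j. entry i j X) = X}"

lemma blk_in_blk_alg:
  assumes "finite I" "csubspace C" "\<And>i j. i \<in> I \<Longrightarrow> j \<in> I \<Longrightarrow> M i j \<in> C"
  shows "blk I M \<in> blk_alg I C"
  using assms by (auto simp: blk_alg_def entry_blk csubspace_0 intro: blk_cong)

lemma csubspace_blk_alg: "csubspace C \<Longrightarrow> csubspace (blk_alg I C)"
proof (rule csubspaceI)
  assume C: "csubspace C"
  show "clinear_op X" if "X \<in> blk_alg I C" for X
  proof -
    have "clinear_op (blk I (\<lambda>i j. entry i j X))"
      using that csubspace_bop[OF C] by (intro clinear_blk) (auto simp: blk_alg_def)
    then show ?thesis using that by (simp add: blk_alg_def)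
  qed
  show "0 \<in> blk_alg I C"
    using csubspace_0[OF C] by (simp add: blk_alg_def entry_linear blk_def compose_distribs)
  show "X + Y \<in> blk_alg I C" if "X \<in> blk_alg I C" "Y \<in> blk_alg I C" for X Y
    using that csubspace_add[OF C] by (auto simp: blk_alg_def entry_linear blk_add[symmetric])
  show "scale_op c X \<in> blk_alg I C" if "X \<in> blk_alg I C" for c X
    using that csubspace_scale[OF C] by (auto simp: blk_alg_def entry_linear scale_blk[symmetric])
qed

lemma closed_blk_alg:
  assumes "closed C"
  shows "closed (blk_alg I C)"
proof -
  have "continuous_on UNIV (\<lambda>X. blk I (\<lambda>i j. entry i j X))"
    unfolding blk_def
    by (intro continuous_on_sum linear_continuous_on bounded_linear_compose[OF bounded_linear_compose_op bounded_linear_entry])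
  then have "closed {X. blk I (\<lambda>i j. entry i j X) = X}"
    by (intro closed_Collect_eq continuous_on_id)
  moreover have "closed (entry i j -` C)" for i j
    using assms by (intro continuous_closed_vimage linear_continuous_at bounded_linear_entry)
  moreover have "blk_alg I C = (\<Inter>i. \<Inter>j. entry i j -` C) \<inter> {X. blk I (\<lambda>i j. entry i j X) = X}"
    by (auto simp: blk_alg_def)
  ultimately show ?thesis by (auto intro!: closed_Int closed_INT)
qed

lemma blk_alg_mult:
  assumes "finite I" "X \<in> blk_alg I C" "Y \<in> blk_alg I C"
  shows "X o\<^sub>L Y = blk I (\<lambda>i j. \<Sum>k\<in>I. entry i k X o\<^sub>L entry k j Y)"
  using assms blk_mult[OF assms(1), of "\<lambda>i j. entry i j X" "\<lambda>i j. entry i j Y"]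
  by (simp add: blk_alg_def)

lemma blk_alg_adj:
  assumes "csubspace C" "X \<in> blk_alg I C"
  shows "adj X = blk I (\<lambda>i j. adj (entry j i X))"
  using assms adj_blk[of I "\<lambda>i j. entry i j X"] by (simp add: blk_alg_def csubspace_bop)

lemma cstar_blk_alg:
  assumes I: "finite I" and C: "cstar_algebra C"
  shows "cstar_algebra (blk_alg I C)"
  unfolding cstar_algebra_def
proof (intro conjI ballI)
  note Cs = cstar_csubspace[OF C]
  show "csubspace (blk_alg I C)" by (rule csubspace_blk_alg[OF Cs])
  show "closed (blk_alg I C)" by (rule closed_blk_alg[OF cstar_closed[OF C]])
  fix X assume X: "X \<in> blk_alg I C"
  show "adj X \<in> blk_alg I C"
    unfolding blk_alg_adj[OF Cs X] using X
    by (intro blk_in_blk_alg[OF I Cs] cstar_adj[OF C]) (simp add: blk_alg_def)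
  fix Y assume Y: "Y \<in> blk_alg I C"
  show "X o\<^sub>L Y \<in> blk_alg I C"
    unfolding blk_alg_mult[OF I X Y] using X Y
    by (intro blk_in_blk_alg[OF I Cs] csubspace_sum[OF Cs] cstar_mult[OF C]) (auto simp: blk_alg_def)
qed

lemma star_hom_blk_alg:
  assumes I: "finite I" and C: "cstar_algebra C" and D: "cstar_algebra D" and q: "star_hom C D q"
  shows "star_hom (blk_alg I C) (blk_alg I D) (\<lambda>X. blk I (\<lambda>i j. q (entry i j X)))"
proof -
  note Cs = cstar_csubspace[OF C] and Ds = cstar_csubspace[OF D]
  have e: "entry i j X \<in> C" if "X \<in> blk_alg I C" for X i j using that by (simp add: blk_alg_def)
  show ?thesis
    unfolding star_hom_def clinear_on_def
  proof (intro conjI ballI allI)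
    fix X assume X: "X \<in> blk_alg I C"
    show "blk I (\<lambda>i j. q (entry i j X)) \<in> blk_alg I D"
      by (intro blk_in_blk_alg[OF I Ds] star_hom_in[OF q] e X)
    show "blk I (\<lambda>i j. q (entry i j (scale_op c X))) = scale_op c (blk I (\<lambda>i j. q (entry i j X)))" for c
      by (simp add: scale_blk entry_linear star_hom_scale[OF q] e[OF X])
    have "blk I (\<lambda>i j. q (entry i j (adj X))) = blk I (\<lambda>i j. adj (q (entry j i X)))"
      unfolding blk_alg_adj[OF Cs X]
      by (intro blk_cong) (simp add: entry_blk[OF I] star_hom_adj[OF q] e[OF X])
    also have "\<dots> = adj (blk I (\<lambda>i j. q (entry i j X)))"
      by (rule adj_blk[symmetric]) (rule clinear_if_subset_bop[OF cstar_bop[OF D] star_hom_in[OF q e[OF X]]])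
    finally show "blk I (\<lambda>i j. q (entry i j (adj X))) = adj (blk I (\<lambda>i j. q (entry i j X)))" .
    fix Y assume Y: "Y \<in> blk_alg I C"
    show "blk I (\<lambda>i j. q (entry i j (X + Y))) = blk I (\<lambda>i j. q (entry i j X)) + blk I (\<lambda>i j. q (entry i j Y))"
      by (simp add: blk_add entry_linear star_hom_add[OF q] e X Y)
    have "blk I (\<lambda>i j. q (entry i j (X o\<^sub>L Y))) = blk I (\<lambda>i j. \<Sum>k\<in>I. q (entry i k X) o\<^sub>L q (entry k j Y))"
      unfolding blk_alg_mult[OF I X Y]
    proof (rule blk_cong)
      fix i j assume "i \<in> I" "j \<in> I"
      then have "q (entry i j (blk I (\<lambda>i j. \<Sum>k\<in>I. entry i k X o\<^sub>L entry k j Y)))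
          = q (\<Sum>k\<in>I. entry i k X o\<^sub>L entry k j Y)"
        by (simp add: entry_blk[OF I])
      also have "\<dots> = (\<Sum>k\<in>I. q (entry i k X o\<^sub>L entry k j Y))"
        by (intro clinear_on_sum[OF Cs star_hom_clinear[OF q]] cstar_mult[OF C] e X Y)
      finally show "q (entry i j (blk I (\<lambda>i j. \<Sum>k\<in>I. entry i k X o\<^sub>L entry k j Y)))
          = (\<Sum>k\<in>I. q (entry i k X) o\<^sub>L q (entry k j Y))"
        by (simp add: star_hom_mult[OF q] e X Y)
    qed
    then show "blk I (\<lambda>i j. q (entry i j (X o\<^sub>L Y))) = blk I (\<lambda>i j. q (entry i j X)) o\<^sub>L blk I (\<lambda>i j. q (entry i j Y))"
      by (simp add: blk_mult[OF I])
  qed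
qed

lemma mat_bdd_mono: "mat_bdd I M N \<Longrightarrow> N \<le> N' \<Longrightarrow> mat_bdd I M N'"
  unfolding mat_bdd_def by (meson L2_set_nonneg mult_right_mono order_trans)

text \<open>The n-th amplification of \<open>q\<close> is itself a *-homomorphism between
  C*-algebras of matrices, hence contractive.\<close>

lemma cbdd_star_hom:
  assumes C: "cstar_algebra C" and D: "cstar_algebra D" and q: "star_hom C D q"
  shows "cbdd 1 C q"
  unfolding cbdd_def
proof (intro allI impI)
  fix n :: nat and M N assume M: "\<forall>i j. M i j \<in> C" and N: "0 \<le> N" and bd: "mat_bdd {..<n} M N"
  let ?I = "{..<n}" and ?X = "blk {..<n} M"
  let ?Q = "\<lambda>X. blk {..<n} (\<lambda>i j. q (entry i j X))"
  have "?X \<in> blk_alg ?I C" by (intro blk_in_blk_alg cstar_csubspace[OF C]) (use M in auto)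
  then have "norm (?Q ?X) \<le> norm ?X"
    using cstar_bop[OF cstar_blk_alg[OF _ D]]
    by (intro norm_star_hom_le[OF cstar_blk_alg[OF _ C] _ star_hom_blk_alg[OF _ C D q]]) auto
  also have "norm ?X \<le> N" by (rule norm_blk_le[OF bd N]) simp
  finally have "mat_bdd ?I (\<lambda>i j. entry i j (?Q ?X)) N"
    by (rule mat_bdd_mono[OF mat_bdd_entry, rotated]) simp
  then show "mat_bdd ?I (\<lambda>i j. q (M i j)) (1 * N)"
    by (simp only: mult_1) (rule mat_bdd_cong[rotated], assumption, simp add: entry_blk)
qed

section \<open>Compressions and completely positive maps\<close>

lemma L2_apply_le: "L2_set (\<lambda>i. norm (blinfun_apply T (\<xi> i))) I \<le> norm T * L2_set (\<lambda>i. norm (\<xi> i)) I"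
  by (simp add: L2_set_right_distrib L2_set_mono norm_blinfun)

text \<open>\<open>S\<close> moves to the left vectors as its adjoint and \<open>R\<close> to the
  right ones, so the same matrix is tested on vectors that have grown by the two norms at most.
  Slices, corner embeddings and compressions are of this kind.\<close>

lemma cbdd_compose_op:
  fixes S :: "'x ell2 \<Rightarrow>\<^sub>L 'y ell2" and R :: "'y ell2 \<Rightarrow>\<^sub>L 'x ell2"
  assumes S: "clinear_op S"
  shows "cbdd (norm S * norm R) V (\<lambda>x. S o\<^sub>L x o\<^sub>L R)"
  unfolding cbdd_def mat_bdd_def
proof (intro allI impI)
  fix n :: nat and M :: "nat \<Rightarrow> nat \<Rightarrow> 'x op" and N and \<xi> \<eta> :: "nat \<Rightarrow> 'y ell2"
  assume N: "0 \<le> N" and bd: "\<forall>\<xi> \<eta>. cmod (\<Sum>i<n. \<Sum>j<n. cinner (\<xi> i) (blinfun_apply (M i j) (\<eta> j)))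
     \<le> N * L2_set (\<lambda>i. norm (\<xi> i)) {..<n} * L2_set (\<lambda>i. norm (\<eta> i)) {..<n}"
  have "cmod (\<Sum>i<n. \<Sum>j<n. cinner (\<xi> i) (blinfun_apply (S o\<^sub>L M i j o\<^sub>L R) (\<eta> j)))
      = cmod (\<Sum>i<n. \<Sum>j<n. cinner (blinfun_apply (adj S) (\<xi> i)) (blinfun_apply (M i j) (blinfun_apply R (\<eta> j))))"
    using S by (simp add: cinner_adj)
  also have "\<dots> \<le> N * L2_set (\<lambda>i. norm (blinfun_apply (adj S) (\<xi> i))) {..<n} * L2_set (\<lambda>i. norm (blinfun_apply R (\<eta> i))) {..<n}"
    by (rule bd[rule_format])
  also have "\<dots> \<le> N * (norm (adj S) * L2_set (\<lambda>i. norm (\<xi> i)) {..<n}) * (norm R * L2_set (\<lambda>i. norm (\<eta> i)) {..<n})"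
    using N by (intro mult_mono L2_apply_le mult_nonneg_nonneg L2_set_nonneg order_refl norm_ge_zero)
  finally show "cmod (\<Sum>i<n. \<Sum>j<n. cinner (\<xi> i) (blinfun_apply (S o\<^sub>L M i j o\<^sub>L R) (\<eta> j)))
      \<le> norm S * norm R * N * L2_set (\<lambda>i. norm (\<xi> i)) {..<n} * L2_set (\<lambda>i. norm (\<eta> i)) {..<n}"
    using S by (simp add: norm_adj mult_ac)
qed

text \<open>Positivity of a 2 x 2 block matrix only yields a bound by the arithmetic mean of two
  squared lengths. Rescaling both families to length 1 replaces the mean by the product.\<close>

lemma mat_bdd_if_quadratic:
  fixes M :: "'i \<Rightarrow> 'i \<Rightarrow> 'x op"
  assumes I: "finite I" and bd: "\<And>\<xi> \<eta>. cmod (\<Sum>i\<in>I. \<Sum>j\<in>I. cinner (\<xi> i) (blinfun_apply (M i j) (\<eta> j)))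
     \<le> N / 2 * ((L2_set (\<lambda>i. norm (\<xi> i)) I)\<^sup>2 + (L2_set (\<lambda>i. norm (\<eta> i)) I)\<^sup>2)"
  shows "mat_bdd I M N"
  unfolding mat_bdd_def
proof (intro allI)
  fix \<xi> \<eta> :: "'i \<Rightarrow> 'x ell2"
  define a where "a = L2_set (\<lambda>i. norm (\<xi> i)) I"
  define b where "b = L2_set (\<lambda>i. norm (\<eta> i)) I"
  let ?S = "\<lambda>\<xi> \<eta>. \<Sum>i\<in>I. \<Sum>j\<in>I. cinner (\<xi> i) (blinfun_apply (M i j) (\<eta> j))"
  have ab: "0 \<le> a" "0 \<le> b" by (auto simp: a_def b_def L2_set_nonneg)
  have "cmod (?S \<xi> \<eta>) \<le> N * a * b"
  proof (cases "a = 0 \<or> b = 0")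
    case True
    then have "(\<forall>i\<in>I. \<xi> i = 0) \<or> (\<forall>i\<in>I. \<eta> i = 0)"
      using I by (auto simp: a_def b_def L2_set_eq_0_iff)
    then have "?S \<xi> \<eta> = 0" by auto
    then show ?thesis using True by auto
  next
    case False
    then have pos: "a > 0" "b > 0" using ab by auto
    have scale: "L2_set (\<lambda>i. norm ((1 / L2_set (\<lambda>i. norm (\<zeta> i)) I) *\<^sub>R \<zeta> i)) I = 1"
      if "L2_set (\<lambda>i. norm (\<zeta> i)) I > 0" for \<zeta> :: "'i \<Rightarrow> 'x ell2"
      using that L2_set_right_distrib[of "1 / L2_set (\<lambda>i. norm (\<zeta> i)) I" "\<lambda>i. norm (\<zeta> i)" I] by simp
    have "?S (\<lambda>i. (1/a) *\<^sub>R \<xi> i) (\<lambda>i. (1/b) *\<^sub>R \<eta> i) = complex_of_real (1 / (a * b)) * ?S \<xi> \<eta>"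
      by (simp add: cinner_scaleR blinfun.scaleR_right sum_distrib_left mult_ac divide_inverse)
    then have "cmod (?S \<xi> \<eta>) / (a * b) = cmod (?S (\<lambda>i. (1/a) *\<^sub>R \<xi> i) (\<lambda>i. (1/b) *\<^sub>R \<eta> i))"
      using pos by (simp add: norm_mult norm_divide)
    also have "\<dots> \<le> N / 2 * (1\<^sup>2 + 1\<^sup>2)"
      using bd[of "\<lambda>i. (1/a) *\<^sub>R \<xi> i" "\<lambda>i. (1/b) *\<^sub>R \<eta> i"] scale pos unfolding a_def b_def by simp
    finally show ?thesis using pos by (simp add: field_simps)
  qed
  then show "cmod (?S \<xi> \<eta>) \<le> N * L2_set (\<lambda>i. norm (\<xi> i)) I * L2_set (\<lambda>i. norm (\<eta> i)) I"
    by (simp add: a_def b_def)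
qed

lemma sum_lessThan_double: "(\<Sum>i<n + n. f i) = (\<Sum>i<n. f i) + (\<Sum>i<n. f (n + i))" for n :: nat
proof -
  have "(\<Sum>i<n + m. f i) = (\<Sum>i<n. f i) + (\<Sum>i<m. f (n + i))" for m
    by (induction m) (auto simp: add.assoc)
  then show ?thesis by blast
qed

text \<open>\<open>mat_positive\<close> speaks of indices below a number, so a 2 x 2 matrix of n x n
  blocks is flattened to size n + n, with n + i for the i-th index of the second half.\<close>

definition block22 :: "nat \<Rightarrow> 'x op \<Rightarrow> (nat \<Rightarrow> nat \<Rightarrow> 'x op) \<Rightarrow> (nat \<Rightarrow> nat \<Rightarrow> 'x op) \<Rightarrow> nat \<Rightarrow> nat \<Rightarrow> 'x op"
  where "block22 n P M M' i j =
    (if i < n then (if j < n then (if i = j then P else 0) else M i (j - n))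
     else (if j < n then M' (i - n) j else (if i = j then P else 0)))"

lemma form_block22:
  "(\<Sum>i<n + n. \<Sum>j<n + n. cinner (\<zeta> i) (blinfun_apply (block22 n P M M' i j) (\<zeta> j)))
   = (\<Sum>i<n. cinner (\<zeta> i) (blinfun_apply P (\<zeta> i))) + (\<Sum>i<n. \<Sum>j<n. cinner (\<zeta> i) (blinfun_apply (M i j) (\<zeta> (n + j))))
   + (\<Sum>i<n. \<Sum>j<n. cinner (\<zeta> (n + i)) (blinfun_apply (M' i j) (\<zeta> j)))
   + (\<Sum>i<n. cinner (\<zeta> (n + i)) (blinfun_apply P (\<zeta> (n + i))))"
proof -
  have d: "(\<Sum>j<n. cinner (\<xi> i) (blinfun_apply (if i = j then P else 0) (\<xi> j))) = cinner (\<xi> i) (blinfun_apply P (\<xi> i))"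
    if "i < n" for i and \<xi> :: "nat \<Rightarrow> 'a ell2"
  proof -
    have "(\<Sum>j<n. cinner (\<xi> i) (blinfun_apply (if i = j then P else 0) (\<xi> j)))
        = (\<Sum>j<n. if i = j then cinner (\<xi> i) (blinfun_apply P (\<xi> j)) else 0)"
      by (intro sum.cong) (auto simp: blinfun.zero_left)
    then show ?thesis using that by simp
  qed
  let ?c = "\<lambda>i j. cinner (\<zeta> i) (blinfun_apply (block22 n P M M' i j) (\<zeta> j))"
  have "(\<Sum>i<n. \<Sum>j<n. ?c i j) = (\<Sum>i<n. \<Sum>j<n. cinner (\<zeta> i) (blinfun_apply (if i = j then P else 0) (\<zeta> j)))"
    by (intro sum.cong refl) (simp add: block22_def)
  also have "\<dots> = (\<Sum>i<n. cinner (\<zeta> i) (blinfun_apply P (\<zeta> i)))"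
    by (intro sum.cong refl d) simp
  finally have 1: "(\<Sum>i<n. \<Sum>j<n. ?c i j) = (\<Sum>i<n. cinner (\<zeta> i) (blinfun_apply P (\<zeta> i)))" .
  have "(\<Sum>i<n. \<Sum>j<n. ?c (n + i) (n + j))
      = (\<Sum>i<n. \<Sum>j<n. cinner (\<zeta> (n + i)) (blinfun_apply (if i = j then P else 0) (\<zeta> (n + j))))"
    by (intro sum.cong refl) (simp add: block22_def)
  also have "\<dots> = (\<Sum>i<n. cinner (\<zeta> (n + i)) (blinfun_apply P (\<zeta> (n + i))))"
    by (intro sum.cong refl d[of _ "\<lambda>i. \<zeta> (n + i)"]) simp
  finally have 2: "(\<Sum>i<n. \<Sum>j<n. ?c (n + i) (n + j)) = (\<Sum>i<n. cinner (\<zeta> (n + i)) (blinfun_apply P (\<zeta> (n + i))))" .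
  have 3: "(\<Sum>i<n. \<Sum>j<n. ?c i (n + j)) = (\<Sum>i<n. \<Sum>j<n. cinner (\<zeta> i) (blinfun_apply (M i j) (\<zeta> (n + j))))"
    by (intro sum.cong refl) (simp add: block22_def)
  have 4: "(\<Sum>i<n. \<Sum>j<n. ?c (n + i) j) = (\<Sum>i<n. \<Sum>j<n. cinner (\<zeta> (n + i)) (blinfun_apply (M' i j) (\<zeta> j)))"
    by (intro sum.cong refl) (simp add: block22_def)
  show ?thesis
    unfolding sum_lessThan_double sum.distrib 1 2 3 4 by (simp add: add_ac)
qed

text \<open>Complete positivity is applied to the matrix with blocks \<open>N p\<close>, \<open>M\<close>, \<open>M\<^sup>*\<close>, \<open>N p\<close>, which is
  positive when \<open>M\<close> has norm at most \<open>N\<close>.\<close>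

lemma cbdd_cp_map:
  assumes V: "csubspace V" "\<And>x. x \<in> V \<Longrightarrow> adj x \<in> V" and p: "is_unit_of V p"
    and W: "W \<subseteq> bop" and \<phi>: "cp_map V W \<phi>" and K: "norm (\<phi> p) \<le> K"
  shows "cbdd K V \<phi>"
  unfolding cbdd_def
proof (intro allI impI)
  fix n :: nat and M N assume M: "\<forall>i j. M i j \<in> V" and N: "0 \<le> N" and bd: "mat_bdd {..<n} M N"
  have pV: "p \<in> V" and pl: "\<And>x. x \<in> V \<Longrightarrow> p o\<^sub>L x = x" and pr: "\<And>x. x \<in> V \<Longrightarrow> x o\<^sub>L p = x"
    using p by (auto simp: is_unit_of_def)
  have lin: "\<And>x. x \<in> V \<Longrightarrow> clinear_op x" by (rule csubspace_bop[OF V(1)])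
  \<comment> \<open>As the adjoint p' of \<open>p\<close> lies in \<open>V\<close>, p p' = p', and
    the left side is self-adjoint.\<close>
  have "adj p = p"
  proof -
    have e: "p o\<^sub>L adj p = adj p" using V(2) pV pl by blast
    have "p = adj (p o\<^sub>L adj p)" using lin[OF pV] by (simp add: e)
    also have "\<dots> = p o\<^sub>L adj p" using lin[OF pV] by (simp add: adj_compose)
    finally show ?thesis by (simp add: e)
  qed
  have pform: "cinner \<xi> (blinfun_apply p \<xi>) = of_real ((norm (blinfun_apply p \<xi>))\<^sup>2)" for \<xi>
    using cinner_adj[OF lin[OF pV], of \<xi> "blinfun_apply p \<xi>"] \<open>adj p = p\<close> pl[OF pV]
    by (metis blinfun_apply_blinfun_compose cinner_self)
  \<comment> \<open>As \<open>p\<close> may be a proper projection, the bound on \<open>M\<close> is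
    applied to p\<xi> and p\<eta>, to match the diagonal blocks.\<close>
  have Mform: "cinner \<xi> (blinfun_apply (M i j) \<eta>) = cinner (blinfun_apply p \<xi>) (blinfun_apply (M i j) (blinfun_apply p \<eta>))"
    for \<xi> \<eta> i j
    using cinner_adj[OF lin[OF pV], of \<xi>] \<open>adj p = p\<close> pl pr M
    by (metis blinfun_apply_blinfun_compose)
  have cl: "clinear_on V \<phi>" and in_W: "\<And>x. x \<in> V \<Longrightarrow> \<phi> x \<in> W" using \<phi> by (auto simp: cp_map_def)
  have lin': "\<And>x. x \<in> V \<Longrightarrow> clinear_op (\<phi> x)" by (rule clinear_if_subset_bop[OF W in_W])
  define P where "P = scale_op (of_real N) p"
  define B where "B = block22 n P M (\<lambda>i j. adj (M j i))"
  have BV: "B i j \<in> V" for i j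
    unfolding B_def block22_def P_def using M V pV csubspace_scale[OF V(1)] csubspace_0[OF V(1)] by auto
  \<comment> \<open>With a and b for \<open>?a\<close> and \<open>?b\<close>, the diagonal
    contributes N(a^2 + b^2), which dominates the off-diagonal part 2 Re S since |S| is at most
    Nab.\<close>
  have "mat_positive (n + n) B"
    unfolding mat_positive_def
  proof
    fix \<zeta> :: "nat \<Rightarrow> 'a ell2"
    let ?a = "L2_set (\<lambda>i. norm (blinfun_apply p (\<zeta> i))) {..<n}"
    let ?b = "L2_set (\<lambda>i. norm (blinfun_apply p (\<zeta> (n + i)))) {..<n}"
    let ?S = "\<Sum>i<n. \<Sum>j<n. cinner (\<zeta> i) (blinfun_apply (M i j) (\<zeta> (n + j)))"
    have 1: "(\<Sum>i<n. cinner (\<xi> i) (blinfun_apply P (\<xi> i))) = of_real (N * (L2_set (\<lambda>i. norm (blinfun_apply p (\<xi> i))) {..<n})\<^sup>2)"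
      for \<xi> :: "nat \<Rightarrow> 'a ell2"
      by (simp add: P_def pform L2_sq sum_distrib_left)
    have "(\<Sum>i<n. \<Sum>j<n. cinner (\<zeta> (n + i)) (blinfun_apply (adj (M j i)) (\<zeta> j)))
        = (\<Sum>i<n. \<Sum>j<n. cnj (cinner (\<zeta> j) (blinfun_apply (M j i) (\<zeta> (n + i)))))"
      using M lin by (simp add: cinner_adj_right) (simp add: cinner_commute[symmetric])
    also have "\<dots> = cnj ?S" by (subst sum.swap) simp
    finally have 2: "(\<Sum>i<n. \<Sum>j<n. cinner (\<zeta> (n + i)) (blinfun_apply (adj (M j i)) (\<zeta> j))) = cnj ?S" .
    have "cmod ?S \<le> N * ?a * ?b"
      unfolding Mform[of "\<zeta> _"] using bd by (simp add: mat_bdd_def)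
    then have "\<bar>Re ?S\<bar> \<le> N * ?a * ?b" using abs_Re_le_cmod order_trans by blast
    moreover have "2 * (N * ?a * ?b) \<le> N * ?a\<^sup>2 + N * ?b\<^sup>2"
      using mult_left_mono[OF sum_squares_bound[of ?a ?b] N] by (simp add: algebra_simps)
    ultimately have "0 \<le> N * ?a\<^sup>2 + N * ?b\<^sup>2 + 2 * Re ?S" by linarith
    moreover have "of_real A + z + cnj z + of_real A' \<in> \<real>\<^sub>\<ge>\<^sub>0" if "0 \<le> A + A' + 2 * Re z" for A A' z
      using that by (simp add: complex_nonneg_Reals_iff)
    ultimately show "(\<Sum>i<n + n. \<Sum>j<n + n. cinner (\<zeta> i) (blinfun_apply (B i j) (\<zeta> j))) \<in> \<real>\<^sub>\<ge>\<^sub>0"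
      unfolding B_def form_block22 1 1[of "\<lambda>i. \<zeta> (n + i)"] 2 by blast
  qed
  then have pos: "mat_positive (n + n) (\<lambda>i j. \<phi> (B i j))"
    using \<phi> BV by (auto simp: cp_map_def)
  have \<phi>B: "\<phi> (B i j) = block22 n (scale_op (of_real N) (\<phi> p)) (\<lambda>i j. \<phi> (M i j)) (\<lambda>i j. \<phi> (adj (M j i))) i j" for i j
    using cl pV clinear_on_zero[OF V(1) cl] by (auto simp: B_def block22_def P_def clinear_on_def)
  show "mat_bdd {..<n} (\<lambda>i j. \<phi> (M i j)) (K * N)"
  proof (rule mat_bdd_if_quadratic)
    fix \<xi> \<eta> :: "nat \<Rightarrow> 'b ell2"
    let ?a = "L2_set (\<lambda>i. norm (\<xi> i)) {..<n}" and ?b = "L2_set (\<lambda>i. norm (\<eta> i)) {..<n}"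
    define S where "S = (\<Sum>i<n. \<Sum>j<n. cinner (\<xi> i) (blinfun_apply (\<phi> (M i j)) (\<eta> j)))"
    define S' where "S' = (\<Sum>i<n. \<Sum>j<n. cinner (\<eta> i) (blinfun_apply (\<phi> (adj (M j i))) (\<xi> j)))"
    define Q where "Q \<zeta> = (\<Sum>i<n. cinner (\<zeta> i) (blinfun_apply (\<phi> p) (\<zeta> i)))" for \<zeta>
    \<comment> \<open>The first half of the test vector is rotated by a phase \<open>c\<close>,
      which only the cross terms see.\<close>
    have main: "of_real N * (Q \<xi> + Q \<eta>) + cnj c * S + c * S' \<in> \<real>\<^sub>\<ge>\<^sub>0" if c: "cmod c = 1" for c
    proof -
      define \<zeta> where "\<zeta> i = (if i < n then c *\<^sub>C \<xi> i else \<eta> (i - n))" for i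
      have "cnj c * c = 1" using c complex_norm_square[of c] by (simp add: mult.commute)
      then have e1: "(\<Sum>i<n. cinner (\<zeta> i) (blinfun_apply (scale_op (of_real N) (\<phi> p)) (\<zeta> i))) = of_real N * Q \<xi>"
        using lin'[OF pV] unfolding Q_def sum_distrib_left
        by (intro sum.cong) (auto simp: \<zeta>_def clinear_opD algebra_simps)
      have e2: "(\<Sum>i<n. cinner (\<zeta> (n + i)) (blinfun_apply (scale_op (of_real N) (\<phi> p)) (\<zeta> (n + i)))) = of_real N * Q \<eta>"
        by (simp add: \<zeta>_def Q_def sum_distrib_left)
      have e3: "(\<Sum>i<n. \<Sum>j<n. cinner (\<zeta> i) (blinfun_apply (\<phi> (M i j)) (\<zeta> (n + j)))) = cnj c * S"
        by (simp add: \<zeta>_def S_def sum_distrib_left)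
      have e4: "(\<Sum>i<n. \<Sum>j<n. cinner (\<zeta> (n + i)) (blinfun_apply (\<phi> (adj (M j i))) (\<zeta> j))) = c * S'"
        using M V lin' by (simp add: \<zeta>_def S'_def sum_distrib_left clinear_opD)
      have "of_real N * Q \<xi> + cnj c * S + c * S' + of_real N * Q \<eta> \<in> \<real>\<^sub>\<ge>\<^sub>0"
        using pos[unfolded mat_positive_def, rule_format, of \<zeta>] unfolding \<phi>B form_block22 e1 e2 e3 e4 .
      then show ?thesis by (simp add: algebra_simps)
    qed
    define R where "R = N * (Re (Q \<xi>) + Re (Q \<eta>))"
    \<comment> \<open>Elements of the nonnegative cone are real, and comparing the phases 1, -1, i,
      -i forces S' to be the conjugate of S. That \<phi> respects adjoints is thus derived from
      positivity.\<close>
    have "Im S' = - Im S" "Re S' = Re S"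
      using main[of 1] main[of "-1"] main[of \<i>] main[of "-\<i>"] by (auto simp: complex_nonneg_Reals_iff)
    then have S': "S' = cnj S" by (simp add: complex_eq_iff)
    have "2 * cmod S \<le> R"
    proof (cases "S = 0")
      case True
      then show ?thesis using main[of 1] S' by (simp add: complex_nonneg_Reals_iff R_def)
    next
      case False
      \<comment> \<open>With this phase both cross terms equal -|S|, so positivity reads 2|S| <=
        R.\<close>
      define c where "c = - S / cmod S"
      have c: "cmod c = 1" using False by (simp add: c_def norm_divide)
      have cS: "cnj c * S = - of_real (cmod S)"
        using False complex_norm_square[of S] by (simp add: c_def field_simps power2_eq_square)
      have "c * S' = cnj (cnj c * S)" by (simp add: S')
      also have "\<dots> = - of_real (cmod S)" unfolding cS by simp
      finally show ?thesis using main[OF c] cS by (simp add: complex_nonneg_Reals_iff R_def)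
    qed
    moreover have "Re (Q \<zeta>) \<le> K * (L2_set (\<lambda>i. norm (\<zeta> i)) {..<n})\<^sup>2" for \<zeta>
    proof -
      have "Re (Q \<zeta>) \<le> (\<Sum>i<n. K * (norm (\<zeta> i))\<^sup>2)"
        unfolding Q_def Re_sum
      proof (rule sum_mono)
        fix i
        have "Re (cinner (\<zeta> i) (blinfun_apply (\<phi> p) (\<zeta> i))) \<le> norm (\<phi> p) * norm (\<zeta> i) * norm (\<zeta> i)"
          by (rule order_trans[OF complex_Re_le_cmod form_le_norm])
        also have "\<dots> \<le> K * norm (\<zeta> i) * norm (\<zeta> i)" using K by (intro mult_right_mono) auto
        finally show "Re (cinner (\<zeta> i) (blinfun_apply (\<phi> p) (\<zeta> i))) \<le> K * (norm (\<zeta> i))\<^sup>2"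
          by (simp add: power2_eq_square mult.assoc)
      qed
      then show ?thesis by (simp add: L2_sq sum_distrib_left)
    qed
    then have "R \<le> N * (K * ?a\<^sup>2 + K * ?b\<^sup>2)"
      unfolding R_def using N by (intro mult_left_mono add_mono) auto
    ultimately show "cmod (\<Sum>i<n. \<Sum>j<n. cinner (\<xi> i) (blinfun_apply (\<phi> (M i j)) (\<eta> j)))
        \<le> K * N / 2 * (?a\<^sup>2 + ?b\<^sup>2)"
      unfolding S_def[symmetric] by (simp add: algebra_simps)
  qed simp
qed

section \<open>Exactness at the kernel of a quotient map\<close>

definition cb_map :: "real \<Rightarrow> 'x op set \<Rightarrow> 'y op set \<Rightarrow> ('x op \<Rightarrow> 'y op) \<Rightarrow> bool"
  where "cb_map K V W \<phi> \<longleftrightarrow> clinear_on V \<phi> \<and> (\<forall>x\<in>V. \<phi> x \<in> W) \<and> cbdd K V \<phi> \<and> 0 \<le> K"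

definition closed_csubspace :: "'x op set \<Rightarrow> bool"
  where "closed_csubspace V \<longleftrightarrow> csubspace V \<and> closed V"

lemma closed_csubspace_bop: "closed_csubspace V \<Longrightarrow> V \<subseteq> bop"
  by (simp add: closed_csubspace_def csubspace_def)

abbreviation left_map :: "('x op \<Rightarrow> 'w op) \<Rightarrow> 'x op set \<Rightarrow> 'y op set \<Rightarrow> ('x \<times> 'y) op \<Rightarrow> ('w \<times> 'y) op"
  where "left_map \<phi> V C \<equiv> tensor_ext V C (\<lambda>v c. \<phi> v \<otimes>\<^sub>o c)"

abbreviation right_map :: "('y op \<Rightarrow> 'z op) \<Rightarrow> 'x op set \<Rightarrow> 'y op set \<Rightarrow> ('x \<times> 'y) op \<Rightarrow> ('x \<times> 'z) op"
  where "right_map q V C \<equiv> tensor_ext V C (\<lambda>v c. v \<otimes>\<^sub>o q c)"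

lemma cb_map_tensor_ext_bdd:
  assumes "closed_csubspace V" "W \<subseteq> bop" "C \<subseteq> bop" "cb_map K V W \<phi>"
  shows "tensor_ext_bdd K V C (\<lambda>v c. \<phi> v \<otimes>\<^sub>o c)"
  using assms by (intro tensor_ext_bdd_left) (auto simp: closed_csubspace_def cb_map_def)

lemma cb_map_compose:
  "cb_map K V W \<phi> \<Longrightarrow> cb_map L W X \<psi> \<Longrightarrow> cb_map (L * K) V X (\<lambda>x. \<psi> (\<phi> x))"
  unfolding cb_map_def cbdd_def
  by (auto intro: clinear_on_compose simp: mult.assoc)

lemma cb_map_compose_op:
  assumes "clinear_op S" "clinear_op R" "norm S \<le> 1" "norm R \<le> 1" "\<And>x. x \<in> V \<Longrightarrow> S o\<^sub>L x o\<^sub>L R \<in> W"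
  shows "cb_map 1 V W (\<lambda>x. S o\<^sub>L x o\<^sub>L R)"
proof -
  have "cbdd (norm S * norm R) V (\<lambda>x. S o\<^sub>L x o\<^sub>L R)" by (rule cbdd_compose_op[OF assms(1)])
  moreover have "norm S * norm R \<le> 1" using mult_mono[OF assms(3,4)] by simp
  ultimately have "cbdd 1 V (\<lambda>x. S o\<^sub>L x o\<^sub>L R)"
    unfolding cbdd_def by (meson mat_bdd_mono mult_right_mono)
  moreover have "clinear_on V (\<lambda>x. S o\<^sub>L x o\<^sub>L R)"
    using assms(1,2) by (auto simp: clinear_on_def compose_distribs clinear_opD intro!: blinfun_eqI)
  ultimately show ?thesis using assms(5) by (simp add: cb_map_def)
qed

text \<open>The extension is taken over all of \<open>C\<close>, but it leaves the second leg alone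
  and so respects C'. With C' = C this gives the codomain, with C' the kernel of \<open>q\<close>
  the passage from W \<otimes> J back to V \<otimes> J.\<close>

lemma left_map_in:
  assumes V: "closed_csubspace V" and W: "W \<subseteq> bop" and C: "C \<subseteq> bop" "C' \<subseteq> C" and \<phi>: "cb_map K V W \<phi>"
    and x: "x \<in> V \<otimes>\<^sub>m C'"
  shows "left_map \<phi> V C x \<in> W \<otimes>\<^sub>m C'"
proof -
  note Vb = closed_csubspace_bop[OF V]
  note b = cb_map_tensor_ext_bdd[OF V W C(1) \<phi>]
  have C': "C' \<subseteq> bop" using C by blast
  have sub: "V \<otimes>\<^sub>m C' \<subseteq> V \<otimes>\<^sub>m C" by (rule min_tensor_mono) (use Vb C in auto)
  show ?thesis
  proof (rule min_tensor_map[OF Vb C' _ _ csubspace_min_tensor[OF W C'] closed_min_tensor _ x])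
    show "clinear_on (V \<otimes>\<^sub>m C') (left_map \<phi> V C)"
      by (rule clinear_on_subset[OF clinear_tensor_ext[OF Vb C(1) b] sub])
    show "continuous_on (V \<otimes>\<^sub>m C') (left_map \<phi> V C)"
      by (rule continuous_on_subset[OF continuous_tensor_ext[OF Vb C(1) b] sub])
    show "left_map \<phi> V C (v \<otimes>\<^sub>o c) \<in> W \<otimes>\<^sub>m C'" if "v \<in> V" "c \<in> C'" for v c
      using that C \<phi> by (subst tensor_ext_simple[OF Vb C(1) b]) (auto simp: cb_map_def intro: min_tensor_simple)
  qed
qed

lemma star_hom_tensor_ext_bdd:
  assumes "V \<subseteq> bop" "cstar_algebra C" "cstar_algebra D" "star_hom C D q"
  shows "tensor_ext_bdd 1 V C (\<lambda>v c. v \<otimes>\<^sub>o q c)"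
  using assms cstar_bop[OF assms(3)]
  by (intro tensor_ext_bdd_right cbdd_star_hom star_hom_clinear)
    (auto intro: cstar_csubspace cstar_closed clinear_if_subset_bop star_hom_in)

lemma right_map_in:
  assumes V: "V \<subseteq> bop" and C: "cstar_algebra C" and D: "cstar_algebra D" and q: "star_hom C D q"
    and x: "x \<in> V \<otimes>\<^sub>m C"
  shows "right_map q V C x \<in> V \<otimes>\<^sub>m D"
proof -
  note b = star_hom_tensor_ext_bdd[OF V C D q]
  note Cb = cstar_bop[OF C] and Db = cstar_bop[OF D]
  show ?thesis
    by (rule min_tensor_map[OF V Cb clinear_tensor_ext[OF V Cb b] continuous_tensor_ext[OF V Cb b]
          csubspace_min_tensor[OF V Db] closed_min_tensor _ x])
      (auto simp: tensor_ext_simple[OF V Cb b] intro: min_tensor_simple star_hom_in[OF q])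
qed

text \<open>Both sides are linear, continuous and send v \<otimes> c to \<phi>(v) \<otimes>
  q(c).\<close>

lemma left_right_map_commute:
  assumes V: "closed_csubspace V" and W: "W \<subseteq> bop" and \<phi>: "cb_map K V W \<phi>"
    and C: "cstar_algebra C" and D: "cstar_algebra D" and q: "star_hom C D q"
    and x: "x \<in> V \<otimes>\<^sub>m C"
  shows "right_map q W C (left_map \<phi> V C x) = left_map \<phi> V D (right_map q V C x)"
proof -
  note Cb = cstar_bop[OF C] and Db = cstar_bop[OF D] and Vb = closed_csubspace_bop[OF V]
  note l = cb_map_tensor_ext_bdd[OF V W Cb \<phi>] and l' = cb_map_tensor_ext_bdd[OF V W Db \<phi>]
  note r = star_hom_tensor_ext_bdd[OF Vb C D q] and r' = star_hom_tensor_ext_bdd[OF W C D q]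
  have inl: "left_map \<phi> V C ` (V \<otimes>\<^sub>m C) \<subseteq> W \<otimes>\<^sub>m C" using left_map_in[OF V W Cb order_refl \<phi>] by blast
  have inr: "right_map q V C ` (V \<otimes>\<^sub>m C) \<subseteq> V \<otimes>\<^sub>m D" using right_map_in[OF Vb C D q] by blast
  show ?thesis
  proof (rule min_tensor_eq[OF Vb Cb _ _ _ _ _ x])
    show "clinear_on (V \<otimes>\<^sub>m C) (\<lambda>x. right_map q W C (left_map \<phi> V C x))"
      by (rule clinear_on_compose[OF clinear_tensor_ext[OF Vb Cb l] clinear_tensor_ext[OF W Cb r'] inl])
    show "clinear_on (V \<otimes>\<^sub>m C) (\<lambda>x. left_map \<phi> V D (right_map q V C x))"
      by (rule clinear_on_compose[OF clinear_tensor_ext[OF Vb Cb r] clinear_tensor_ext[OF Vb Db l'] inr])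
    show "continuous_on (V \<otimes>\<^sub>m C) (\<lambda>x. right_map q W C (left_map \<phi> V C x))"
      by (rule continuous_on_compose2[OF continuous_tensor_ext[OF W Cb r'] continuous_tensor_ext[OF Vb Cb l] inl])
    show "continuous_on (V \<otimes>\<^sub>m C) (\<lambda>x. left_map \<phi> V D (right_map q V C x))"
      by (rule continuous_on_compose2[OF continuous_tensor_ext[OF Vb Db l'] continuous_tensor_ext[OF Vb Cb r] inr])
    show "right_map q W C (left_map \<phi> V C (v \<otimes>\<^sub>o c)) = left_map \<phi> V D (right_map q V C (v \<otimes>\<^sub>o c))"
      if "v \<in> V" "c \<in> C" for v c
      using that \<phi> star_hom_in[OF q]
      by (simp add: tensor_ext_simple[OF Vb Cb l] tensor_ext_simple[OF Vb Db l'] tensor_ext_simple[OF Vb Cb r]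
          tensor_ext_simple[OF W Cb r'] cb_map_def)
  qed
qed

text \<open>The inclusion in \<open>exact_cstar\<close> that can fail, for one quotient map. It is
  transferred between algebras for each \<open>q\<close> separately.\<close>

definition kernel_exact :: "'x op set \<Rightarrow> 'y op set \<Rightarrow> ('y op \<Rightarrow> 'z op) \<Rightarrow> bool"
  where "kernel_exact V C q \<longleftrightarrow> (\<forall>x\<in>V \<otimes>\<^sub>m C. right_map q V C x = 0 \<longrightarrow> x \<in> V \<otimes>\<^sub>m {c \<in> C. q c = 0})"

lemma exact_cstar_iff_kernel_exact:
  assumes A: "A \<subseteq> bop"
  shows "exact_cstar TYPE('y) TYPE('z) A \<longleftrightarrow> (\<forall>(C :: 'y op set) (D :: 'z op set) q.
     cstar_algebra C \<and> cstar_algebra D \<and> star_hom C D q \<and> q ` C = D \<longrightarrow> kernel_exact A C q)"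
proof -
  have "right_map q A C x = 0 \<and> x \<in> A \<otimes>\<^sub>m C" if C: "cstar_algebra C" and D: "cstar_algebra D" and q: "star_hom C D q"
    and x: "x \<in> A \<otimes>\<^sub>m {c \<in> C. q c = 0}" for C :: "'y op set" and D :: "'z op set" and q x
  proof -
    note Cb = cstar_bop[OF C] and b = star_hom_tensor_ext_bdd[OF A C D q]
    let ?J = "{c \<in> C. q c = 0}"
    have J: "?J \<subseteq> bop" using Cb by blast
    have sub: "A \<otimes>\<^sub>m ?J \<subseteq> A \<otimes>\<^sub>m C" by (rule min_tensor_mono) (use A Cb in auto)
    have "right_map q A C x \<in> {0}"
      by (rule min_tensor_map[OF A J clinear_on_subset[OF clinear_tensor_ext[OF A Cb b] sub]
            continuous_on_subset[OF continuous_tensor_ext[OF A Cb b] sub] _ _ _ x])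
        (auto simp: tensor_ext_simple[OF A Cb b])
    then show ?thesis using x sub by auto
  qed
  then show ?thesis
    unfolding exact_cstar_def kernel_exact_def by blast
qed

text \<open>An element killed by id \<otimes> q stays killed after \<phi> \<otimes> id, since the
  two maps commute; exactness of \<open>W\<close> then applies to it.\<close>

lemma left_map_kernel:
  assumes V: "closed_csubspace V" and W: "W \<subseteq> bop" and \<phi>: "cb_map K V W \<phi>"
    and C: "cstar_algebra C" and D: "cstar_algebra D" and q: "star_hom C D q"
    and x: "x \<in> V \<otimes>\<^sub>m C" "right_map q V C x = 0" and ex: "kernel_exact W C q"
  shows "left_map \<phi> V C x \<in> W \<otimes>\<^sub>m {c \<in> C. q c = 0}"
proof -
  note Vb = closed_csubspace_bop[OF V]
  have "left_map \<phi> V D 0 = 0"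
    by (rule clinear_on_zero[OF csubspace_min_tensor[OF Vb cstar_bop[OF D]]
          clinear_tensor_ext[OF Vb cstar_bop[OF D] cb_map_tensor_ext_bdd[OF V W cstar_bop[OF D] \<phi>]]])
  then have "right_map q W C (left_map \<phi> V C x) = 0"
    using left_right_map_commute[OF V W \<phi> C D q x(1)] x(2) by simp
  then show ?thesis
    using ex left_map_in[OF V W cstar_bop[OF C] order_refl \<phi> x(1)] by (simp add: kernel_exact_def)
qed

text \<open>The mechanism common to retracts, approximations and matrix corners: a round trip
  through an exact \<open>W\<close> moves the kernel of id \<otimes> q into V \<otimes> J.\<close>

lemma kernel_exact_factor:
  assumes V: "closed_csubspace V" and W: "closed_csubspace W"
    and \<phi>: "cb_map K V W \<phi>" and \<psi>: "cb_map L W V \<psi>"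
    and C: "cstar_algebra C" and D: "cstar_algebra D" and q: "star_hom C D q"
    and x: "x \<in> V \<otimes>\<^sub>m C" "right_map q V C x = 0" and ex: "kernel_exact W C q"
  shows "left_map \<psi> W C (left_map \<phi> V C x) \<in> V \<otimes>\<^sub>m {c \<in> C. q c = 0}"
  by (rule left_map_in[OF W closed_csubspace_bop[OF V] cstar_bop[OF C] _ \<psi>
        left_map_kernel[OF V closed_csubspace_bop[OF W] \<phi> C D q x ex]]) auto

lemma left_map_compose:
  assumes V: "closed_csubspace V" and W: "closed_csubspace W" and X: "X \<subseteq> bop" and C: "C \<subseteq> bop"
    and \<phi>: "cb_map K V W \<phi>" and \<psi>: "cb_map L W X \<psi>"
  shows "clinear_on (V \<otimes>\<^sub>m C) (\<lambda>x. left_map \<psi> W C (left_map \<phi> V C x))"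
    and "continuous_on (V \<otimes>\<^sub>m C) (\<lambda>x. left_map \<psi> W C (left_map \<phi> V C x))"
    and "v \<in> V \<Longrightarrow> c \<in> C \<Longrightarrow> left_map \<psi> W C (left_map \<phi> V C (v \<otimes>\<^sub>o c)) = \<psi> (\<phi> v) \<otimes>\<^sub>o c"
    and "x \<in> V \<otimes>\<^sub>m C \<Longrightarrow> norm (left_map \<psi> W C (left_map \<phi> V C x)) \<le> L * K * norm x"
proof -
  note Vb = closed_csubspace_bop[OF V] and Wb = closed_csubspace_bop[OF W]
  note b = cb_map_tensor_ext_bdd[OF V Wb C \<phi>] and b' = cb_map_tensor_ext_bdd[OF W X C \<psi>]
  have i: "left_map \<phi> V C ` (V \<otimes>\<^sub>m C) \<subseteq> W \<otimes>\<^sub>m C" using left_map_in[OF V Wb C order_refl \<phi>] by blast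
  show "clinear_on (V \<otimes>\<^sub>m C) (\<lambda>x. left_map \<psi> W C (left_map \<phi> V C x))"
    by (rule clinear_on_compose[OF clinear_tensor_ext[OF Vb C b] clinear_tensor_ext[OF Wb C b'] i])
  show "continuous_on (V \<otimes>\<^sub>m C) (\<lambda>x. left_map \<psi> W C (left_map \<phi> V C x))"
    by (rule continuous_on_compose2[OF continuous_tensor_ext[OF Wb C b'] continuous_tensor_ext[OF Vb C b] i])
  show "left_map \<psi> W C (left_map \<phi> V C (v \<otimes>\<^sub>o c)) = \<psi> (\<phi> v) \<otimes>\<^sub>o c" if "v \<in> V" "c \<in> C"
    using that \<phi> by (simp add: tensor_ext_simple[OF Vb C b] tensor_ext_simple[OF Wb C b'] cb_map_def)
  show "norm (left_map \<psi> W C (left_map \<phi> V C x)) \<le> L * K * norm x" if x: "x \<in> V \<otimes>\<^sub>m C"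
  proof -
    have "norm (left_map \<psi> W C (left_map \<phi> V C x)) \<le> L * norm (left_map \<phi> V C x)"
      using i x by (intro norm_tensor_ext_le[OF Wb C b']) auto
    also have "\<dots> \<le> L * (K * norm x)"
      using \<psi> by (intro mult_left_mono norm_tensor_ext_le[OF Vb C b x]) (simp add: cb_map_def)
    finally show ?thesis by (simp add: mult.assoc)
  qed
qed

text \<open>The round trip is the identity on simple tensors, hence on all of V \<otimes> C.\<close>

lemma kernel_exact_retract:
  assumes V: "closed_csubspace V" and W: "closed_csubspace W"
    and \<phi>: "cb_map K V W \<phi>" and \<psi>: "cb_map L W V \<psi>" and retract: "\<And>v. v \<in> V \<Longrightarrow> \<psi> (\<phi> v) = v"
    and C: "cstar_algebra C" and D: "cstar_algebra D" and q: "star_hom C D q"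
    and ex: "kernel_exact W C q"
  shows "kernel_exact V C q"
  unfolding kernel_exact_def
proof (intro ballI impI)
  fix x assume x: "x \<in> V \<otimes>\<^sub>m C" "right_map q V C x = 0"
  note Vb = closed_csubspace_bop[OF V] and Cb = cstar_bop[OF C]
  note c = left_map_compose[OF V W Vb Cb \<phi> \<psi>]
  have "left_map \<psi> W C (left_map \<phi> V C x) = x"
    by (rule min_tensor_eq[OF Vb Cb c(1,2) _ continuous_on_id _ x(1)]) (simp_all add: c(3) retract clinear_on_def)
  then show "x \<in> V \<otimes>\<^sub>m {c \<in> C. q c = 0}"
    using kernel_exact_factor[OF V W \<phi> \<psi> C D q x ex] by simp
qed

text \<open>\<open>S\<close> and \<open>K\<close> have to come before \<open>T\<close>, \<theta> and
  \<delta>, because nuclearity supplies its maps only after the finite set and the tolerance are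
  given. Elements with this property form a subspace containing the simple tensors, so no explicit
  representation as a sum is handled.\<close>

lemma cspan_tensor_approx:
  assumes V: "V \<subseteq> bop" and C: "C \<subseteq> bop" and x: "x \<in> cspan (simple_tensors V C)"
  obtains S K where "finite S" "S \<subseteq> V" "0 \<le> K"
    "\<forall>T \<theta> \<delta>. clinear_on (V \<otimes>\<^sub>m C) T \<and> (\<forall>v\<in>V. \<forall>c\<in>C. T (v \<otimes>\<^sub>o c) = \<theta> v \<otimes>\<^sub>o c) \<and>
        (\<forall>v\<in>V. clinear_op (\<theta> v)) \<and> (\<forall>v\<in>S. norm (\<theta> v - v) \<le> \<delta>) \<and> 0 \<le> \<delta> \<longrightarrow>
        norm (T x - x) \<le> K * \<delta>"
proof -
  note X = csubspace_min_tensor[OF V C]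
  define good where "good T \<theta> \<delta> S \<longleftrightarrow> clinear_on (V \<otimes>\<^sub>m C) T \<and> (\<forall>v\<in>V. \<forall>c\<in>C. T (v \<otimes>\<^sub>o c) = \<theta> v \<otimes>\<^sub>o c) \<and>
      (\<forall>v\<in>V. clinear_op (\<theta> v)) \<and> (\<forall>v\<in>S. norm (\<theta> v - v) \<le> \<delta>) \<and> 0 \<le> \<delta>" for T \<theta> \<delta> S
  define W where "W = {x \<in> V \<otimes>\<^sub>m C. \<exists>S K. finite S \<and> S \<subseteq> V \<and> 0 \<le> K \<and>
     (\<forall>T \<theta> \<delta>. good T \<theta> \<delta> S \<longrightarrow> norm (T x - x) \<le> K * \<delta>)}"
  have WI: "x \<in> W" if "x \<in> V \<otimes>\<^sub>m C" "finite S" "S \<subseteq> V" "0 \<le> K"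
    "\<And>T \<theta> \<delta>. good T \<theta> \<delta> S \<Longrightarrow> norm (T x - x) \<le> K * \<delta>" for x S K
    using that unfolding W_def by blast
  have "csubspace W"
  proof (rule csubspaceI)
    show "clinear_op x" if "x \<in> W" for x using that csubspace_bop[OF X] by (simp add: W_def)
    show "0 \<in> W"
      by (rule WI[of _ "{}" 0]) (auto simp: csubspace_0[OF X] good_def clinear_on_zero[OF X])
    show "scale_op c x \<in> W" if xW: "x \<in> W" for c x
    proof -
      obtain S K where x: "x \<in> V \<otimes>\<^sub>m C" "finite S" "S \<subseteq> V" "0 \<le> K"
        "\<forall>T \<theta> \<delta>. good T \<theta> \<delta> S \<longrightarrow> norm (T x - x) \<le> K * \<delta>"
        using xW unfolding W_def by blast
      show ?thesis
      proof (rule WI[of _ S "cmod c * K"])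
        fix T \<theta> \<delta> assume g: "good T \<theta> \<delta> S"
        then have "T (scale_op c x) - scale_op c x = scale_op c (T x - x)"
          using x(1) by (simp add: good_def clinear_on_def scale_op_distribs)
        then have "norm (T (scale_op c x) - scale_op c x) \<le> cmod c * norm (T x - x)"
          using norm_scale_op by metis
        also have "\<dots> \<le> cmod c * (K * \<delta>)" by (intro mult_left_mono x(5)[rule_format, OF g]) auto
        finally show "norm (T (scale_op c x) - scale_op c x) \<le> cmod c * K * \<delta>" by (simp add: mult.assoc)
      qed (use x csubspace_scale[OF X] in auto)
    qed
    show "x + y \<in> W" if xW: "x \<in> W" and yW: "y \<in> W" for x y
    proof -
      obtain S K where x: "x \<in> V \<otimes>\<^sub>m C" "finite S" "S \<subseteq> V" "0 \<le> K"
        "\<forall>T \<theta> \<delta>. good T \<theta> \<delta> S \<longrightarrow> norm (T x - x) \<le> K * \<delta>"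
        using xW unfolding W_def by blast
      obtain S' K' where y: "y \<in> V \<otimes>\<^sub>m C" "finite S'" "S' \<subseteq> V" "0 \<le> K'"
        "\<forall>T \<theta> \<delta>. good T \<theta> \<delta> S' \<longrightarrow> norm (T y - y) \<le> K' * \<delta>"
        using yW unfolding W_def by blast
      show ?thesis
      proof (rule WI[of _ "S \<union> S'" "K + K'"])
        fix T \<theta> \<delta> assume g: "good T \<theta> \<delta> (S \<union> S')"
        then have g': "good T \<theta> \<delta> S" "good T \<theta> \<delta> S'" by (auto simp: good_def)
        have "T (x + y) - (x + y) = (T x - x) + (T y - y)"
          using g x(1) y(1) by (simp add: good_def clinear_on_def)
        then have "norm (T (x + y) - (x + y)) \<le> norm (T x - x) + norm (T y - y)"
          using norm_triangle_ineq by metis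
        also have "\<dots> \<le> K * \<delta> + K' * \<delta>" by (intro add_mono x(5)[rule_format, OF g'(1)] y(5)[rule_format, OF g'(2)])
        finally show "norm (T (x + y) - (x + y)) \<le> (K + K') * \<delta>" by (simp add: algebra_simps)
      qed (use x y csubspace_add[OF X] in auto)
    qed
  qed
  moreover have "simple_tensors V C \<subseteq> W"
  proof
    fix x assume "x \<in> simple_tensors V C"
    then obtain v c where vc: "v \<in> V" "c \<in> C" and x: "x = v \<otimes>\<^sub>o c" by blast
    have lin: "clinear_op v" "clinear_op c" using vc V C by auto
    show "x \<in> W"
    \<comment> \<open>The error on v \<otimes> c is (\<theta>(v) - v) \<otimes> c, which explains
      both witnesses.\<close>
    proof (rule WI[of _ "{v}" "norm c"])
      fix T \<theta> \<delta> assume g: "good T \<theta> \<delta> {v}"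
      then have \<theta>: "clinear_op (\<theta> v)" "norm (\<theta> v - v) \<le> \<delta>" using vc by (auto simp: good_def)
      have "T x - x = (\<theta> v - v) \<otimes>\<^sub>o c"
        using g vc \<theta> lin by (simp add: x good_def tensor_op_diff_left)
      then have "norm (T x - x) \<le> norm (\<theta> v - v) * norm c"
        using \<theta> lin by (simp add: norm_tensor_op_le)
      also have "\<dots> \<le> \<delta> * norm c" by (intro mult_right_mono \<theta>) simp
      finally show "norm (T x - x) \<le> norm c * \<delta>" by (simp add: mult.commute)
    qed (use vc x min_tensor_simple in auto)
  qed
  ultimately have "x \<in> W" using x cspan_minimal by blast
  then show ?thesis
    using that unfolding W_def good_def by blast
qed

text \<open>With x0 a finite sum of simple tensors near x, the distance from T x to x is split at T
  x0 and x0. The outer parts are small since T is contractive whatever \<open>W\<close> is chosen,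
  the middle one by the choice of the maps.\<close>

lemma kernel_exact_approx:
  assumes V: "closed_csubspace V"
    and approx: "\<And>\<epsilon> S. \<epsilon> > 0 \<Longrightarrow> finite S \<Longrightarrow> S \<subseteq> V \<Longrightarrow>
      \<exists>(W :: 'w op set) \<phi> \<psi>. closed_csubspace W \<and> cb_map 1 V W \<phi> \<and> cb_map 1 W V \<psi> \<and> kernel_exact W C q \<and>
        (\<forall>v\<in>S. norm (\<psi> (\<phi> v) - v) \<le> \<epsilon>)"
    and C: "cstar_algebra C" and D: "cstar_algebra D" and q: "star_hom C D q"
  shows "kernel_exact V C q"
  unfolding kernel_exact_def
proof (intro ballI impI)
  fix x assume x: "x \<in> V \<otimes>\<^sub>m C" "right_map q V C x = 0"
  let ?J = "{c \<in> C. q c = 0}"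
  note Vb = closed_csubspace_bop[OF V] and Cb = cstar_bop[OF C]
  have "x \<in> closure (V \<otimes>\<^sub>m ?J)"
    unfolding closure_approachable
  proof (intro allI impI)
    fix e :: real assume e: "e > 0"
    have "x \<in> closure (cspan (simple_tensors V C))" using x(1) by (simp add: min_tensor_def)
    moreover have "e / 4 > 0" using e by simp
    ultimately obtain x0 where x0: "x0 \<in> cspan (simple_tensors V C)" "dist x0 x < e / 4"
      unfolding closure_approachable by blast
    obtain S K where S: "finite S" "S \<subseteq> V" "0 \<le> K"
      "\<forall>T \<theta> \<delta>. clinear_on (V \<otimes>\<^sub>m C) T \<and> (\<forall>v\<in>V. \<forall>c\<in>C. T (v \<otimes>\<^sub>o c) = \<theta> v \<otimes>\<^sub>o c) \<and>
        (\<forall>v\<in>V. clinear_op (\<theta> v)) \<and> (\<forall>v\<in>S. norm (\<theta> v - v) \<le> \<delta>) \<and> 0 \<le> \<delta> \<longrightarrow>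
        norm (T x0 - x0) \<le> K * \<delta>"
      using cspan_tensor_approx[OF Vb Cb x0(1)] .
    \<comment> \<open>This makes K\<delta> at most e/4; the summand 1 avoids division by 0 when
      \<open>K\<close> vanishes.\<close>
    define \<delta> where "\<delta> = e / (4 * (K + 1))"
    have \<delta>: "\<delta> > 0" using e S(3) by (simp add: \<delta>_def)
    have K\<delta>: "K * \<delta> \<le> e / 4" using e S(3) by (simp add: \<delta>_def field_simps)
    obtain W :: "'w op set" and \<phi> \<psi> where W: "closed_csubspace W" and \<phi>: "cb_map 1 V W \<phi>" and \<psi>: "cb_map 1 W V \<psi>"
      and ex: "kernel_exact W C q" and near: "\<And>v. v \<in> S \<Longrightarrow> norm (\<psi> (\<phi> v) - v) \<le> \<delta>"
      using approx[OF \<delta> S(1,2)] by blast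
    define T where "T x = left_map \<psi> W C (left_map \<phi> V C x)" for x
    note c = left_map_compose[OF V W Vb Cb \<phi> \<psi>, folded T_def]
    have "norm (T x0 - x0) \<le> K * \<delta>"
    proof (rule S(4)[rule_format, of T "\<lambda>v. \<psi> (\<phi> v)" \<delta>], intro conjI ballI)
      show "clinear_op (\<psi> (\<phi> v))" if "v \<in> V" for v
        using \<phi> \<psi> that by (intro clinear_if_subset_bop[OF Vb]) (simp add: cb_map_def)
    qed (use near \<delta> c(1,3) in auto)
    then have 1: "norm (T x0 - x0) \<le> e / 4" using K\<delta> by linarith
    have x0': "x0 \<in> V \<otimes>\<^sub>m C" using x0(1) closure_subset unfolding min_tensor_def by blast
    have "T (x - x0) = T x - T x0"
      by (rule clinear_on_diff[OF csubspace_min_tensor[OF Vb Cb] c(1) x(1) x0'])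
    then have "norm (T x - T x0) \<le> norm (x - x0)"
      using c(4)[OF csubspace_diff[OF csubspace_min_tensor[OF Vb Cb] x(1) x0']] by simp
    then have 2: "norm (T x - T x0) < e / 4" using x0(2) by (simp add: dist_norm norm_minus_commute)
    have 3: "norm (x0 - x) < e / 4" using x0(2) by (simp add: dist_norm)
    have "T x - x = (T x - T x0) + ((T x0 - x0) + (x0 - x))" by simp
    also have "norm \<dots> \<le> norm (T x - T x0) + (norm (T x0 - x0) + norm (x0 - x))"
      by (intro norm_triangle_le add_left_mono norm_triangle_ineq)
    finally have "dist (T x) x < e" using 1 2 3 e unfolding dist_norm by linarith
    moreover have "T x \<in> V \<otimes>\<^sub>m ?J"
      unfolding T_def by (rule kernel_exact_factor[OF V W \<phi> \<psi> C D q x ex])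
    ultimately show "\<exists>y\<in>V \<otimes>\<^sub>m ?J. dist y x < e" by blast
  qed
  then show "x \<in> V \<otimes>\<^sub>m ?J" by (simp add: closure_closed[OF closed_min_tensor])
qed

section \<open>Exactness of matrix algebras\<close>

lemma closed_csubspace_blk_alg: "closed_csubspace A \<Longrightarrow> closed_csubspace (blk_alg I A)"
  by (simp add: closed_csubspace_def csubspace_blk_alg closed_blk_alg)

lemma norm_adj_ins_le: "norm (adj (ins i)) \<le> 1"
  using norm_ins_le[of i] by (simp add: norm_adj)

lemma cb_map_entry: "(\<And>x. x \<in> V \<Longrightarrow> entry i j x \<in> W) \<Longrightarrow> cb_map 1 V W (entry i j)"
  unfolding entry_def[abs_def] by (rule cb_map_compose_op) (auto simp: norm_ins_le norm_adj_ins_le)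

lemma tensor_op_sum_left:
  "(\<And>i. i \<in> I \<Longrightarrow> clinear_op (f i)) \<Longrightarrow> clinear_op c \<Longrightarrow> (\<Sum>i\<in>I. f i) \<otimes>\<^sub>o c = (\<Sum>i\<in>I. f i \<otimes>\<^sub>o c)"
  by (induction I rule: infinite_finite_induct) (auto simp: tensor_op_add_left)

lemma clinear_on_sum_fun:
  "(\<And>i. i \<in> I \<Longrightarrow> clinear_on V (f i)) \<Longrightarrow> clinear_on V (\<lambda>x. \<Sum>i\<in>I. f i x)"
  unfolding clinear_on_def by (simp add: sum.distrib scale_op_sum)

text \<open>The identity of M_I(A) is the finite sum of the maps that read one entry and put it back
  in its place, and each of these factors through \<open>A\<close>.\<close>

lemma kernel_exact_blk_alg:
  fixes I :: "'i set" and A :: "'x op set"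
  assumes I: "finite I" and A: "closed_csubspace A"
    and C: "cstar_algebra C" and D: "cstar_algebra D" and q: "star_hom C D q" and ex: "kernel_exact A C q"
  shows "kernel_exact (blk_alg I A) C q"
  unfolding kernel_exact_def
proof (intro ballI impI)
  let ?M = "blk_alg I A" and ?J = "{c \<in> C. q c = 0}"
  fix y assume y: "y \<in> ?M \<otimes>\<^sub>m C" "right_map q ?M C y = 0"
  note Ab = closed_csubspace_bop[OF A] and Cb = cstar_bop[OF C]
  have M: "closed_csubspace ?M" by (rule closed_csubspace_blk_alg[OF A])
  note Mb = closed_csubspace_bop[OF M]
  have As: "csubspace A" using A by (simp add: closed_csubspace_def)
  define \<iota> where "\<iota> s t x = ins s o\<^sub>L x o\<^sub>L adj (ins t)" for s t :: 'i and x :: "'x op"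
  have e: "cb_map 1 ?M A (entry s t)" for s t
    by (rule cb_map_entry) (simp add: blk_alg_def)
  have "\<iota> s t x = blk I (\<lambda>i j. if i = s \<and> j = t then x else 0)" if "s \<in> I" "t \<in> I" for s t x
    by (rule op_eq_entries) (use that in \<open>auto simp: \<iota>_def entry_ins entry_blk[OF I]\<close>)
  then have "\<iota> s t x \<in> ?M" if "s \<in> I" "t \<in> I" "x \<in> A" for s t x
    using that csubspace_0[OF As] by (simp add: blk_in_blk_alg[OF I As])
  then have \<iota>: "cb_map 1 A ?M (\<iota> s t)" if "s \<in> I" "t \<in> I" for s t
    unfolding \<iota>_def[abs_def] using that by (intro cb_map_compose_op) (auto simp: norm_ins_le norm_adj_ins_le)
  let ?T = "\<lambda>s t x. left_map (\<iota> s t) A C (left_map (entry s t) ?M C x)"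
  note c = left_map_compose[OF M A Mb Cb e \<iota>]
  have "(\<Sum>s\<in>I. \<Sum>t\<in>I. ?T s t y) = y"
  proof (rule min_tensor_eq[OF Mb Cb _ _ _ continuous_on_id _ y(1)])
    show "clinear_on (?M \<otimes>\<^sub>m C) (\<lambda>x. \<Sum>s\<in>I. \<Sum>t\<in>I. ?T s t x)"
      by (intro clinear_on_sum_fun c(1))
    show "continuous_on (?M \<otimes>\<^sub>m C) (\<lambda>x. \<Sum>s\<in>I. \<Sum>t\<in>I. ?T s t x)"
      by (intro continuous_on_sum c(2))
    show "clinear_on (?M \<otimes>\<^sub>m C) (\<lambda>x. x)" by (simp add: clinear_on_def)
    fix v d assume v: "v \<in> ?M" and d: "d \<in> C"
    have lin: "clinear_op v" "clinear_op d" using v d Mb Cb by auto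
    have "(\<Sum>s\<in>I. \<Sum>t\<in>I. ?T s t (v \<otimes>\<^sub>o d)) = (\<Sum>s\<in>I. \<Sum>t\<in>I. \<iota> s t (entry s t v) \<otimes>\<^sub>o d)"
      by (intro sum.cong refl c(3) v d)
    also have "\<dots> = blk I (\<lambda>i j. entry i j v) \<otimes>\<^sub>o d"
      unfolding blk_def using lin by (simp add: tensor_op_sum_left \<iota>_def clinear_op_sum)
    also have "blk I (\<lambda>i j. entry i j v) = v" using v by (simp add: blk_alg_def)
    finally show "(\<Sum>s\<in>I. \<Sum>t\<in>I. ?T s t (v \<otimes>\<^sub>o d)) = v \<otimes>\<^sub>o d" .
  qed
  moreover have "(\<Sum>s\<in>I. \<Sum>t\<in>I. ?T s t y) \<in> ?M \<otimes>\<^sub>m ?J"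
  proof -
    have X: "csubspace (?M \<otimes>\<^sub>m ?J)" by (rule csubspace_min_tensor[OF Mb]) (use Cb in blast)
    have "?T s t y \<in> ?M \<otimes>\<^sub>m ?J" if "s \<in> I" "t \<in> I" for s t
      by (rule kernel_exact_factor[OF M A e \<iota>[OF that] C D q y ex])
    then show ?thesis by (intro csubspace_sum[OF X])
  qed
  ultimately show "y \<in> ?M \<otimes>\<^sub>m ?J" by simp
qed

section \<open>Crossed products\<close>

lemma perm_op_eqI:
  assumes "clinear_op U" "\<And>x. blinfun_apply U (ket x) = ket (f x)"
  shows "perm_op f = U"
  unfolding perm_op_def by (rule the_equality) (use assms in \<open>auto intro: clinear_op_eqI\<close>)

lemma left_reg_eq_reindex: "left_reg s = reindex_op (\<lambda>t. - s + t)"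
proof -
  have "inj (\<lambda>t. - s + t)" by (simp add: inj_on_def)
  then show ?thesis
    unfolding left_reg_def
    by (intro perm_op_eqI clinear_reindex_op ell2_eqI) (auto simp: coord_reindex_op)
qed

lemma clinear_left_reg [simp, intro]: "clinear_op (left_reg s)"
  by (simp add: left_reg_eq_reindex clinear_reindex_op inj_on_def)

lemma left_reg_ket [simp]: "blinfun_apply (left_reg s) (ket t) = ket (s + t)"
  by (rule ell2_eqI) (auto simp: left_reg_eq_reindex coord_reindex_op inj_on_def)

lemma entry_adj: "clinear_op X \<Longrightarrow> entry i j (adj X) = adj (entry j i X)"
  by (simp add: entry_def adj_compose compose_assoc)

text \<open>The description in \<open>adj\<close> has a solution for complex-linear operators only;
  on these \<open>adj\<close> is isometric, whence the restriction to \<open>bop\<close>.\<close>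

lemma closed_vimage_adj:
  assumes "closed W"
  shows "closed {x \<in> bop. adj x \<in> W}"
proof -
  have "1-lipschitz_on bop adj"
    by (rule lipschitz_onI) (auto simp: dist_norm adj_diff[symmetric] norm_adj)
  then have "closed (bop \<inter> adj -` W)"
    by (intro continuous_closed_preimage lipschitz_on_continuous_on closed_bop assms)
  then show ?thesis by (simp add: vimage_def Int_def)
qed

text \<open>\<open>adj\<close> is conjugate linear, so \<open>closed_cspan_map\<close> does not
  apply; still, the operators whose adjoint lies in the closed span form a closed complex
  subspace.\<close>

lemma closed_cspan_adj:
  assumes G: "G \<subseteq> bop" "\<And>x. x \<in> G \<Longrightarrow> adj x \<in> closure (cspan G)" and x: "x \<in> closure (cspan G)"
  shows "adj x \<in> closure (cspan G)"
proof -
  let ?X = "closure (cspan G)"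
  have X: "csubspace ?X" using G(1) by (rule csubspace_closed_cspan)
  have "csubspace {x \<in> bop. adj x \<in> ?X}"
    by (rule csubspaceI) (auto simp: csubspace_0[OF X] csubspace_add[OF X] csubspace_scale[OF X] adj_add adj_scale_op)
  then have "?X \<subseteq> {x \<in> bop. adj x \<in> ?X}"
    using G by (intro closure_minimal cspan_minimal closed_vimage_adj) auto
  then show ?thesis using x by blast
qed

lemma cstar_bop_univ: "cstar_algebra (bop :: 'x op set)"
  by (auto simp: cstar_algebra_def closed_bop)

lemma norm_projection_le:
  assumes "clinear_op p" "adj p = p" "p o\<^sub>L p = p"
  shows "norm p \<le> 1"
proof (cases "norm p = 0")
  case False
  have "(norm p)\<^sup>2 \<le> norm p" using norm_sq_le_adj_compose[OF assms(1)] by (simp add: assms)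
  then show ?thesis using False by (simp add: power2_eq_square)
qed simp

section \<open>The matrix systems M_F(A) and compression to them\<close>

lemma mat_unit_apply [simp]: "blinfun_apply (mat_unit s t) \<xi> = coord \<xi> t *\<^sub>C ket s"
proof -
  have "bounded_linear (\<lambda>\<xi>. coord \<xi> t *\<^sub>C ket s)"
    by (rule bounded_linear_intro[where K = 1]) (auto simp: scaleC_distribs cmod_coord_le intro: ell2_eqI)
  then show ?thesis by (simp add: mat_unit_def bounded_linear_Blinfun_apply)
qed

lemma tensor_mat_unit: "clinear_op a \<Longrightarrow> a \<otimes>\<^sub>o mat_unit s t = ins s o\<^sub>L a o\<^sub>L adj (ins t)"
  by (rule tensor_op_eqI) (simp add: clinear_opD)

text \<open>This is 1 \<otimes> P_I, see \<open>id_tensor_proj_on\<close>, in block form so that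
  products with it are matrix products.\<close>

definition corner_unit :: "'i set \<Rightarrow> ('x \<times> 'i) op"
  where "corner_unit I = blk I (\<lambda>i j. if i = j then id_blinfun else 0)"

lemma id_tensor_proj_on:
  assumes "finite I"
  shows "id_blinfun \<otimes>\<^sub>o proj_on I = corner_unit I"
proof -
  have "corner_unit I = (\<Sum>i\<in>I. \<Sum>j\<in>I. if i = j then ins i o\<^sub>L adj (ins i) else 0)"
    unfolding corner_unit_def blk_def by (intro sum.cong) (auto simp: compose_distribs)
  also have "\<dots> = (\<Sum>i\<in>I. ins i o\<^sub>L adj (ins i))" using assms by simp
  finally have e: "corner_unit I = (\<Sum>i\<in>I. ins i o\<^sub>L adj (ins i))" .
  show ?thesis
    by (rule tensor_op_eqI)
      (simp add: e proj_on_def blinfun.sum_left bounded_bilinear.sum_right[OF bounded_bilinear_tensor_vec])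
qed

text \<open>A finite matrix is the sum of its entries tensored with matrix units, so the span
  already contains every block matrix over \<open>A\<close>. The right side shows that M_I(A) is
  closed when \<open>A\<close> is.\<close>

lemma mats_eq_blk_alg:
  assumes I: "finite I" and A: "csubspace A"
  shows "mats A I = blk_alg I A"
proof
  let ?G = "{a \<otimes>\<^sub>o mat_unit s t | a s t. a \<in> A \<and> s \<in> I \<and> t \<in> I}"
  have G: "?G \<subseteq> blk_alg I A"
  proof
    fix x assume "x \<in> ?G"
    then obtain a s t where a: "a \<in> A" "s \<in> I" "t \<in> I" and x: "x = a \<otimes>\<^sub>o mat_unit s t" by blast
    have "x = blk I (\<lambda>i j. if i = s \<and> j = t then a else 0)"
      using a csubspace_bop[OF A] by (intro op_eq_entries) (auto simp: x tensor_mat_unit entry_ins entry_blk[OF I])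
    then show "x \<in> blk_alg I A" using a csubspace_0[OF A] by (simp add: blk_in_blk_alg[OF I A])
  qed
  show "mats A I \<subseteq> blk_alg I A"
    unfolding mats_def by (rule cspan_minimal[OF csubspace_blk_alg[OF A] G])
  show "blk_alg I A \<subseteq> mats A I"
  proof
    fix X assume X: "X \<in> blk_alg I A"
    have "blk_alg I A \<subseteq> bop" using csubspace_blk_alg[OF A, of I] by (simp add: csubspace_def)
    then have c: "csubspace (mats A I)"
      unfolding mats_def by (rule csubspace_cspan[OF order_trans[OF G]])
    have "ins s o\<^sub>L entry s t X o\<^sub>L adj (ins t) \<in> mats A I" if "s \<in> I" "t \<in> I" for s t
    proof -
      have "entry s t X \<in> A" using X by (simp add: blk_alg_def)
      then have "entry s t X \<otimes>\<^sub>o mat_unit s t \<in> mats A I"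
        unfolding mats_def using that by (intro cspan_superset[THEN subsetD]) blast
      then show ?thesis using \<open>entry s t X \<in> A\<close> csubspace_bop[OF A] by (simp add: tensor_mat_unit)
    qed
    then have "blk I (\<lambda>i j. entry i j X) \<in> mats A I"
      unfolding blk_def by (intro csubspace_sum[OF c])
    then show "X \<in> mats A I" using X by (simp add: blk_alg_def)
  qed
qed

lemma corner_unit:
  fixes I :: "'i set" and A :: "'x op set"
  assumes I: "finite I" and A: "csubspace A" "id_blinfun \<in> A"
  shows "is_unit_of (blk_alg I A) (corner_unit I)" "norm (corner_unit I :: ('x \<times> 'i) op) \<le> 1"
proof -
  have d: "(\<Sum>k\<in>I. (if i = k then id_blinfun else 0) o\<^sub>L M k) = M i"
    "(\<Sum>k\<in>I. M k o\<^sub>L (if k = i then id_blinfun else 0)) = M i" if "i \<in> I" for i and M :: "_ \<Rightarrow> 'y op"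
  proof -
    have "(\<Sum>k\<in>I. (if i = k then id_blinfun else 0) o\<^sub>L M k) = (\<Sum>k\<in>I. if i = k then M k else 0)"
      by (intro sum.cong) (auto simp: compose_distribs)
    then show "(\<Sum>k\<in>I. (if i = k then id_blinfun else 0) o\<^sub>L M k) = M i" using I that by simp
    have "(\<Sum>k\<in>I. M k o\<^sub>L (if k = i then id_blinfun else 0)) = (\<Sum>k\<in>I. if k = i then M k else 0)"
      by (intro sum.cong) (auto simp: compose_distribs)
    then show "(\<Sum>k\<in>I. M k o\<^sub>L (if k = i then id_blinfun else 0)) = M i" using I that by simp
  qed
  have l: "corner_unit I o\<^sub>L blk I M = blk I M" and r: "blk I M o\<^sub>L corner_unit I = blk I M"
    for M :: "_ \<Rightarrow> _ \<Rightarrow> 'y op"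
    unfolding corner_unit_def blk_mult[OF I] by (auto intro!: blk_cong simp: d)
  have "corner_unit I \<in> blk_alg I A"
    unfolding corner_unit_def using A csubspace_0 by (intro blk_in_blk_alg[OF I A(1)]) auto
  moreover have "corner_unit I o\<^sub>L X = X" "X o\<^sub>L corner_unit I = X" if "X \<in> blk_alg I A" for X
    using l[of "\<lambda>i j. entry i j X"] r[of "\<lambda>i j. entry i j X"] that by (simp_all add: blk_alg_def)
  ultimately show "is_unit_of (blk_alg I A) (corner_unit I)"
    by (auto simp: is_unit_of_def)
  show "norm (corner_unit I :: ('x \<times> 'i) op) \<le> 1"
  proof (rule norm_projection_le)
    show "clinear_op (corner_unit I)" by (auto simp: corner_unit_def intro: clinear_blk)
    have "adj (corner_unit I :: ('x \<times> 'i) op) = blk I (\<lambda>i j. adj (if j = i then id_blinfun else 0))"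
      unfolding corner_unit_def by (rule adj_blk) simp
    also have "\<dots> = corner_unit I" unfolding corner_unit_def by (rule blk_cong) auto
    finally show "adj (corner_unit I :: ('x \<times> 'i) op) = corner_unit I" .
    show "corner_unit I o\<^sub>L corner_unit I = corner_unit I"
      using l unfolding corner_unit_def .
  qed
qed

lemma clinear_corner_unit: "clinear_op (corner_unit I)"
  by (auto simp: corner_unit_def intro: clinear_blk)

text \<open>The slices of \<open>X\<close> lie in \<open>A\<close>, and compression keeps those with
  both indices in \<open>I\<close> and nothing else.\<close>

lemma compress_min_tensor:
  fixes I :: "'i set" and A :: "'x op set"
  assumes I: "finite I" and A: "closed_csubspace A" and X: "X \<in> A \<otimes>\<^sub>m bop"
  shows "corner_unit I o\<^sub>L X o\<^sub>L corner_unit I \<in> blk_alg I A"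
proof -
  have As: "csubspace A" "closed A" using A by (auto simp: closed_csubspace_def)
  have e: "entry i j X \<in> A" for i j by (rule entry_min_tensor[OF As order_refl X])
  have l: "adj (ins i) o\<^sub>L corner_unit I = (if i \<in> I then adj (ins i) else 0)"
    and r: "corner_unit I o\<^sub>L ins i = (if i \<in> I then ins i else 0)" for i :: 'i
  proof -
    show "adj (ins i) o\<^sub>L corner_unit I = (if i \<in> I then adj (ins i) else 0)"
    proof (rule blinfun_eq_on_ins)
      fix j
      have "adj (ins i) o\<^sub>L corner_unit I o\<^sub>L ins j = entry i j (corner_unit I)" by (simp add: entry_def)
      also have "\<dots> = (if i \<in> I then adj (ins i) else 0) o\<^sub>L ins j"
        by (auto simp: corner_unit_def entry_blk[OF I] adj_ins_compose_ins compose_distribs)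
      finally show "adj (ins i) o\<^sub>L corner_unit I o\<^sub>L ins j = (if i \<in> I then adj (ins i) else 0) o\<^sub>L ins j" .
    qed
    show "corner_unit I o\<^sub>L ins i = (if i \<in> I then ins i else 0)"
    proof (rule blinfun_eq_adj_ins)
      fix j
      have "adj (ins j) o\<^sub>L (corner_unit I o\<^sub>L ins i) = entry j i (corner_unit I)" by (simp add: entry_def compose_assoc)
      also have "\<dots> = adj (ins j) o\<^sub>L (if i \<in> I then ins i else 0)"
        by (auto simp: corner_unit_def entry_blk[OF I] adj_ins_compose_ins compose_distribs)
      finally show "adj (ins j) o\<^sub>L (corner_unit I o\<^sub>L ins i) = adj (ins j) o\<^sub>L (if i \<in> I then ins i else 0)" .
    qed
  qed
  have "corner_unit I o\<^sub>L X o\<^sub>L corner_unit I = blk I (\<lambda>i j. entry i j X)"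
  proof (rule op_eq_entries)
    fix i j
    have "entry i j (corner_unit I o\<^sub>L X o\<^sub>L corner_unit I)
        = (adj (ins i) o\<^sub>L corner_unit I) o\<^sub>L X o\<^sub>L (corner_unit I o\<^sub>L ins j)"
      by (simp add: entry_def compose_assoc)
    then show "entry i j (corner_unit I o\<^sub>L X o\<^sub>L corner_unit I) = entry i j (blk I (\<lambda>i j. entry i j X))"
      unfolding l r entry_blk[OF I] by (simp add: entry_def compose_distribs)
  qed
  then show ?thesis using e by (simp add: blk_in_blk_alg[OF I As(1)])
qed

text \<open>\<open>ccp_map\<close> bounds norms on the first matrix level. Evaluated at the unit
  this gives the constant 1 in \<open>cbdd_cp_map\<close>, which holds on all levels.\<close>

lemma cb_map_ccp_map:
  assumes V: "closed_csubspace V" "\<And>x. x \<in> V \<Longrightarrow> adj x \<in> V" and p: "is_unit_of V p" "norm p \<le> 1"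
    and W: "W \<subseteq> bop" and \<phi>: "ccp_map V W \<phi>"
  shows "cb_map 1 V W \<phi>"
proof -
  have "cp_map V W \<phi>" "norm (\<phi> p) \<le> 1"
    using \<phi> p by (auto simp: ccp_map_def is_unit_of_def intro: order_trans)
  then show ?thesis
    using V p cbdd_cp_map[OF _ V(2) p(1) W] by (auto simp: cb_map_def cp_map_def closed_csubspace_def)
qed

section \<open>The crossed product by an action on a unital C*-algebra\<close>

locale unital_cstar_action =
  fixes A :: "'h op set" and \<alpha> :: "'g::group_add \<Rightarrow> 'h op \<Rightarrow> 'h op"
  assumes unital: "unital_cstar_algebra A" and action: "cstar_action A \<alpha>"
begin

abbreviation \<pi> :: "'h op \<Rightarrow> ('h \<times> 'g) op"
  where "\<pi> \<equiv> diag_rep \<alpha> (\<lambda>s. s)"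

abbreviation L :: "'g \<Rightarrow> ('h \<times> 'g) op"
  where "L s \<equiv> id_blinfun \<otimes>\<^sub>o left_reg s"

abbreviation B :: "('h \<times> 'g) op set"
  where "B \<equiv> crossed_product A \<alpha>"

lemma cstar_A: "cstar_algebra A" and id_in_A: "id_blinfun \<in> A"
  using unital by (auto simp: unital_cstar_algebra_def)

lemma A_bop: "A \<subseteq> bop"
  by (rule cstar_bop[OF cstar_A])

lemma closed_csubspace_A: "closed_csubspace A"
  by (simp add: closed_csubspace_def cstar_csubspace[OF cstar_A] cstar_closed[OF cstar_A])

lemma star_hom_\<alpha>: "star_hom A A (\<alpha> s)"
  and \<alpha>_0: "a \<in> A \<Longrightarrow> \<alpha> 0 a = a"
  and \<alpha>_add: "a \<in> A \<Longrightarrow> \<alpha> (s + t) a = \<alpha> s (\<alpha> t a)"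
  using action by (auto simp: cstar_action_def)

lemmas \<alpha>_in = star_hom_in[OF star_hom_\<alpha>]
lemmas \<alpha>_clinear = clinear_if_subset_bop[OF A_bop \<alpha>_in]

text \<open>The action consists of *-homomorphisms not assumed unital. The identity is in the range
  of each, by the inverse group element, and the image of the identity is a unit for the
  range.\<close>

lemma \<alpha>_id: "\<alpha> s id_blinfun = id_blinfun"
proof -
  have inv: "\<alpha> s (\<alpha> (- s) id_blinfun) = id_blinfun"
    using \<alpha>_add[OF id_in_A, of s "- s"] \<alpha>_0[OF id_in_A] by simp
  have "\<alpha> s (id_blinfun o\<^sub>L \<alpha> (- s) id_blinfun) = \<alpha> s id_blinfun o\<^sub>L \<alpha> s (\<alpha> (- s) id_blinfun)"
    by (rule star_hom_mult[OF star_hom_\<alpha> id_in_A \<alpha>_in[OF id_in_A]])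
  then show ?thesis by (simp add: inv)
qed

text \<open>The family of translates of \<open>a\<close> is bounded by \<open>norm a\<close> because
  *-homomorphisms contract; this gives existence in \<open>diag_rep\<close>, and uniqueness holds on
  elementary tensors.\<close>

lemma
  assumes a: "a \<in> A"
  shows \<pi>_apply: "blinfun_apply (\<pi> a) (\<xi> \<otimes>\<^sub>v ket t) = blinfun_apply (\<alpha> (- t) a) \<xi> \<otimes>\<^sub>v ket t"
    and clinear_\<pi>: "clinear_op (\<pi> a)"
proof -
  obtain R where R: "clinear_op R" "norm R \<le> norm a"
    "\<And>\<xi> t. blinfun_apply R (\<xi> \<otimes>\<^sub>v ket t) = blinfun_apply (\<alpha> (- t) a) \<xi> \<otimes>\<^sub>v ket t"
    by (rule diag_op_exists[of "\<lambda>t. \<alpha> (- t) a" "norm a",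
          OF \<alpha>_clinear[OF a] norm_star_hom_le[OF cstar_A A_bop star_hom_\<alpha> a]]) auto
  have "\<pi> a = R"
    unfolding diag_rep_def by (rule the_equality) (use R(3) in \<open>auto intro: blinfun_eq_on_tensors\<close>)
  then show "blinfun_apply (\<pi> a) (\<xi> \<otimes>\<^sub>v ket t) = blinfun_apply (\<alpha> (- t) a) \<xi> \<otimes>\<^sub>v ket t" "clinear_op (\<pi> a)"
    using R by auto
qed

lemma entry_\<pi>:
  assumes "a \<in> A"
  shows "entry i j (\<pi> a) = (if i = j then \<alpha> (- j) a else 0)"
  by (rule blinfun_eqI) (auto simp: entry_def \<pi>_apply[OF assms] blinfun.zero_left)

lemma star_hom_\<pi>: "star_hom A bop \<pi>"
  unfolding star_hom_def clinear_on_def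
proof (intro conjI ballI allI)
  note C = cstar_csubspace[OF cstar_A]
  fix a assume a: "a \<in> A"
  show "\<pi> a \<in> bop" by (simp add: clinear_\<pi>[OF a])
  show "\<pi> (scale_op c a) = scale_op c (\<pi> a)" for c
    using a csubspace_scale[OF C a]
    by (intro blinfun_eq_on_tensors) (simp add: \<pi>_apply star_hom_scale[OF star_hom_\<alpha>])
  show "\<pi> (adj a) = adj (\<pi> a)"
    using a cstar_adj[OF cstar_A a]
    by (intro op_eq_entries) (simp add: entry_\<pi> entry_adj clinear_\<pi> star_hom_adj[OF star_hom_\<alpha>])
  fix b assume b: "b \<in> A"
  show "\<pi> (a + b) = \<pi> a + \<pi> b"
    using a b csubspace_add[OF C a b]
    by (intro blinfun_eq_on_tensors)
      (simp add: \<pi>_apply star_hom_add[OF star_hom_\<alpha>] blinfun.add_left tensor_vec_bilinear_simps)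
  show "\<pi> (a o\<^sub>L b) = \<pi> a o\<^sub>L \<pi> b"
    using a b cstar_mult[OF cstar_A a b]
    by (intro blinfun_eq_on_tensors) (simp add: \<pi>_apply star_hom_mult[OF star_hom_\<alpha>])
qed

lemma \<pi>_id: "\<pi> id_blinfun = id_blinfun"
  by (rule blinfun_eq_on_tensors) (simp add: \<pi>_apply[OF id_in_A] \<alpha>_id)

lemma L_0: "L 0 = id_blinfun"
  by (rule blinfun_eq_on_tensors) simp

lemma adj_L: "adj (L s) = L (- s)"
proof (rule op_eq_entries)
  fix i j
  have "i = - s + j \<longleftrightarrow> j = s + i" by (metis add.assoc add.left_neutral add.right_inverse left_minus)
  then show "entry i j (adj (L s)) = entry i j (L (- s))"
    by (auto simp: entry_adj entry_tensor_op)
qed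

text \<open>The relation s a = \<alpha>_s(a) s of the crossed product. On the t-th component it
  comes down to -(s + t) + s = -t.\<close>

lemma covariance:
  assumes a: "a \<in> A"
  shows "L s o\<^sub>L \<pi> a = \<pi> (\<alpha> s a) o\<^sub>L L s"
proof (rule blinfun_eq_on_tensors)
  fix \<xi> t
  have "\<alpha> (- (s + t)) (\<alpha> s a) = \<alpha> (- (s + t) + s) a" by (rule \<alpha>_add[OF a, symmetric])
  also have "- (s + t) + s = - t" by (simp add: minus_add add.assoc)
  finally show "blinfun_apply (L s o\<^sub>L \<pi> a) (\<xi> \<otimes>\<^sub>v ket t) = blinfun_apply (\<pi> (\<alpha> s a) o\<^sub>L L s) (\<xi> \<otimes>\<^sub>v ket t)"
    by (simp add: \<pi>_apply a \<alpha>_in)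
qed

abbreviation generators :: "('h \<times> 'g) op set"
  where "generators \<equiv> {\<pi> a o\<^sub>L L s | a s. a \<in> A}"

lemma generators_bop: "generators \<subseteq> bop"
  by (auto simp: clinear_\<pi>)

lemma generator_in_B: "a \<in> A \<Longrightarrow> \<pi> a o\<^sub>L L s \<in> B"
  unfolding crossed_product_def by (rule closed_cspan_superset) blast

lemma closed_csubspace_B: "closed_csubspace B"
  unfolding closed_csubspace_def crossed_product_def
  by (intro conjI csubspace_closed_cspan generators_bop closed_closure)

lemmas B_bop = closed_csubspace_bop[OF closed_csubspace_B]

lemma \<pi>_in_B: "a \<in> A \<Longrightarrow> \<pi> a \<in> B"
  using generator_in_B[of a 0] by (simp add: L_0)

lemma id_in_B: "id_blinfun \<in> B"
  using \<pi>_in_B[OF id_in_A] by (simp add: \<pi>_id)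

text \<open>The adjoint of a generator has the group element on the left; covariance moves it to the
  right, giving another generator.\<close>

lemma adj_in_B: "x \<in> B \<Longrightarrow> adj x \<in> B"
proof -
  have "adj g \<in> B" if gen: "g \<in> generators" for g
  proof -
    obtain a s where a: "a \<in> A" and g: "g = \<pi> a o\<^sub>L L s" using gen by blast
    have a': "adj a \<in> A" by (rule cstar_adj[OF cstar_A a])
    have "adj g = L (- s) o\<^sub>L \<pi> (adj a)"
      by (simp add: g adj_compose clinear_\<pi> a adj_L star_hom_adj[OF star_hom_\<pi> a])
    also have "\<dots> = \<pi> (\<alpha> (- s) (adj a)) o\<^sub>L L (- s)" by (rule covariance[OF a'])
    finally show ?thesis using generator_in_B[OF \<alpha>_in[OF a']] by simp
  qed
  then show "x \<in> B \<Longrightarrow> adj x \<in> B"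
    using closed_cspan_adj[OF generators_bop] unfolding crossed_product_def by blast
qed

text \<open>As a *-homomorphism into all bounded operators \<pi> is completely contractive; its
  values happen to lie in \<open>B\<close>.\<close>

lemma cb_map_\<pi>: "cb_map 1 A B \<pi>"
  using cbdd_star_hom[OF cstar_A cstar_bop_univ star_hom_\<pi>] star_hom_clinear[OF star_hom_\<pi>] \<pi>_in_B
  by (simp add: cb_map_def)

text \<open>The slice at the basis vector of the neutral element is the conditional expectation onto
  A: it keeps the generators with s = 0 and kills the others.\<close>

lemma cb_map_expectation: "cb_map 1 B A (entry 0 0)"
proof (rule cb_map_entry)
  fix x assume x: "x \<in> B"
  have c: "clinear_on B (entry 0 0)" by (simp add: clinear_on_def entry_linear)
  show "entry 0 0 x \<in> A"
  proof (rule closed_cspan_map[OF generators_bop])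
    show "entry 0 0 g \<in> A" if gen: "g \<in> generators" for g
    proof -
      obtain a s where a: "a \<in> A" and g: "g = \<pi> a o\<^sub>L L s" using gen by blast
      have "entry 0 0 g = (if s = 0 then \<alpha> (- s) a else 0)"
        by (rule blinfun_eqI) (auto simp: entry_def g \<pi>_apply[OF a] blinfun.zero_left)
      then show ?thesis using \<alpha>_in[OF a] csubspace_0[OF cstar_csubspace[OF cstar_A]] by simp
    qed
  qed (use x c closed_csubspace_A in \<open>auto simp: crossed_product_def closed_csubspace_def
      intro: linear_continuous_on bounded_linear_entry\<close>)
qed

lemma kernel_exact_A_if_B:
  assumes "cstar_algebra C" "cstar_algebra D" "star_hom C D q" "kernel_exact B C q"
  shows "kernel_exact A C q"
  by (rule kernel_exact_retract[OF closed_csubspace_A closed_csubspace_B cb_map_\<pi> cb_map_expectation _ assms])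
    (simp add: entry_\<pi> \<alpha>_0)

lemma kernel_exact_B_if_A:
  assumes nuc: "approximable A \<alpha> (\<lambda>_. True) (\<lambda>_. True)"
    and C: "cstar_algebra C" and D: "cstar_algebra D" and q: "star_hom C D q" and ex: "kernel_exact A C q"
  shows "kernel_exact B C q"
proof (rule kernel_exact_approx[OF closed_csubspace_B _ C D q])
  fix \<epsilon> :: real and S assume eps: "\<epsilon> > 0" and S: "finite S" "S \<subseteq> B"
  obtain \<phi> :: "('h \<times> 'g) op \<Rightarrow> ('h \<times> 'g tuples) op" and \<psi> F
    where \<phi>: "ccp_map B (all_mats A) \<phi>" and \<psi>: "\<forall>F. finite F \<longrightarrow> ccp_map (mats A F) B (\<psi> F)"
      and F: "finite F"
      and near: "\<forall>b\<in>S. norm (\<psi> F ((id_blinfun \<otimes>\<^sub>o proj_on F) o\<^sub>L \<phi> b o\<^sub>L (id_blinfun \<otimes>\<^sub>o proj_on F)) - b) \<le> \<epsilon>"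
    using nuc[unfolded approximable_def, rule_format, OF eps conjI[OF S]]
    by (elim exE conjE) (rule that)
  let ?p = "corner_unit F :: ('h \<times> 'g tuples) op" and ?W = "blk_alg F A"
  note As = cstar_csubspace[OF cstar_A]
  note p = corner_unit[OF F As id_in_A]
  have W: "closed_csubspace ?W" by (rule closed_csubspace_blk_alg[OF closed_csubspace_A])
  \<comment> \<open>\<open>cb_map_ccp_map\<close> asks for a unit of norm at most 1: the identity
    for \<open>B\<close>, and \<open>?p\<close> for the matrix system.\<close>
  have "is_unit_of B id_blinfun" using id_in_B by (simp add: is_unit_of_def)
  moreover have "norm (id_blinfun :: ('h \<times> 'g) op) \<le> 1" by (rule norm_projection_le) auto
  moreover have "all_mats A \<subseteq> (bop :: ('h \<times> 'g tuples) op set)"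
    unfolding all_mats_def
    by (rule closed_csubspace_bop)
      (simp add: closed_csubspace_def closed_min_tensor csubspace_min_tensor[OF A_bop order_refl])
  ultimately have "cb_map 1 B (all_mats A) \<phi>"
    by (intro cb_map_ccp_map[OF closed_csubspace_B adj_in_B _ _ _ \<phi>])
  \<comment> \<open>Compression by a projection turns \<phi> into \<phi>_F without increasing the
    constant and brings the values into M_F(A).\<close>
  moreover have "cb_map 1 (all_mats A) ?W (\<lambda>x. ?p o\<^sub>L x o\<^sub>L ?p)"
    by (rule cb_map_compose_op)
      (use p(2) in \<open>auto simp: clinear_corner_unit all_mats_def intro: compress_min_tensor[OF F closed_csubspace_A]\<close>)
  ultimately have "cb_map (1 * 1) B ?W (\<lambda>b. ?p o\<^sub>L \<phi> b o\<^sub>L ?p)"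
    by (rule cb_map_compose)
  then have 1: "cb_map 1 B ?W (\<lambda>b. ?p o\<^sub>L \<phi> b o\<^sub>L ?p)" by simp
  have "ccp_map ?W B (\<psi> F)" using \<psi>[rule_format, OF F] unfolding mats_eq_blk_alg[OF F As] .
  then have 2: "cb_map 1 ?W B (\<psi> F)"
    by (intro cb_map_ccp_map[OF W cstar_adj[OF cstar_blk_alg[OF F cstar_A]] p B_bop])
  have 3: "kernel_exact ?W C q" by (rule kernel_exact_blk_alg[OF F closed_csubspace_A C D q ex])
  show "\<exists>(W :: ('h \<times> 'g tuples) op set) \<phi> \<psi>. closed_csubspace W \<and> cb_map 1 B W \<phi> \<and> cb_map 1 W B \<psi> \<and>
      kernel_exact W C q \<and> (\<forall>v\<in>S. norm (\<psi> (\<phi> v) - v) \<le> \<epsilon>)"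
    by (rule exI[of _ ?W], rule exI[of _ "\<lambda>b. ?p o\<^sub>L \<phi> b o\<^sub>L ?p"], rule exI[of _ "\<psi> F"])
      (intro conjI W 1 2 3 near[unfolded id_tensor_proj_on[OF F]])
qed

end

text \<open>Both predicates occur positively, so the module and the comodule version lead to one
  common approximation statement.\<close>

lemma approximable_mono:
  assumes "approximable A \<alpha> adm adm_fam"
  shows "approximable A \<alpha> (\<lambda>_. True) (\<lambda>_. True)"
  using assms unfolding approximable_def
  by (elim all_forward imp_forward ex_forward conj_forward) simp_all

theorem theorem3p13:
  fixes A :: "'h op set" and \<alpha> :: "'g::group_add \<Rightarrow> 'h op \<Rightarrow> 'h op"
  assumes "unital_cstar_algebra A" and "cstar_action A \<alpha>"
    and "nuclear_module TYPE('u) A \<alpha> \<or> nuclear_comodule TYPE('u) A \<alpha>"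
  shows "exact_cstar TYPE('y) TYPE('z) A \<longleftrightarrow> exact_cstar TYPE('y) TYPE('z) (crossed_product A \<alpha>)"
proof -
  interpret unital_cstar_action A \<alpha> using assms(1,2) by unfold_locales
  have nuc: "approximable A \<alpha> (\<lambda>_. True) (\<lambda>_. True)"
    using assms(3) unfolding nuclear_module_def nuclear_comodule_def by (auto intro: approximable_mono)
  show ?thesis
    \<comment> \<open>Both sides now quantify over the same quotient maps, so the two implications
      are proved for one \<open>q\<close> at a time.\<close>
    unfolding exact_cstar_iff_kernel_exact[OF A_bop] exact_cstar_iff_kernel_exact[OF B_bop]
    using kernel_exact_A_if_B kernel_exact_B_if_A[OF nuc] by blast
qed

end
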